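(* Let $\alpha>0$, $H=\frac12(p^2-\alpha^2x^2)$, $t\in(0,\frac{\pi}{2\alpha})$, $\tau=it$, and let $\theta\in(0,\pi/2)$ with $\tan\theta=\alpha$. Let $U_\tau=\exp(t\rho(H))\circ\exp(-t\hat H)$ be the KSH transform, defined on the span $V$ of the Gaussian coherent states $\psi_Y$, $Y=(P,Q)\in\mathbb R^2$. Then: (a) $U_\tau$ intertwines the Heisenberg group representations: for all $P_0,Q_0\in\mathbb R$, $U_\tau\circ V^{(0)}_{P_0}=V^{(\tau)}_{P_0}\circ U_\tau$ and $U_\tau\circ W^{(0)}_{Q_0}=W^{(\tau)}_{Q_0}\circ U_\tau$ on $V$; (b) $U_\tau$ (extended from $V$ by continuity) is a unitary isomorphism $L^2(\mathbb R,dx)\otimes\sqrt{dx}\to\mathcal H_{\mathcal P_\tau}$; (c) for $Y=(P,Q)\in\mathbb R^2$, $$(U_\tau\psi_Y)(p,x)=\pi^{-1/2}\left|\frac{\sin\theta}{\sin(\theta+\alpha t)}\right|^{1/2}e^{-\int_0^t\left(L_H(p_{is},x_{is})-L_H(P_{is},Q_{is})\right)ds}\,e^{-iP_\tau(w_\tau-Q_\tau)-\frac{b_\tau}{2}(w_\tau-Q_\tau)^2}\otimes\sqrt{dw_\tau}$$ $$=\pi^{-1/2}\left|\frac{\sin\theta}{\sin(\theta+\alpha t)}\right|^{1/2}e^{-iP(x-Q)}\exp\!\left(\frac{-\cos\theta\sin(\alpha t)(p-P)^2-\sin\theta\cos(\alpha t)(x-Q)^2-2i\cos\theta\sin(\alpha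 t)(x-Q)(p-P)}{2\sin(\alpha t+\theta)}\right)\otimes\sqrt{dw_\tau},$$ where $b_\tau=\alpha\cot(\theta+\alpha t)$.
   Context: Work on $\mathbb R^2$ with coordinates $(x,p)$, $\omega=dx\wedge dp$, Hamiltonian vector fields $X_f=\frac{\partial f}{\partial p}\partial_x-\frac{\partial f}{\partial x}\partial_p$, trivial prequantum line bundle with connection $\nabla_X\psi=X(\psi)+i\,p\,dx(X)\psi$. The half-form corrected prequantum operator of $f$ is $\rho(f)=(i\nabla_{X_f}+f)\otimes1+i\otimes\mathcal L_{X_f}=\left(iX_f-(p\frac{\partial f}{\partial p}-f)\right)\otimes1+i\otimes\mathcal L_{X_f}$, acting on $\psi\otimes\sqrt{\mu}$ ($\mu$ a complex 1-form, $\mathcal L_X$ the Lie derivative on half-forms). Put $L_H=p\frac{\partial H}{\partial p}-H=\frac12(p^2+\alpha^2x^2)$ and $\hat H=\frac12\left(-\frac{d^2}{dx^2}-\alpha^2x^2\right)$. Complexified flow: for $s\in\mathbb R$, $p_{is}=\cos(\alpha s)p+i\alpha\sin(\alpha s)x$, $x_{is}=\frac{i}{\alpha}\sin(\alpha s)p+\cos(\alpha s)x$; likewise $P_{is},Q_{is}$ with $(p,x)$ replaced by $(P,Q)$; $P_\tau=P_{it},Q_\tau=Q_{it}$, and $w_\tau=x_{it}=\cos(\alpha t)x+\frac{i}{\alpha}\sin(\alpha t)p$. Schrödinger space: $\mathcal H_{Sch}=L^2(\mathbb R,dx)\otimes\sqrt{dx}$ with $\langle\psi_1,\psi_2\rangle=\sqrt\pi\int_{\mathbb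 R}\overline{\psi_1}\psi_2\,dx$. Gaussian coherent states: $\psi_Y(x)=\pi^{-1/2}e^{-iP(x-Q)-\frac12(x-Q)^2}\otimes\sqrt{dx}$, $Y=(P,Q)$; $V$ is their finite linear span. $\mathcal H_{\mathcal P_\tau}$ (for $t\in(0,\frac\pi{2\alpha})$) is the completion of the space of $\psi\otimes\sqrt{dw_\tau}$, $\psi\in C^\infty(\mathbb R^2)$, with $\nabla_{X_{w_\tau}}\psi=0$ and finite norm, for the inner product $\langle\psi_1\otimes\sqrt{dw_\tau},\psi_2\otimes\sqrt{dw_\tau}\rangle=\int_{\mathbb R^2}\overline{\psi_1}\psi_2\sqrt{\frac{dw_\tau\wedge d\bar w_\tau}{(-2i)dx\wedge dp}}\,dx\,dp$. Definition of $U_\tau$ on $V$: $\exp(-t\hat H)\psi_Y$ is the solution at time $t$ of $\partial_s\phi_s=-\hat H\phi_s$, $\phi_0=\psi_Y$ (a Gaussian); and for $\phi$ entire in $x$, $\exp(t\rho(H))(\phi\otimes\sqrt{dx})=e^{-\int_0^tL_H(p_{is},x_{is})ds}\,\phi(w_\tau)\otimes\sqrt{dw_\tau}$ (analytic continuation to imaginary time of the real-time prequantum flow); extend linearly. Heisenberg operators: on $\mathcal H_{Sch}$, $(V^{(0)}_{P_0}\phi)(x)=e^{-iP_0x}\phi(x)$, $(W^{(0)}_{Q_0}\phi)(x)=\phi(x-Q_0)$; on $\mathcal H_{\mathcal P_\tau}$, $V^{(\tau)}_{P_0}=e^{-iP_0\rho(x)}$, i.e. $(V^{(\tau)}_{P_0}\psi)(x,p)=e^{-iP_0x}\psi(x,p-P_0)$,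 and $W^{(\tau)}_{Q_0}=e^{iQ_0\rho(p)}$, i.e. $(W^{(\tau)}_{Q_0}\psi)(x,p)=\psi(x-Q_0,p)$ (acting on the function factor). *)

theory Defs
  imports "HOL-Analysis.Analysis"
begin

text \<open>Conventions. Half-form factors (sqrt dx, sqrt dw_tau) are formal tags; we work with the
  function factors only. Points of R^2 are pairs (x, p). alpha > 0 and t are parameters.\<close>

definition psiY :: "real \<Rightarrow> real \<Rightarrow> real \<Rightarrow> complex" where
  "psiY P Q x = of_real (1 / sqrt pi) *
     exp (- \<i> * of_real P * of_real (x - Q) - of_real ((x - Q)^2 / 2))"

definition lin_comb :: "nat \<Rightarrow> (nat \<Rightarrow> complex) \<Rightarrow> (nat \<Rightarrow> real) \<Rightarrow> (nat \<Rightarrow> real)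
    \<Rightarrow> real \<Rightarrow> complex" where
  "lin_comb n c P Q = (\<lambda>x. \<Sum>k<n. c k * psiY (P k) (Q k) x)"

definition in_V :: "(real \<Rightarrow> complex) \<Rightarrow> bool" where
  "in_V f \<longleftrightarrow> (\<exists>n c P Q. f = lin_comb n c P Q)"

definition L2R :: "(real \<Rightarrow> complex) set" where
  "L2R = {f. f \<in> borel_measurable lborel \<and> (\<integral>\<^sup>+ x. ennreal ((cmod (f x))^2) \<partial>lborel) < \<infinity>}"

definition ip_Sch :: "(real \<Rightarrow> complex) \<Rightarrow> (real \<Rightarrow> complex) \<Rightarrow> complex" where
  "ip_Sch f g = of_real (sqrt pi) * (LINT x|lborel. cnj (f x) * g x)"

definition normsq_Sch :: "(real \<Rightarrow> complex) \<Rightarrow> ennreal" where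
  "normsq_Sch f = ennreal (sqrt pi) * (\<integral>\<^sup>+ x. ennreal ((cmod (f x))^2) \<partial>lborel)"

definition heat_sol :: "real \<Rightarrow> real \<Rightarrow> (real \<Rightarrow> complex) \<Rightarrow> (real \<Rightarrow> real \<Rightarrow> complex) \<Rightarrow> bool" where
  "heat_sol \<alpha> t f \<phi> \<longleftrightarrow>
     (\<forall>x. \<phi> 0 x = f x) \<and>
     (\<exists>a b c :: real \<Rightarrow> complex.
        a differentiable_on {0..t} \<and> b differentiable_on {0..t} \<and> c differentiable_on {0..t} \<and>
        (\<forall>s\<in>{0..t}. \<forall>x. \<phi> s x = exp (a s * of_real (x^2) + b s * of_real x + c s))) \<and>
     (\<forall>s\<in>{0..t}. \<exists>\<phi>x \<phi>xx :: real \<Rightarrow> complex.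
        (\<forall>y. (\<phi> s has_vector_derivative \<phi>x y) (at y)) \<and>
        (\<forall>y. (\<phi>x has_vector_derivative \<phi>xx y) (at y)) \<and>
        (\<forall>x. ((\<lambda>r. \<phi> r x) has_vector_derivative
               (- (of_real (1/2) * (- \<phi>xx x - of_real (\<alpha>^2 * x^2) * \<phi> s x))))
             (at s within {0..t})))"

definition heat_evol :: "real \<Rightarrow> real \<Rightarrow> (real \<Rightarrow> complex) \<Rightarrow> real \<Rightarrow> complex" where
  "heat_evol \<alpha> t f = (THE g. \<exists>\<phi>. heat_sol \<alpha> t f \<phi> \<and> g = \<phi> t)"

definition p_is :: "real \<Rightarrow> real \<Rightarrow> real \<Rightarrow> real \<Rightarrow> complex" where
  "p_is \<alpha> s x p = of_real (cos (\<alpha> * s) * p) + \<i> * of_real (\<alpha> * sin (\<alpha> * s) * x)"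

definition x_is :: "real \<Rightarrow> real \<Rightarrow> real \<Rightarrow> real \<Rightarrow> complex" where
  "x_is \<alpha> s x p = \<i> * of_real (sin (\<alpha> * s) / \<alpha> * p) + of_real (cos (\<alpha> * s) * x)"

definition w_tau :: "real \<Rightarrow> real \<Rightarrow> real \<Rightarrow> real \<Rightarrow> complex" where
  "w_tau \<alpha> t x p = x_is \<alpha> t x p"

text \<open>L_H = p dH/dp - H = (p^2 + alpha^2 x^2)/2  (evaluated at complex arguments)\<close>
definition L_H :: "real \<Rightarrow> complex \<Rightarrow> complex \<Rightarrow> complex" where
  "L_H \<alpha> p x = (p^2 + of_real (\<alpha>^2) * x^2) / 2"

definition entire_ext :: "(real \<Rightarrow> complex) \<Rightarrow> complex \<Rightarrow> complex" where
  "entire_ext \<phi> = (THE g. g holomorphic_on UNIV \<and> (\<forall>x::real. g (of_real x) = \<phi> x))"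

definition exp_rhoH :: "real \<Rightarrow> real \<Rightarrow> (real \<Rightarrow> complex) \<Rightarrow> real \<times> real \<Rightarrow> complex" where
  "exp_rhoH \<alpha> t \<phi> = (\<lambda>(x, p).
     exp (- integral {0..t} (\<lambda>s. L_H \<alpha> (p_is \<alpha> s x p) (x_is \<alpha> s x p)))
     * entire_ext \<phi> (w_tau \<alpha> t x p))"

definition KSH_gauss :: "real \<Rightarrow> real \<Rightarrow> real \<Rightarrow> real \<Rightarrow> real \<times> real \<Rightarrow> complex" where
  "KSH_gauss \<alpha> t P Q = exp_rhoH \<alpha> t (heat_evol \<alpha> t (psiY P Q))"

definition KSH :: "real \<Rightarrow> real \<Rightarrow> (real \<Rightarrow> complex) \<Rightarrow> real \<times> real \<Rightarrow> complex" where
  "KSH \<alpha> t f = (SOME g. \<exists>n c P Q. f = lin_comb n c P Q \<and>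
       g = (\<lambda>z. \<Sum>k<n. c k * KSH_gauss \<alpha> t (P k) (Q k) z))"

fun Ck :: "nat \<Rightarrow> (real \<times> real \<Rightarrow> complex) \<Rightarrow> bool" where
  "Ck 0 f = continuous_on UNIV f"
| "Ck (Suc n) f = (\<exists>fx fp. (\<forall>z. (f has_derivative (\<lambda>h. fst h *\<^sub>R fx z + snd h *\<^sub>R fp z)) (at z))
                        \<and> Ck n fx \<and> Ck n fp)"

definition smooth2 :: "(real \<times> real \<Rightarrow> complex) \<Rightarrow> bool" where
  "smooth2 f \<longleftrightarrow> (\<forall>n. Ck n f)"

text \<open>Hamiltonian vector field of w_tau: X_w = (dw/dp) d_x - (dw/dx) d_p, with
  dw/dx = cos(alpha t), dw/dp = (i/alpha) sin(alpha t). The connection is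
  nabla_X psi = X(psi) + i p dx(X) psi, extended complex-linearly in X.\<close>
definition Xw_x :: "real \<Rightarrow> real \<Rightarrow> complex" where
  "Xw_x \<alpha> t = \<i> * of_real (sin (\<alpha> * t) / \<alpha>)"

definition Xw_p :: "real \<Rightarrow> real \<Rightarrow> complex" where
  "Xw_p \<alpha> t = - of_real (cos (\<alpha> * t))"

definition polarized :: "real \<Rightarrow> real \<Rightarrow> (real \<times> real \<Rightarrow> complex) \<Rightarrow> bool" where
  "polarized \<alpha> t \<psi> \<longleftrightarrow> (\<forall>z. \<exists>D. (\<psi> has_derivative D) (at z) \<and>
      Xw_x \<alpha> t * D (1, 0) + Xw_p \<alpha> t * D (0, 1) + \<i> * of_real (snd z) * Xw_x \<alpha> t * \<psi> z = 0)"

text \<open>Density sqrt( dw_tau ^ d(conj w_tau) / ((-2i) dx ^ dp) ).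
  For 1-forms u = u1 dx + u2 dp and v = v1 dx + v2 dp, u ^ v = (u1 v2 - u2 v1) dx ^ dp.\<close>
definition vol_density :: "real \<Rightarrow> real \<Rightarrow> complex" where
  "vol_density \<alpha> t =
     (let u1 = of_real (cos (\<alpha> * t)); u2 = \<i> * of_real (sin (\<alpha> * t) / \<alpha>);
          v1 = cnj u1; v2 = cnj u2
      in csqrt ((u1 * v2 - u2 * v1) / (- 2 * \<i>)))"

definition ip_P :: "real \<Rightarrow> real \<Rightarrow> (real \<times> real \<Rightarrow> complex) \<Rightarrow> (real \<times> real \<Rightarrow> complex) \<Rightarrow> complex" where
  "ip_P \<alpha> t f g = (LINT z|lborel. cnj (f z) * g z * vol_density \<alpha> t)"

definition normsq_P :: "real \<Rightarrow> real \<Rightarrow> (real \<times> real \<Rightarrow> complex) \<Rightarrow> ennreal" where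
  "normsq_P \<alpha> t f = (\<integral>\<^sup>+ z. ennreal ((cmod (f z))^2 * cmod (vol_density \<alpha> t)) \<partial>lborel)"

definition S_pol :: "real \<Rightarrow> real \<Rightarrow> (real \<times> real \<Rightarrow> complex) set" where
  "S_pol \<alpha> t = {\<psi>. smooth2 \<psi> \<and> polarized \<alpha> t \<psi> \<and> normsq_P \<alpha> t \<psi> < \<infinity>}"

text \<open>Its completion, realised as the L^2 closure (elements up to a.e. equality).\<close>
definition H_P :: "real \<Rightarrow> real \<Rightarrow> (real \<times> real \<Rightarrow> complex) set" where
  "H_P \<alpha> t = {g. g \<in> borel_measurable lborel \<and>
      (\<exists>\<psi>s. (\<forall>n. \<psi>s n \<in> S_pol \<alpha> t) \<and>
             (\<lambda>n. normsq_P \<alpha> t (\<lambda>z. \<psi>s n z - g z)) \<longlonglongrightarrow> 0)}"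

definition V0 :: "real \<Rightarrow> (real \<Rightarrow> complex) \<Rightarrow> real \<Rightarrow> complex" where
  "V0 P0 \<phi> = (\<lambda>x. exp (- \<i> * of_real (P0 * x)) * \<phi> x)"

definition W0 :: "real \<Rightarrow> (real \<Rightarrow> complex) \<Rightarrow> real \<Rightarrow> complex" where
  "W0 Q0 \<phi> = (\<lambda>x. \<phi> (x - Q0))"

definition Vtau :: "real \<Rightarrow> (real \<times> real \<Rightarrow> complex) \<Rightarrow> real \<times> real \<Rightarrow> complex" where
  "Vtau P0 \<psi> = (\<lambda>(x, p). exp (- \<i> * of_real (P0 * x)) * \<psi> (x, p - P0))"

definition Wtau :: "real \<Rightarrow> (real \<times> real \<Rightarrow> complex) \<Rightarrow> real \<times> real \<Rightarrow> complex" where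
  "Wtau Q0 \<psi> = (\<lambda>(x, p). \<psi> (x - Q0, p))"

definition unitary_ext :: "real \<Rightarrow> real \<Rightarrow> ((real \<Rightarrow> complex) \<Rightarrow> real \<times> real \<Rightarrow> complex) \<Rightarrow> bool" where
  "unitary_ext \<alpha> t T \<longleftrightarrow>
     (\<forall>f\<in>L2R. T f \<in> H_P \<alpha> t) \<and>
     (\<forall>f\<in>L2R. \<forall>g\<in>L2R. \<forall>c. AE z in lborel. T (\<lambda>x. f x + c * g x) z = T f z + c * T g z) \<and>
     (\<forall>f\<in>L2R. \<forall>g\<in>L2R. ip_P \<alpha> t (T f) (T g) = ip_Sch f g) \<and>
     (\<forall>g\<in>H_P \<alpha> t. \<exists>f\<in>L2R. AE z in lborel. T f z = g z) \<and>
     (\<forall>f. in_V f \<longrightarrow> (AE z in lborel. T f z = KSH \<alpha> t f z))"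

end

theory Submission
  imports Defs "HOL-Probability.Probability" "HOL-Complex_Analysis.Complex_Analysis"
begin

text \<open>
  Solving the heat equation inside the class of Gaussians reduces it to a Riccati system, which gives
  the closed formula for the transform of a coherent state. Up to a constant, this formula says that
  \<open>U\<^sub>\<tau>\<close> is a windowed Fourier transform
  \<open>f \<mapsto> \<integral> exp (-i p (x - y) - \<gamma> (x - y)\<^sup>2 / 2) f(y) dy\<close> with the Gaussian window of width
  \<open>\<gamma> = \<alpha> cot (\<alpha> t)\<close>. This integral makes sense for every square integrable \<open>f\<close>, its kernel is visibly
  covariant under the Heisenberg group, and it is isometric (up to a factor) on the span of the
  coherent states because their Gram matrices agree; density of the span extends this to all of
  \<open>L\<^sup>2\<close>. A polarized function is a Gaussian times an entire function of one complex variable, so by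
  the mean value property the integral transform has a reproducing kernel on such functions; applying
  the adjoint to truncations of a polarized function and passing to the limit yields a preimage.
\<close>

section \<open>Square integrable functions\<close>

text \<open>The two factors of the transform cannot be extended to square integrable functions one
  at a time: once theta + alpha t exceeds pi / 2, the heat flow of the inverted oscillator turns a
  coherent state into a growing Gaussian, and only the factor from the flow of H makes the composite
  decay again. Hence the closed formula on coherent states is the single link between the definition
  of the transform and the integral operator that extends it. The width is forced: for fixed y the
  kernel is annihilated by i d/dx - gamma d/dp - p, and this operator is a multiple of the covariant
  derivative along the Hamiltonian field of w_tau exactly when gamma = alpha cot (alpha t). The
  remaining constant is forced by the amplitude of a coherent state, so unitarity is a check on
  constants rather than a normalisation. Equal Gram matrices give an isometry but say nothing about
  its range; there the polarization condition has to be used. Functions rather than classes are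
  carried throughout, because the transform has well-defined point values that depend continuously
  on the argument.\<close>

definition sqint :: "'a measure \<Rightarrow> ('a \<Rightarrow> complex) \<Rightarrow> bool" where
  "sqint M f \<longleftrightarrow> f \<in> borel_measurable M \<and> integrable M (\<lambda>x. (cmod (f x))\<^sup>2)"

definition l2 :: "'a measure \<Rightarrow> ('a \<Rightarrow> complex) \<Rightarrow> real" where
  "l2 M f = sqrt (LINT x|M. (cmod (f x))\<^sup>2)"

lemma sqint_measurable [measurable_dest]: "sqint M f \<Longrightarrow> f \<in> borel_measurable M"
  by (simp add: sqint_def)

lemma l2_nonneg [simp]: "0 \<le> l2 M f"
  by (simp add: l2_def)

lemma l2_power2: "(l2 M f)\<^sup>2 = (LINT x|M. (cmod (f x))\<^sup>2)"
  by (simp add: l2_def)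

lemma nn_integral_l2:
  "sqint M f \<Longrightarrow> (\<integral>\<^sup>+ x. ennreal ((cmod (f x))\<^sup>2) \<partial>M) = ennreal ((l2 M f)\<^sup>2)"
  unfolding l2_power2 sqint_def by (intro nn_integral_eq_integral) auto

lemma sqintI_nn_integral:
  "f \<in> borel_measurable M \<Longrightarrow> (\<integral>\<^sup>+ x. ennreal ((cmod (f x))\<^sup>2) \<partial>M) < \<infinity> \<Longrightarrow> sqint M f"
  unfolding sqint_def by (auto intro!: integrableI_nonneg)

lemma sqint_iff_nn_integral:
  "f \<in> borel_measurable M \<Longrightarrow>
    sqint M f \<longleftrightarrow> (\<integral>\<^sup>+ x. ennreal ((cmod (f x))\<^sup>2) \<partial>M) < \<infinity>"
  by (metis sqintI_nn_integral nn_integral_l2 ennreal_less_top infinity_ennreal_def)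

lemma sqint_bound:
  assumes "f \<in> borel_measurable M" "integrable M g" "\<And>x. (cmod (f x))\<^sup>2 \<le> g x"
  shows "sqint M f"
  unfolding sqint_def
proof
  show "integrable M (\<lambda>x. (cmod (f x))\<^sup>2)"
    using assms(1)
    by (intro Bochner_Integration.integrable_bound[OF assms(2)])
       (auto intro!: AE_I2 order_trans[OF assms(3)])
qed fact

lemma power2_add_le: "(a + b)\<^sup>2 \<le> 2 * a\<^sup>2 + 2 * (b::real)\<^sup>2"
  using sum_squares_bound[of a b] by (simp add: power2_sum)

lemma sqint_zero [simp]: "sqint M (\<lambda>x. 0)"
  by (simp add: sqint_def)

lemma sqint_add:
  assumes "sqint M f" "sqint M g"
  shows "sqint M (\<lambda>x. f x + g x)"
proof (rule sqint_bound)
  show "(\<lambda>x. f x + g x) \<in> borel_measurable M" using assms by measurable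
  show "integrable M (\<lambda>x. 2 * (cmod (f x))\<^sup>2 + 2 * (cmod (g x))\<^sup>2)"
    using assms by (auto simp: sqint_def)
  show "(cmod (f x + g x))\<^sup>2 \<le> 2 * (cmod (f x))\<^sup>2 + 2 * (cmod (g x))\<^sup>2" for x
    by (rule order_trans[OF power_mono[OF norm_triangle_ineq] power2_add_le]) auto
qed

lemma sqint_cmult:
  assumes "sqint M f"
  shows "sqint M (\<lambda>x. c * f x)"
  using assms by (auto simp: sqint_def norm_mult power_mult_distrib)

lemma sqint_uminus: "sqint M f \<Longrightarrow> sqint M (\<lambda>x. - f x)"
  using sqint_cmult[of M f "-1"] by simp

lemma sqint_diff: "sqint M f \<Longrightarrow> sqint M g \<Longrightarrow> sqint M (\<lambda>x. f x - g x)"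
  using sqint_add[of M f "\<lambda>x. - g x"] sqint_uminus[of M g] by simp

lemma sqint_sum: "(\<And>i. i \<in> I \<Longrightarrow> sqint M (f i)) \<Longrightarrow> sqint M (\<lambda>x. \<Sum>i\<in>I. f i x)"
  by (induction I rule: infinite_finite_induct) (simp_all add: sqint_add)

lemma sqint_unimodular:
  assumes "sqint M f" "g \<in> borel_measurable M" "\<And>x. cmod (g x) = cmod (f x)"
  shows "sqint M g"
  using assms by (simp add: sqint_def)

lemma sqint_norm_mult_integrable:
  assumes "sqint M f" "sqint M g"
  shows "integrable M (\<lambda>x. cmod (f x) * cmod (g x))"
proof (rule Bochner_Integration.integrable_bound)
  show "integrable M (\<lambda>x. (cmod (f x))\<^sup>2 + (cmod (g x))\<^sup>2)"
    using assms by (auto simp: sqint_def)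
  show "(\<lambda>x. cmod (f x) * cmod (g x)) \<in> borel_measurable M" using assms by measurable
  show "AE x in M. norm (cmod (f x) * cmod (g x)) \<le> norm ((cmod (f x))\<^sup>2 + (cmod (g x))\<^sup>2)"
  proof (intro AE_I2)
    fix x
    have "2 * (cmod (f x) * cmod (g x)) \<le> (cmod (f x))\<^sup>2 + (cmod (g x))\<^sup>2"
      using sum_squares_bound[of "cmod (f x)" "cmod (g x)"] by simp
    moreover have "0 \<le> cmod (f x) * cmod (g x)" by simp
    ultimately show "norm (cmod (f x) * cmod (g x)) \<le> norm ((cmod (f x))\<^sup>2 + (cmod (g x))\<^sup>2)"
      by (smt (verit) real_norm_def)
  qed
qed

lemma sqint_mult_integrable:
  assumes "sqint M f" "sqint M g"
  shows "integrable M (\<lambda>x. f x * g x)"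
proof (rule Bochner_Integration.integrable_bound[OF sqint_norm_mult_integrable[OF assms]])
  show "(\<lambda>x. f x * g x) \<in> borel_measurable M" using assms by measurable
qed (simp add: norm_mult)

lemma borel_measurable_cnj [measurable]: "cnj \<in> borel_measurable borel"
  by (intro borel_measurable_continuous_onI continuous_intros)

lemma sqint_cnj: "sqint M f \<Longrightarrow> sqint M (\<lambda>x. cnj (f x))"
  by (rule sqint_unimodular) auto

lemma sqint_cnj_mult_integrable:
  "sqint M f \<Longrightarrow> sqint M g \<Longrightarrow> integrable M (\<lambda>x. cnj (f x) * g x)"
  by (intro sqint_mult_integrable sqint_cnj)

text \<open>Cauchy-Schwarz: expand the nonnegative integral of the square of
  \<open>s * cmod (f x) - r * cmod (g x)\<close>, where \<open>r\<close> and \<open>s\<close> are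
  the two norms, and cancel \<open>r * s\<close>. If this product is 0, one of the functions
  vanishes almost everywhere.\<close>

lemma integral_norm_mult_le_l2:
  assumes "sqint M f" "sqint M g"
  shows "(LINT x|M. cmod (f x) * cmod (g x)) \<le> l2 M f * l2 M g"
proof -
  let ?r = "l2 M f" and ?s = "l2 M g" and ?I = "LINT x|M. cmod (f x) * cmod (g x)"
  have int: "integrable M (\<lambda>x. (cmod (f x))\<^sup>2)" "integrable M (\<lambda>x. (cmod (g x))\<^sup>2)"
    "integrable M (\<lambda>x. cmod (f x) * cmod (g x))"
    using assms sqint_norm_mult_integrable[OF assms] by (auto simp: sqint_def)
  have "0 \<le> (LINT x|M. (?s * cmod (f x) - ?r * cmod (g x))\<^sup>2)"
    by simp
  also have "\<dots> = (LINT x|M. ?s\<^sup>2 * (cmod (f x))\<^sup>2 + ?r\<^sup>2 * (cmod (g x))\<^sup>2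
      - 2 * ?r * ?s * (cmod (f x) * cmod (g x)))"
    by (intro Bochner_Integration.integral_cong) (auto simp: power2_eq_square algebra_simps)
  also have "\<dots> = ?s\<^sup>2 * ?r\<^sup>2 + ?r\<^sup>2 * ?s\<^sup>2 - 2 * ?r * ?s * ?I"
    using int by (simp add: l2_power2)
  finally have *: "(?r * ?s) * ?I \<le> (?r * ?s) * (?r * ?s)"
    by (simp add: power2_eq_square algebra_simps)
  show ?thesis
  proof (cases "?r * ?s = 0")
    case False
    then have "?r * ?s > 0" by (metis l2_nonneg mult_nonneg_nonneg order_le_less)
    with * show ?thesis by (simp only: mult_le_cancel_left_pos)
  next
    case True
    then have "(LINT x|M. (cmod (f x))\<^sup>2) = 0 \<or> (LINT x|M. (cmod (g x))\<^sup>2) = 0"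
      by (auto simp flip: l2_power2)
    then have "(AE x in M. cmod (f x) = 0) \<or> (AE x in M. cmod (g x) = 0)"
      using int by (auto simp: integral_nonneg_eq_0_iff_AE)
    then have "AE x in M. cmod (f x) * cmod (g x) = 0" by auto
    then have "?I = 0" by (intro integral_eq_zero_AE)
    with True show ?thesis by simp
  qed
qed

lemma norm_integral_mult_le_l2:
  assumes "sqint M f" "sqint M g"
  shows "cmod (LINT x|M. f x * g x) \<le> l2 M f * l2 M g"
  using integral_norm_bound[of M "\<lambda>x. f x * g x"] integral_norm_mult_le_l2[OF assms]
  by (simp add: norm_mult)

lemma l2_cnj [simp]: "l2 M (\<lambda>x. cnj (f x)) = l2 M f"
  by (simp add: l2_def)

lemma norm_inner_le_l2:
  assumes "sqint M f" "sqint M g"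
  shows "cmod (LINT x|M. cnj (f x) * g x) \<le> l2 M f * l2 M g"
  using norm_integral_mult_le_l2[OF sqint_cnj[OF assms(1)] assms(2)] by simp

lemma l2_triangle:
  assumes "sqint M f" "sqint M g"
  shows "l2 M (\<lambda>x. f x + g x) \<le> l2 M f + l2 M g"
proof (rule power2_le_imp_le)
  have int: "integrable M (\<lambda>x. (cmod (f x))\<^sup>2)" "integrable M (\<lambda>x. (cmod (g x))\<^sup>2)"
    "integrable M (\<lambda>x. cmod (f x) * cmod (g x))"
    using assms sqint_norm_mult_integrable[OF assms] by (auto simp: sqint_def)
  have "(l2 M (\<lambda>x. f x + g x))\<^sup>2 = (LINT x|M. (cmod (f x + g x))\<^sup>2)"
    by (simp add: l2_power2)
  also have "\<dots> \<le> (LINT x|M. (cmod (f x))\<^sup>2 + (cmod (g x))\<^sup>2 + 2 * (cmod (f x) * cmod (g x)))"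
  proof (rule integral_mono)
    show "integrable M (\<lambda>x. (cmod (f x + g x))\<^sup>2)"
      using sqint_add[OF assms] by (simp add: sqint_def)
    show "(cmod (f x + g x))\<^sup>2 \<le> (cmod (f x))\<^sup>2 + (cmod (g x))\<^sup>2 + 2 * (cmod (f x) * cmod (g x))" for x
      using power_mono[OF norm_triangle_ineq[of "f x" "g x"], of 2]
      by (simp add: power2_sum algebra_simps)
  qed (use int in auto)
  also have "\<dots> = (l2 M f)\<^sup>2 + (l2 M g)\<^sup>2 + 2 * (LINT x|M. cmod (f x) * cmod (g x))"
    using int by (simp add: l2_power2)
  also have "\<dots> \<le> (l2 M f + l2 M g)\<^sup>2"
    using integral_norm_mult_le_l2[OF assms] by (simp add: power2_sum)
  finally show "(l2 M (\<lambda>x. f x + g x))\<^sup>2 \<le> (l2 M f + l2 M g)\<^sup>2" .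
qed simp

lemma l2_cmult: "l2 M (\<lambda>x. c * f x) = cmod c * l2 M f"
  by (simp add: l2_def norm_mult power_mult_distrib real_sqrt_mult)

lemma l2_minus_commute: "l2 M (\<lambda>x. f x - g x) = l2 M (\<lambda>x. g x - f x)"
  by (simp add: l2_def norm_minus_commute)

lemma l2_triangle_diff:
  assumes "sqint M f" "sqint M g" "sqint M h"
  shows "l2 M (\<lambda>x. f x - h x) \<le> l2 M (\<lambda>x. f x - g x) + l2 M (\<lambda>x. g x - h x)"
  using l2_triangle[OF sqint_diff[OF assms(1,2)] sqint_diff[OF assms(2,3)]] by simp

lemma l2_diff_le:
  assumes "sqint M f" "sqint M g"
  shows "\<bar>l2 M f - l2 M g\<bar> \<le> l2 M (\<lambda>x. f x - g x)"
  using l2_triangle[OF sqint_diff[OF assms] assms(2)]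
    l2_triangle[OF sqint_diff[OF assms(2,1)] assms(1)] l2_minus_commute[of M f g]
  by simp

lemma l2_tendsto:
  assumes "\<And>n. sqint M (f n)" "sqint M g" "(\<lambda>n. l2 M (\<lambda>x. f n x - g x)) \<longlonglongrightarrow> 0"
  shows "(\<lambda>n. l2 M (f n)) \<longlonglongrightarrow> l2 M g"
proof -
  have "(\<lambda>n. l2 M (f n) - l2 M g) \<longlonglongrightarrow> 0"
    by (rule Lim_null_comparison[OF _ assms(3)])
       (use l2_diff_le[OF assms(1,2)] in \<open>auto intro!: always_eventually\<close>)
  then show ?thesis by (simp add: LIM_zero_iff)
qed

lemma l2_eq_0_AE:
  assumes "sqint M f" "l2 M f = 0"
  shows "AE x in M. f x = 0"
  using assms by (auto simp: l2_def sqint_def integral_nonneg_eq_0_iff_AE)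

text \<open>Fatou's lemma for squared moduli. It puts a pointwise limit into L2 from a norm bound
  that holds only eventually; completeness and the passage of the isometry from the span of the
  coherent states to L2 both rest on it.\<close>

lemma l2_fatou:
  assumes f: "\<And>n. sqint M (f n)" and g: "g \<in> borel_measurable M"
    and lim: "AE x in M. (\<lambda>n. f n x) \<longlonglongrightarrow> g x"
    and le: "\<And>n. n \<ge> N \<Longrightarrow> l2 M (f n) \<le> B"
  shows "sqint M g" "l2 M g \<le> B"
proof -
  have [measurable]: "f n \<in> borel_measurable M" for n using f by (simp add: sqint_def)
  note g[measurable]
  have B: "0 \<le> B" using le[of N] l2_nonneg[of M "f N"] by linarith
  have "(\<integral>\<^sup>+ x. ennreal ((cmod (g x))\<^sup>2) \<partial>M)
      = (\<integral>\<^sup>+ x. liminf (\<lambda>n. ennreal ((cmod (f n x))\<^sup>2)) \<partial>M)"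
  proof (intro nn_integral_cong_AE, use lim in eventually_elim)
    case (elim x)
    have "(\<lambda>n. ennreal ((cmod (f n x))\<^sup>2)) \<longlonglongrightarrow> ennreal ((cmod (g x))\<^sup>2)"
      by (intro tendsto_ennrealI tendsto_intros elim)
    then show ?case by (intro lim_imp_Liminf[symmetric]) auto
  qed
  also have "\<dots> \<le> liminf (\<lambda>n. \<integral>\<^sup>+ x. ennreal ((cmod (f n x))\<^sup>2) \<partial>M)"
    by (rule nn_integral_liminf) measurable
  also have "\<dots> \<le> liminf (\<lambda>n. ennreal (B\<^sup>2))"
    by (rule Liminf_mono)
       (auto simp: nn_integral_l2[OF f] eventually_sequentially
         intro!: exI[of _ N] ennreal_leI power_mono le)
  also have "\<dots> = ennreal (B\<^sup>2)" by (simp add: Liminf_const)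
  finally have *: "(\<integral>\<^sup>+ x. ennreal ((cmod (g x))\<^sup>2) \<partial>M) \<le> ennreal (B\<^sup>2)" .
  then show sq: "sqint M g"
    by (intro sqintI_nn_integral g) (auto intro: le_less_trans)
  from * have "(l2 M g)\<^sup>2 \<le> B\<^sup>2"
    by (simp add: nn_integral_l2[OF sq])
  then show "l2 M g \<le> B" using B by (rule power2_le_imp_le)
qed

text \<open>Consecutive differences \<open>d n\<close> have squared norm at most 4^-n, so the sum of
  2^n |d n|^2 still has a finite integral and is finite almost everywhere. That forces the
  telescoping series to converge absolutely at almost every point.\<close>

lemma l2_complete_fast:
  assumes f: "\<And>n. sqint M (f n)"
    and fast: "\<And>m n. n \<le> m \<Longrightarrow> l2 M (\<lambda>x. f m x - f n x) \<le> (1/2) ^ n"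
  shows "\<exists>g. sqint M g \<and> (\<lambda>n. l2 M (\<lambda>x. f n x - g x)) \<longlonglongrightarrow> 0"
proof -
  have [measurable]: "f n \<in> borel_measurable M" for n using f by (simp add: sqint_def)
  define d where "d n x = f (Suc n) x - f n x" for n x
  have d: "sqint M (d n)" for n unfolding d_def by (intro sqint_diff f)
  have [measurable]: "d n \<in> borel_measurable M" for n using d by (simp add: sqint_def)
  have "(\<integral>\<^sup>+ x. (\<Sum>n. ennreal (2^n * (cmod (d n x))\<^sup>2)) \<partial>M)
      = (\<Sum>n. \<integral>\<^sup>+ x. ennreal (2^n * (cmod (d n x))\<^sup>2) \<partial>M)"
    by (rule nn_integral_suminf) measurable
  also have "\<dots> \<le> (\<Sum>n. ennreal ((1/2)^n))"
  proof (intro suminf_le summableI)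
    fix n
    have "(\<integral>\<^sup>+ x. ennreal (2^n * (cmod (d n x))\<^sup>2) \<partial>M) = ennreal (2^n * (l2 M (d n))\<^sup>2)"
      by (simp only: ennreal_mult zero_le_power2 zero_le_power zero_le_numeral)
         (subst nn_integral_cmult, auto simp only: nn_integral_l2[OF d], measurable)
    also have "\<dots> \<le> ennreal (2^n * ((1/2)^n)\<^sup>2)"
      using fast[of n "Suc n"]
      by (intro ennreal_leI mult_left_mono power_mono) (auto simp: d_def[abs_def])
    also have "2^n * ((1/2)^n)\<^sup>2 = (1/2::real)^n"
      by (simp add: power2_eq_square mult.assoc[symmetric] flip: power_mult_distrib)
    finally show "(\<integral>\<^sup>+ x. ennreal (2^n * (cmod (d n x))\<^sup>2) \<partial>M) \<le> ennreal ((1/2)^n)" .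
  qed
  also have "\<dots> = ennreal (\<Sum>n. (1/2)^n)"
    by (rule suminf_ennreal2) (auto intro: summable_geometric)
  finally have "(\<integral>\<^sup>+ x. (\<Sum>n. ennreal (2^n * (cmod (d n x))\<^sup>2)) \<partial>M) \<noteq> \<infinity>"
    by (auto simp: top_unique)
  then have "AE x in M. (\<Sum>n. ennreal (2^n * (cmod (d n x))\<^sup>2)) \<noteq> \<infinity>"
    by (intro nn_integral_PInf_AE) measurable
  then have conv: "AE x in M. convergent (\<lambda>n. f n x)"
  proof eventually_elim
    case (elim x)
    have sm: "summable (\<lambda>n. 2^n * (cmod (d n x))\<^sup>2)"
      using elim by (intro summable_suminf_not_top) auto
    have "summable (\<lambda>n. d n x)"
    proof (rule summable_comparison_test')
      show "summable (\<lambda>n. 2^n * (cmod (d n x))\<^sup>2 + (1/2)^n)"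
        by (intro summable_add sm summable_geometric) auto
      fix n
      \<comment> \<open>The two factors \<open>sqrt (2^n) * cmod (d n x)\<close> and
        \<open>sqrt ((1/2)^n)\<close> multiply to \<open>cmod (d n x)\<close>, so the inequality of
        means bounds the differences by two summable series.\<close>
      have "2 * (sqrt (2^n) * cmod (d n x)) * sqrt ((1/2)^n) \<le> (sqrt (2^n) * cmod (d n x))\<^sup>2 + (sqrt ((1/2)^n))\<^sup>2"
        by (rule sum_squares_bound)
      also have "2 * (sqrt (2^n) * cmod (d n x)) * sqrt ((1/2)^n) = 2 * cmod (d n x) * sqrt (2^n * (1/2)^n)"
        by (simp add: real_sqrt_mult)
      also have "2^n * (1/2::real)^n = 1" by (simp flip: power_mult_distrib)
      finally have "2 * cmod (d n x) \<le> 2^n * (cmod (d n x))\<^sup>2 + (1/2)^n"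
        by (simp add: power_mult_distrib)
      then show "norm (d n x) \<le> 2^n * (cmod (d n x))\<^sup>2 + (1/2)^n"
        by (smt (verit) norm_ge_zero)
    qed
    then have "convergent (\<lambda>n. \<Sum>k<n. d k x)" by (simp add: summable_iff_convergent)
    moreover have "(\<Sum>k<n. d k x) = f n x - f 0 x" for n
      by (induction n) (auto simp: d_def)
    ultimately have "convergent (\<lambda>n. f n x - f 0 x)" by simp
    then show ?case using convergent_diff_const_right_iff by blast
  qed
  define g where "g x = lim (\<lambda>n. f n x)" for x
  have [measurable]: "g \<in> borel_measurable M"
    unfolding g_def[abs_def] by measurable
  have lim: "AE x in M. (\<lambda>n. f n x) \<longlonglongrightarrow> g x"
    using conv by eventually_elim (simp add: g_def convergent_LIMSEQ_iff)
  \<comment> \<open>Fatou is applied with \<open>n\<close> fixed and \<open>m\<close> going to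
    infinity; the bound on \<open>f m - f n\<close> is available from \<open>m = n\<close>
    on.\<close>
  have fat: "sqint M (\<lambda>x. g x - f n x)" "l2 M (\<lambda>x. g x - f n x) \<le> (1/2)^n" for n
  proof -
    have lim': "AE x in M. (\<lambda>m. f m x - f n x) \<longlonglongrightarrow> g x - f n x"
      using lim by eventually_elim (intro tendsto_intros)
    show "sqint M (\<lambda>x. g x - f n x)"
      by (rule l2_fatou(1)[of M "\<lambda>m x. f m x - f n x" _ n, OF sqint_diff[OF f f] _ lim' fast]) auto
    show "l2 M (\<lambda>x. g x - f n x) \<le> (1/2)^n"
      by (rule l2_fatou(2)[of M "\<lambda>m x. f m x - f n x" _ n, OF sqint_diff[OF f f] _ lim' fast]) auto
  qed
  have "sqint M g" using sqint_add[OF fat(1)[of 0] f[of 0]] by simp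
  moreover have "(\<lambda>n. l2 M (\<lambda>x. f n x - g x)) \<longlonglongrightarrow> 0"
  proof (rule Lim_null_comparison)
    show "(\<lambda>n. (1/2::real)^n) \<longlonglongrightarrow> 0" by (rule LIMSEQ_realpow_zero) auto
    show "\<forall>\<^sub>F n in sequentially. norm (l2 M (\<lambda>x. f n x - g x)) \<le> (1/2)^n"
      using fat(2) by (auto simp: l2_minus_commute[of M "f _" g])
  qed
  ultimately show ?thesis by blast
qed

theorem l2_complete:
  assumes f: "\<And>n. sqint M (f n)"
    and cauchy: "\<And>e. e > 0 \<Longrightarrow> \<exists>N. \<forall>m\<ge>N. \<forall>n\<ge>N. l2 M (\<lambda>x. f m x - f n x) < e"
  shows "\<exists>g. sqint M g \<and> (\<lambda>n. l2 M (\<lambda>x. f n x - g x)) \<longlonglongrightarrow> 0"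
proof -
  have "\<forall>k. \<exists>N. \<forall>m\<ge>N. \<forall>n\<ge>N. l2 M (\<lambda>x. f m x - f n x) < (1/2)^k"
    using cauchy by simp
  then obtain N where N: "\<And>k m n. m \<ge> N k \<Longrightarrow> n \<ge> N k \<Longrightarrow> l2 M (\<lambda>x. f m x - f n x) < (1/2)^k"
    by metis
  \<comment> \<open>The sum over \<open>j \<le> k\<close> makes \<open>r\<close> monotone and at
    least \<open>N k\<close>, which gives the geometric rate along the subsequence; the summand
    \<open>k\<close> makes \<open>r\<close> unbounded.\<close>
  define r where "r k = (\<Sum>j\<le>k. N j) + k" for k
  have r_mono: "r k \<le> r l" if "k \<le> l" for k l
    unfolding r_def using that by (intro add_mono sum_mono2) auto
  have r_N: "N k \<le> r k" for k
    unfolding r_def by (rule trans_le_add1) (rule member_le_sum, auto)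
  have r_k: "k \<le> r k" for k by (simp add: r_def)
  have "\<exists>g. sqint M g \<and> (\<lambda>k. l2 M (\<lambda>x. f (r k) x - g x)) \<longlonglongrightarrow> 0"
    by (rule l2_complete_fast)
       (use f in \<open>auto intro!: less_imp_le[OF N] r_N order_trans[OF r_N r_mono]\<close>)
  then obtain g where g: "sqint M g" and lim: "(\<lambda>k. l2 M (\<lambda>x. f (r k) x - g x)) \<longlonglongrightarrow> 0"
    by blast
  have "(\<lambda>n. l2 M (\<lambda>x. f n x - g x)) \<longlonglongrightarrow> 0"
  proof (rule LIMSEQ_I)
    fix e :: real assume e: "0 < e"
    obtain K where K: "\<And>m n. m \<ge> K \<Longrightarrow> n \<ge> K \<Longrightarrow> l2 M (\<lambda>x. f m x - f n x) < e/2"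
      using cauchy[of "e/2"] e by auto
    obtain L where L: "\<And>k. k \<ge> L \<Longrightarrow> l2 M (\<lambda>x. f (r k) x - g x) < e/2"
      using LIMSEQ_D[OF lim, of "e/2"] e by auto
    define k where "k = max K L"
    show "\<exists>no. \<forall>n\<ge>no. norm (l2 M (\<lambda>x. f n x - g x) - 0) < e"
    proof (intro exI allI impI)
      fix n assume "n \<ge> K"
      then have "l2 M (\<lambda>x. f n x - f (r k) x) < e/2"
        using r_k[of k] by (intro K) (auto simp: k_def)
      moreover have "l2 M (\<lambda>x. f (r k) x - g x) < e/2" by (intro L) (simp add: k_def)
      ultimately show "norm (l2 M (\<lambda>x. f n x - g x) - 0) < e"
        using l2_triangle_diff[OF f f g, of n "r k"] by simp
    qed
  qed
  with g show ?thesis by blast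
qed

lemma cnj_mult_polarization:
  "cnj a * b = (of_real ((cmod (a + b))\<^sup>2 - (cmod (a + (-1) * b))\<^sup>2)
     - \<i> * of_real ((cmod (a + \<i> * b))\<^sup>2 - (cmod (a + (-\<i>) * b))\<^sup>2)) / 4"
  unfolding of_real_diff complex_norm_square by (simp add: algebra_simps)

text \<open>Reduces preservation of inner products to preservation of norms. The coefficients stay
  visible as multipliers, so that one norm identity for \<open>f + c * g\<close> serves the terms
  with c = -1, i and -i.\<close>

lemma inner_polarization:
  assumes "sqint M f" "sqint M g"
  shows "(LINT x|M. cnj (f x) * g x) =
    (of_real ((l2 M (\<lambda>x. f x + g x))\<^sup>2 - (l2 M (\<lambda>x. f x + (-1) * g x))\<^sup>2)
     - \<i> * of_real ((l2 M (\<lambda>x. f x + \<i> * g x))\<^sup>2 - (l2 M (\<lambda>x. f x + (-\<i>) * g x))\<^sup>2)) / 4"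
proof -
  have s: "sqint M (\<lambda>x. f x + c * g x)" for c by (intro sqint_add sqint_cmult assms)
  have i: "integrable M (\<lambda>x. complex_of_real ((cmod (f x + c * g x))\<^sup>2))" for c
    using s[of c] by (intro integrable_of_real) (simp add: sqint_def)
  have e: "of_real ((l2 M (\<lambda>x. f x + c * g x))\<^sup>2) = (LINT x|M. complex_of_real ((cmod (f x + c * g x))\<^sup>2))" for c
    unfolding l2_power2 by (simp only: integral_complex_of_real)
  show ?thesis
    unfolding cnj_mult_polarization of_real_diff
    using i[of 1] i[of "-1"] i[of \<i>] i[of "-\<i>"] e[of 1] e[of "-1"] e[of \<i>] e[of "-\<i>"]
    by simp
qed

section \<open>The heat equation on Gaussians\<close>

lemma has_vector_derivative_cexp:
  fixes f :: "real \<Rightarrow> complex"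
  assumes "(f has_vector_derivative f') (at x within S)"
  shows "((\<lambda>x. exp (f x)) has_vector_derivative f' * exp (f x)) (at x within S)"
  using field_vector_diff_chain_within[OF assms DERIV_exp[THEN has_field_derivative_at_within]]
  by (simp add: o_def)

text \<open>The integrating factor exp (- integral of k) makes the product with \<open>d\<close>
  constant. This suffices for uniqueness of the Riccati system, because the difference of two
  solutions of a Riccati equation satisfies a linear equation.\<close>

lemma linear_ode_zero:
  fixes d k :: "real \<Rightarrow> complex"
  assumes k: "continuous_on {0..t} k"
    and d: "\<And>s. s \<in> {0..t} \<Longrightarrow> (d has_vector_derivative k s * d s) (at s within {0..t})"
    and d0: "d 0 = 0" and s: "s \<in> {0..t}"
  shows "d s = 0"
proof -
  define K where "K s = integral {0..s} k" for s
  have K: "(K has_vector_derivative k s) (at s within {0..t})" if "s \<in> {0..t}" for s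
    unfolding K_def by (rule integral_has_vector_derivative[OF k that])
  have "((\<lambda>s. exp (- K s) * d s) has_vector_derivative 0) (at s within {0..t})"
    if "s \<in> {0..t}" for s
    using has_vector_derivative_mult[OF has_vector_derivative_cexp[OF
      has_vector_derivative_minus[OF K[OF that]]] d[OF that]]
    by (simp add: algebra_simps)
  then obtain c where c: "\<And>s. s \<in> {0..t} \<Longrightarrow> exp (- K s) * d s = c"
    using has_vector_derivative_zero_constant[of "{0..t}" "\<lambda>s. exp (- K s) * d s"] by auto
  have "c = 0" using c[of 0] d0 s by simp
  with c[OF s] show ?thesis by simp
qed

lemma quadratic_exp_has_vector_derivative:
  fixes a b c :: complex
  shows "((\<lambda>x. exp (a * of_real (x\<^sup>2) + b * of_real x + c)) has_vector_derivative
    (2 * a * of_real y + b) * exp (a * of_real (y\<^sup>2) + b * of_real y + c)) (at y)"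
proof (rule has_vector_derivative_cexp)
  have "((\<lambda>z. a * z\<^sup>2 + b * z + c) has_field_derivative 2 * a * of_real y + b) (at (of_real y))"
    by (auto intro!: derivative_eq_intros)
  from has_vector_derivative_real_field[OF this]
  show "((\<lambda>x. a * of_real (x\<^sup>2) + b * of_real x + c) has_vector_derivative
    2 * a * of_real y + b) (at y)" by simp
qed

lemma quadratic_exp_second_derivative:
  fixes a b c :: complex
  shows "((\<lambda>y. (2 * a * of_real y + b) * exp (a * of_real (y\<^sup>2) + b * of_real y + c))
    has_vector_derivative
    (2 * a + (2 * a * of_real y + b)\<^sup>2) * exp (a * of_real (y\<^sup>2) + b * of_real y + c)) (at y)"
proof -
  have "((\<lambda>z. 2 * a * z + b) has_field_derivative 2 * a) (at (of_real y))"
    by (auto intro!: derivative_eq_intros)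
  from has_vector_derivative_mult[OF has_vector_derivative_real_field[OF this]
      quadratic_exp_has_vector_derivative[of a b c y]]
  show ?thesis by (simp add: algebra_simps power2_eq_square)
qed

lemma at_within_Icc_neq_bot:
  fixes s t :: real
  assumes "0 < t" "s \<in> {0..t}"
  shows "at s within {0..t} \<noteq> bot"
  using assms by (simp add: trivial_limit_within islimpt_Icc)

text \<open>Insert exp (a x^2 + b x + c) into the heat equation, cancel the exponential and compare
  the powers of x. The equation for \<open>a\<close> is a Riccati equation; those for
  \<open>b\<close> and \<open>c\<close> are then solved in turn.\<close>

definition heat_ode :: "real \<Rightarrow> real \<Rightarrow> (real \<Rightarrow> complex) \<Rightarrow> (real \<Rightarrow> complex) \<Rightarrow> (real \<Rightarrow> complex) \<Rightarrow> bool" where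
  "heat_ode \<alpha> t a b c \<longleftrightarrow> (\<forall>s\<in>{0..t}.
     (a has_vector_derivative 2 * (a s)\<^sup>2 + of_real (\<alpha>\<^sup>2) / 2) (at s within {0..t}) \<and>
     (b has_vector_derivative 2 * a s * b s) (at s within {0..t}) \<and>
     (c has_vector_derivative a s + (b s)\<^sup>2 / 2) (at s within {0..t}))"

lemma heat_sol_imp_ode:
  assumes t: "0 < t" and sol: "heat_sol \<alpha> t f \<phi>"
  obtains a b c where "heat_ode \<alpha> t a b c"
    "\<And>s x. s \<in> {0..t} \<Longrightarrow> \<phi> s x = exp (a s * of_real (x\<^sup>2) + b s * of_real x + c s)"
    "\<And>x. f x = exp (a 0 * of_real (x\<^sup>2) + b 0 * of_real x + c 0)"
proof -
  from sol obtain a b c where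
    diff: "a differentiable_on {0..t}" "b differentiable_on {0..t}" "c differentiable_on {0..t}"
    and \<phi>: "\<And>s x. s \<in> {0..t} \<Longrightarrow> \<phi> s x = exp (a s * of_real (x\<^sup>2) + b s * of_real x + c s)"
    unfolding heat_sol_def by blast
  have "heat_ode \<alpha> t a b c"
    unfolding heat_ode_def
  proof
    fix s assume s: "s \<in> {0..t}"
    have "\<phi> s = (\<lambda>x. exp (a s * of_real (x\<^sup>2) + b s * of_real x + c s))"
      using \<phi>[OF s] by auto
    note \<phi>s = this
    from diff s obtain a' b' c' where
      d: "(a has_vector_derivative a') (at s within {0..t})"
         "(b has_vector_derivative b') (at s within {0..t})"
         "(c has_vector_derivative c') (at s within {0..t})"
      unfolding differentiable_on_def vector_derivative_works by blast
    from sol s obtain \<phi>x \<phi>xx where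
      1: "\<And>y. (\<phi> s has_vector_derivative \<phi>x y) (at y)" and
      2: "\<And>y. (\<phi>x has_vector_derivative \<phi>xx y) (at y)" and
      3: "\<And>x. ((\<lambda>r. \<phi> r x) has_vector_derivative
               (- (of_real (1/2) * (- \<phi>xx x - of_real (\<alpha>^2 * x^2) * \<phi> s x))))
             (at s within {0..t})"
      unfolding heat_sol_def by blast
    have "\<phi>x = (\<lambda>y. (2 * a s * of_real y + b s) * exp (a s * of_real (y\<^sup>2) + b s * of_real y + c s))"
      using vector_derivative_unique_at[OF 1[unfolded \<phi>s] quadratic_exp_has_vector_derivative] by auto
    note \<phi>x = this
    have \<phi>xx: "\<phi>xx x = (2 * a s + (2 * a s * of_real x + b s)\<^sup>2) * \<phi> s x" for x
      using vector_derivative_unique_at[OF 2[unfolded \<phi>x] quadratic_exp_second_derivative]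
      by (auto simp: \<phi>s)
    \<comment> \<open>The time derivative is computed once from the exponent and once from the heat
      equation; since an exponential has no zero it can be cancelled, which leaves an identity of
      quadratic polynomials in x.\<close>
    have key: "a' * of_real (x\<^sup>2) + b' * of_real x + c'
        = ((2 * a s + (2 * a s * of_real x + b s)\<^sup>2) + of_real (\<alpha>\<^sup>2 * x\<^sup>2)) / 2" for x
    proof -
      have "((\<lambda>r. exp (a r * of_real (x\<^sup>2) + b r * of_real x + c r)) has_vector_derivative
          (a' * of_real (x\<^sup>2) + b' * of_real x + c') * exp (a s * of_real (x\<^sup>2) + b s * of_real x + c s))
          (at s within {0..t})"
        using d by (intro has_vector_derivative_cexp has_vector_derivative_add
            has_vector_derivative_mult_left) auto
      then have "((\<lambda>r. \<phi> r x) has_vector_derivative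
          (a' * of_real (x\<^sup>2) + b' * of_real x + c') * \<phi> s x) (at s within {0..t})"
        using \<phi> s by (auto intro: has_vector_derivative_transform[OF s])
      from vector_derivative_unique_within[OF at_within_Icc_neq_bot[OF t s] this 3]
      have "(a' * of_real (x\<^sup>2) + b' * of_real x + c') * \<phi> s x
        = (((2 * a s + (2 * a s * of_real x + b s)\<^sup>2) + of_real (\<alpha>\<^sup>2 * x\<^sup>2)) / 2) * \<phi> s x"
        by (simp add: \<phi>xx algebra_simps)
      moreover have "\<phi> s x \<noteq> 0" by (simp add: \<phi>s)
      ultimately show ?thesis by (simp only: mult_cancel_right) simp
    qed
    \<comment> \<open>A quadratic polynomial is determined by its values at 0, 1 and -1, so these
      three instances give the coefficients.\<close>
    from key[of 0] have c': "c' = a s + (b s)\<^sup>2 / 2" by (simp add: field_simps)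
    have e1: "a' + b' + c' = ((2 * a s + (2 * a s + b s)\<^sup>2) + of_real (\<alpha>\<^sup>2)) / 2"
      using key[of 1] by simp
    have e2: "a' - b' + c' = ((2 * a s + (b s - 2 * a s)\<^sup>2) + of_real (\<alpha>\<^sup>2)) / 2"
      using key[of "-1"] by simp
    have "a' = ((a' + b' + c') + (a' - b' + c')) / 2 - c'" by (simp add: field_simps)
    also have "\<dots> = 2 * (a s)\<^sup>2 + of_real (\<alpha>\<^sup>2) / 2"
      unfolding e1 e2 unfolding c' by (simp add: field_simps power2_eq_square)
    finally have a': "a' = 2 * (a s)\<^sup>2 + of_real (\<alpha>\<^sup>2) / 2" .
    have "b' = ((a' + b' + c') - (a' - b' + c')) / 2" by (simp add: field_simps)
    also have "\<dots> = 2 * a s * b s"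
      unfolding e1 e2 by (simp add: field_simps power2_eq_square)
    finally have b': "b' = 2 * a s * b s" .
    show "(a has_vector_derivative 2 * (a s)\<^sup>2 + of_real (\<alpha>\<^sup>2) / 2) (at s within {0..t}) \<and>
     (b has_vector_derivative 2 * a s * b s) (at s within {0..t}) \<and>
     (c has_vector_derivative a s + (b s)\<^sup>2 / 2) (at s within {0..t})"
      using d unfolding a' b' c' by blast
  qed
  moreover have "f x = exp (a 0 * of_real (x\<^sup>2) + b 0 * of_real x + c 0)" for x
    using sol \<phi>[of 0 x] t by (simp add: heat_sol_def)
  ultimately show ?thesis using \<phi> that by blast
qed

lemma heat_ode_imp_sol:
  assumes ode: "heat_ode \<alpha> t a b c"
    and f: "\<And>x. f x = exp (a 0 * of_real (x\<^sup>2) + b 0 * of_real x + c 0)"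
  shows "heat_sol \<alpha> t f (\<lambda>s x. exp (a s * of_real (x\<^sup>2) + b s * of_real x + c s))"
  unfolding heat_sol_def
proof (intro conjI ballI allI)
  show "exp (a 0 * of_real (x\<^sup>2) + b 0 * of_real x + c 0) = f x" for x using f by simp
  have "a differentiable_on {0..t} \<and> b differentiable_on {0..t} \<and> c differentiable_on {0..t}"
    using ode unfolding heat_ode_def differentiable_on_def
    by (meson differentiableI_vector)
  then show "\<exists>a' b' c' :: real \<Rightarrow> complex.
        a' differentiable_on {0..t} \<and> b' differentiable_on {0..t} \<and> c' differentiable_on {0..t} \<and>
        (\<forall>s\<in>{0..t}. \<forall>x. exp (a s * of_real (x\<^sup>2) + b s * of_real x + c s)
          = exp (a' s * of_real (x^2) + b' s * of_real x + c' s))"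
    by blast
  fix s assume s: "s \<in> {0..t}"
  have d: "(a has_vector_derivative 2 * (a s)\<^sup>2 + of_real (\<alpha>\<^sup>2) / 2) (at s within {0..t})"
     "(b has_vector_derivative 2 * a s * b s) (at s within {0..t})"
     "(c has_vector_derivative a s + (b s)\<^sup>2 / 2) (at s within {0..t})"
    using ode s unfolding heat_ode_def by blast+
  let ?\<phi> = "\<lambda>x. exp (a s * of_real (x\<^sup>2) + b s * of_real x + c s)"
  let ?\<phi>x = "\<lambda>x. (2 * a s * of_real x + b s) * ?\<phi> x"
  let ?\<phi>xx = "\<lambda>x. (2 * a s + (2 * a s * of_real x + b s)\<^sup>2) * ?\<phi> x"
  have "((\<lambda>r. exp (a r * of_real (x\<^sup>2) + b r * of_real x + c r)) has_vector_derivative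
      - (of_real (1 / 2) * (- ?\<phi>xx x - of_real (\<alpha>\<^sup>2 * x\<^sup>2) * ?\<phi> x))) (at s within {0..t})" for x
  proof -
    have "((\<lambda>r. exp (a r * of_real (x\<^sup>2) + b r * of_real x + c r)) has_vector_derivative
          ((2 * (a s)\<^sup>2 + of_real (\<alpha>\<^sup>2) / 2) * of_real (x\<^sup>2) + (2 * a s * b s) * of_real x
            + (a s + (b s)\<^sup>2 / 2)) * ?\<phi> x) (at s within {0..t})"
      using d by (intro has_vector_derivative_cexp has_vector_derivative_add
          has_vector_derivative_mult_left) auto
    moreover have "((2 * (a s)\<^sup>2 + of_real (\<alpha>\<^sup>2) / 2) * of_real (x\<^sup>2) + (2 * a s * b s) * of_real x
            + (a s + (b s)\<^sup>2 / 2)) * E = - (of_real (1 / 2) * (- ((2 * a s + (2 * a s * of_real x + b s)\<^sup>2) * E) - of_real (\<alpha>\<^sup>2 * x\<^sup>2) * E))" for E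
      by (simp add: field_simps power2_eq_square)
    ultimately show ?thesis by simp
  qed
  then show "\<exists>\<phi>x \<phi>xx :: real \<Rightarrow> complex.
        (\<forall>y. (?\<phi> has_vector_derivative \<phi>x y) (at y)) \<and>
        (\<forall>y. (\<phi>x has_vector_derivative \<phi>xx y) (at y)) \<and>
        (\<forall>x. ((\<lambda>r. exp (a r * of_real (x\<^sup>2) + b r * of_real x + c r)) has_vector_derivative
               (- (of_real (1/2) * (- \<phi>xx x - of_real (\<alpha>^2 * x^2) * ?\<phi> x))))
             (at s within {0..t}))"
    using quadratic_exp_has_vector_derivative[of "a s" "b s" "c s"]
      quadratic_exp_second_derivative[of "a s" "b s" "c s"]
    by (intro exI[of _ ?\<phi>x] exI[of _ ?\<phi>xx]) blast
qed

text \<open>Differentiating the constant function 1 kills the polynomial 2 a y + b. Only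
  \<open>exp c\<close> is determined: equal Gaussians may have constant terms that differ by a
  multiple of 2 pi i.\<close>

lemma quadratic_exp_eq_1:
  fixes a b c :: complex
  assumes eq: "\<And>x::real. exp (a * of_real (x\<^sup>2) + b * of_real x + c) = 1"
  shows "a = 0" "b = 0" "exp c = 1"
proof -
  have z: "2 * a * of_real y + b = 0" for y
  proof -
    have "((\<lambda>x. 1) has_vector_derivative (2 * a * of_real y + b) * 1) (at y)"
      using quadratic_exp_has_vector_derivative[of a b c y] unfolding eq .
    from vector_derivative_unique_at[OF this has_vector_derivative_const] show ?thesis by simp
  qed
  from z[of 0] show "b = 0" by simp
  with z[of 1] show "a = 0" by simp
  from eq[of 0] show "exp c = 1" by simp
qed

lemma has_vector_derivative_imp_continuous_on:
  assumes "\<And>s. s \<in> S \<Longrightarrow> (f has_vector_derivative f' s) (at s within S)"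
  shows "continuous_on S f"
  using assms has_vector_derivative_continuous
  by (fastforce simp: continuous_on_eq_continuous_within)

text \<open>The differences are treated in the order a, b, c: a - a' solves a linear equation with
  coefficient 2 (a + a'), then b - b' one with coefficient 2 a, and then c - c' is constant. That
  constant is a period of exp, so the Gaussians agree. This is what makes the description in
  \<open>heat_evol\<close> denote.\<close>

lemma heat_sol_unique:
  assumes t: "0 < t" and sol: "heat_sol \<alpha> t f \<phi>" "heat_sol \<alpha> t f \<phi>'"
  shows "\<phi> t = \<phi>' t"
proof -
  obtain a b c where
    abc: "heat_ode \<alpha> t a b c"
    "\<And>s x. s \<in> {0..t} \<Longrightarrow> \<phi> s x = exp (a s * of_real (x\<^sup>2) + b s * of_real x + c s)"
    "\<And>x. f x = exp (a 0 * of_real (x\<^sup>2) + b 0 * of_real x + c 0)"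
    by (rule heat_sol_imp_ode[OF t sol(1)]) (rule that)
  obtain a' b' c' where
    abc': "heat_ode \<alpha> t a' b' c'"
    "\<And>s x. s \<in> {0..t} \<Longrightarrow> \<phi>' s x = exp (a' s * of_real (x\<^sup>2) + b' s * of_real x + c' s)"
    "\<And>x. f x = exp (a' 0 * of_real (x\<^sup>2) + b' 0 * of_real x + c' 0)"
    by (rule heat_sol_imp_ode[OF t sol(2)]) (rule that)
  have d: "(a has_vector_derivative 2 * (a s)\<^sup>2 + of_real (\<alpha>\<^sup>2) / 2) (at s within {0..t})"
     "(b has_vector_derivative 2 * a s * b s) (at s within {0..t})"
     "(c has_vector_derivative a s + (b s)\<^sup>2 / 2) (at s within {0..t})"
     "(a' has_vector_derivative 2 * (a' s)\<^sup>2 + of_real (\<alpha>\<^sup>2) / 2) (at s within {0..t})"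
     "(b' has_vector_derivative 2 * a' s * b' s) (at s within {0..t})"
     "(c' has_vector_derivative a' s + (b' s)\<^sup>2 / 2) (at s within {0..t})"
    if "s \<in> {0..t}" for s
    using abc(1) abc'(1) that unfolding heat_ode_def by blast+
  have cont: "continuous_on {0..t} a" "continuous_on {0..t} a'"
    by (rule has_vector_derivative_imp_continuous_on, rule d(1) d(4), assumption)+
  have "exp ((a 0 - a' 0) * of_real (x\<^sup>2) + (b 0 - b' 0) * of_real x + (c 0 - c' 0)) = 1" for x
  proof -
    have "exp ((a 0 - a' 0) * of_real (x\<^sup>2) + (b 0 - b' 0) * of_real x + (c 0 - c' 0))
      = exp (a 0 * of_real (x\<^sup>2) + b 0 * of_real x + c 0) / exp (a' 0 * of_real (x\<^sup>2) + b' 0 * of_real x + c' 0)"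
      by (simp add: exp_diff[symmetric] algebra_simps)
    then show ?thesis using abc(3)[of x] abc'(3)[of x] by simp
  qed
  from quadratic_exp_eq_1[OF this]
  have init: "a 0 = a' 0" "b 0 = b' 0" "exp (c 0 - c' 0) = 1" by auto
  have "a s - a' s = 0" if "s \<in> {0..t}" for s
  proof (rule linear_ode_zero[of t "\<lambda>s. 2 * (a s + a' s)" "\<lambda>s. a s - a' s"])
    show "continuous_on {0..t} (\<lambda>s. 2 * (a s + a' s))"
      by (intro continuous_intros cont)
    show "((\<lambda>s. a s - a' s) has_vector_derivative 2 * (a s + a' s) * (a s - a' s)) (at s within {0..t})"
      if "s \<in> {0..t}" for s
      using has_vector_derivative_diff[OF d(1)[OF that] d(4)[OF that]]
      by (simp add: algebra_simps power2_eq_square)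
  qed (use init that in auto)
  then have a: "a s = a' s" if "s \<in> {0..t}" for s using that by auto
  have "b s - b' s = 0" if "s \<in> {0..t}" for s
  proof (rule linear_ode_zero[of t "\<lambda>s. 2 * a s" "\<lambda>s. b s - b' s"])
    show "continuous_on {0..t} (\<lambda>s. 2 * a s)"
      by (intro continuous_intros cont)
    show "((\<lambda>s. b s - b' s) has_vector_derivative 2 * a s * (b s - b' s)) (at s within {0..t})"
      if "s \<in> {0..t}" for s
      using has_vector_derivative_diff[OF d(2)[OF that] d(5)[OF that]] a[OF that]
      by (simp add: algebra_simps)
  qed (use init that in auto)
  then have b: "b s = b' s" if "s \<in> {0..t}" for s using that by auto
  have "((\<lambda>s. c s - c' s) has_vector_derivative 0) (at s within {0..t})" if "s \<in> {0..t}" for s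
    using has_vector_derivative_diff[OF d(3)[OF that] d(6)[OF that]] a[OF that] b[OF that] by simp
  then obtain k where k: "\<And>s. s \<in> {0..t} \<Longrightarrow> c s - c' s = k"
    using has_vector_derivative_zero_constant[of "{0..t}" "\<lambda>s. c s - c' s"] by auto
  have "c t - c' t = c 0 - c' 0" using k[of 0] k[of t] t by simp
  with init(3) have "exp (c t - c' t) = 1" by simp
  then have c: "exp (c t) = exp (c' t)" by (simp add: exp_diff)
  show ?thesis
  proof
    fix x
    show "\<phi> t x = \<phi>' t x"
      using abc(2)[of t x] abc'(2)[of t x] a[of t] b[of t] c t by (simp add: exp_add)
  qed
qed

lemma heat_evol_eqI:
  assumes "0 < t" "heat_sol \<alpha> t f \<phi>"
  shows "heat_evol \<alpha> t f = \<phi> t"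
  unfolding heat_evol_def using assms heat_sol_unique by (intro the_equality) blast+

text \<open>Identity theorem: the real line accumulates at 0, so two entire functions that agree on
  it coincide. Any extension that is written down explicitly is therefore the one denoted by
  \<open>entire_ext\<close>.\<close>

lemma entire_ext_eqI:
  assumes g: "g holomorphic_on UNIV" and eq: "\<And>x::real. g (of_real x) = \<phi> x"
  shows "entire_ext \<phi> = g"
  unfolding entire_ext_def
proof (rule the_equality)
  show "g holomorphic_on UNIV \<and> (\<forall>x::real. g (of_real x) = \<phi> x)" using assms by blast
  fix h assume h: "h holomorphic_on UNIV \<and> (\<forall>x::real. h (of_real x) = \<phi> x)"
  have lp: "(0::complex) islimpt \<real>"
    unfolding islimpt_approachable
  proof (intro allI impI)
    fix e :: real assume "e > 0"
    then show "\<exists>x'\<in>\<real>. x' \<noteq> (0::complex) \<and> dist x' 0 < e"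
      by (intro bexI[of _ "of_real (e/2)"]) auto
  qed
  have "h w - g w = 0" for w
  proof (rule analytic_continuation[of "\<lambda>w. h w - g w" UNIV \<real> 0])
    show "(\<lambda>w. h w - g w) holomorphic_on UNIV" using h g by (intro holomorphic_intros) auto
    show "h z - g z = 0" if "z \<in> \<real>" for z
      using that h eq by (auto elim!: Reals_cases)
  qed (use lp in auto)
  then show "h = g" by auto
qed

section \<open>The complexified flow and its action integral\<close>

lemma x_is_has_vector_derivative:
  assumes "\<alpha> \<noteq> 0"
  shows "((\<lambda>s. x_is \<alpha> s x p) has_vector_derivative \<i> * p_is \<alpha> s x p) (at s within S)"
  unfolding x_is_def p_is_def
  by (rule derivative_eq_intros refl | simp add: assms)+
     (use assms in \<open>simp add: complex_eq_iff\<close>)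

lemma p_is_has_vector_derivative:
  assumes "\<alpha> \<noteq> 0"
  shows "((\<lambda>s. p_is \<alpha> s x p) has_vector_derivative \<i> * of_real (\<alpha>\<^sup>2) * x_is \<alpha> s x p) (at s within S)"
  unfolding x_is_def p_is_def
  by (rule derivative_eq_intros refl | simp add: assms)+
     (use assms in \<open>simp add: complex_eq_iff power2_eq_square\<close>)

text \<open>Along the imaginary-time flow the product p x has derivative i (p^2 + alpha^2 x^2),
  which is 2 i times \<open>L_H\<close>. So the action integral is a boundary term, a quadratic form
  in the starting point.\<close>

lemma flow_product_has_vector_derivative:
  assumes "\<alpha> \<noteq> 0"
  shows "((\<lambda>s. (p_is \<alpha> s x p * x_is \<alpha> s x p - of_real (p * x)) / (2 * \<i>)) has_vector_derivative
    L_H \<alpha> (p_is \<alpha> s x p) (x_is \<alpha> s x p)) (at s within S)"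
proof -
  have "((\<lambda>s. (p_is \<alpha> s x p * x_is \<alpha> s x p - of_real (p * x)) / (2 * \<i>)) has_vector_derivative
    ((p_is \<alpha> s x p * (\<i> * p_is \<alpha> s x p) + \<i> * of_real (\<alpha>\<^sup>2) * x_is \<alpha> s x p * x_is \<alpha> s x p) - 0) / (2 * \<i>))
    (at s within S)"
    by (intro has_vector_derivative_divide has_vector_derivative_diff has_vector_derivative_mult
      has_vector_derivative_const x_is_has_vector_derivative p_is_has_vector_derivative assms)
  moreover have "((q * (\<i> * q) + \<i> * A * y * y) - 0) / (2 * \<i>) = (q\<^sup>2 + A * y\<^sup>2) / 2" for q A y
    by (simp add: field_simps power2_eq_square)
  ultimately show ?thesis by (simp only: L_H_def)
qed

lemma L_H_flow_has_integral:
  assumes "\<alpha> \<noteq> 0" "0 \<le> t"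
  shows "((\<lambda>s. L_H \<alpha> (p_is \<alpha> s x p) (x_is \<alpha> s x p)) has_integral
    (p_is \<alpha> t x p * x_is \<alpha> t x p - of_real (p * x)) / (2 * \<i>)) {0..t}"
  using fundamental_theorem_of_calculus[OF assms(2) flow_product_has_vector_derivative[OF assms(1)]]
  by (simp add: p_is_def x_is_def)

section \<open>Closed formula for the transform of a coherent state\<close>

context
  fixes \<alpha> t \<theta> :: real
  assumes \<alpha>: "\<alpha> > 0" and t: "0 < t" "t < pi / (2 * \<alpha>)"
    and \<theta>: "0 < \<theta>" "\<theta> < pi / 2" "tan \<theta> = \<alpha>"
begin

lemma angle_less: "\<alpha> * t < pi / 2"
  using \<alpha> t by (simp add: field_simps)

text \<open>Both theta and alpha s are below pi / 2, so the angle stays inside (0, pi). Hence the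
  cotangent that solves the Riccati equation has no pole up to time t.\<close>

lemma sin_angle_pos: "s \<in> {0..t} \<Longrightarrow> sin (\<theta> + \<alpha> * s) > 0"
proof -
  assume "s \<in> {0..t}"
  then have "0 \<le> \<alpha> * s" "\<alpha> * s \<le> \<alpha> * t" using \<alpha> by auto
  then show ?thesis using angle_less \<theta> by (intro sin_gt_zero) linarith+
qed

lemma cot_angle_has_real_derivative:
  assumes "s \<in> {0..t}"
  shows "((\<lambda>s. \<alpha> * cot (\<theta> + \<alpha> * s)) has_real_derivative
    - ((\<alpha> * cot (\<theta> + \<alpha> * s))\<^sup>2 + \<alpha>\<^sup>2)) (at s within {0..t})"
proof -
  have S: "sin (\<theta> + \<alpha> * s) \<noteq> 0" using sin_angle_pos[OF assms] by simp
  have "((\<lambda>s. \<alpha> * cot (\<theta> + \<alpha> * s)) has_real_derivative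
    \<alpha> * (- inverse ((sin (\<theta> + \<alpha> * s))\<^sup>2) * \<alpha>)) (at s within {0..t})"
    by (intro DERIV_cmult DERIV_chain2[where f = cot] DERIV_cot S)
       (auto intro!: derivative_eq_intros)
  moreover have "\<alpha> * (- inverse ((sin (\<theta> + \<alpha> * s))\<^sup>2) * \<alpha>) = - ((\<alpha> * cot (\<theta> + \<alpha> * s))\<^sup>2 + \<alpha>\<^sup>2)"
  proof -
    show ?thesis
      using S by (simp add: cot_def power_divide power_mult_distrib field_simps) 
        (simp flip: distrib_left power2_eq_square)
  qed
  ultimately show ?thesis by simp
qed

lemma log_sin_has_real_derivative:
  assumes "s \<in> {0..t}"
  shows "((\<lambda>s. ln (sin \<theta> / sin (\<theta> + \<alpha> * s)) / 2 - ln (sqrt pi)) has_real_derivative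
    - (\<alpha> * cot (\<theta> + \<alpha> * s)) / 2) (at s within {0..t})"
proof -
  have S: "sin (\<theta> + \<alpha> * s) > 0" "sin \<theta> > 0"
    using sin_angle_pos[OF assms] sin_angle_pos[of 0] t by auto
  show ?thesis
    using S by (auto intro!: derivative_eq_intros simp: cot_def field_simps power2_eq_square)
qed

text \<open>The phase theta is the one that fits the initial width: tan theta = alpha gives alpha
  cot theta = 1, so \<open>heat_a 0\<close> is -1/2 as in \<open>psiY\<close>.\<close>

definition heat_a :: "real \<Rightarrow> complex" where
  "heat_a s = - of_real (\<alpha> * cot (\<theta> + \<alpha> * s)) / 2"

text \<open>With beta = alpha cot (theta + alpha s), \<open>x_is \<alpha> s Q P\<close> = Q_s and
  \<open>p_is \<alpha> s Q P\<close> = P_s, expand -i P_s (x - Q_s) - (beta / 2) (x - Q_s)^2. The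
  coefficient of x is \<open>heat_b\<close>; \<open>heat_c\<close> is the constant term plus the
  action of the trajectory of (P, Q) plus the logarithm of the amplitude.\<close>

definition heat_b :: "real \<Rightarrow> real \<Rightarrow> real \<Rightarrow> complex" where
  "heat_b P Q s = of_real (\<alpha> * cot (\<theta> + \<alpha> * s)) * x_is \<alpha> s Q P - \<i> * p_is \<alpha> s Q P"

definition heat_c :: "real \<Rightarrow> real \<Rightarrow> real \<Rightarrow> complex" where
  "heat_c P Q s = of_real (ln (sin \<theta> / sin (\<theta> + \<alpha> * s)) / 2 - ln (sqrt pi))
     + (p_is \<alpha> s Q P * x_is \<alpha> s Q P - of_real (P * Q)) / (2 * \<i>)
     + \<i> * (p_is \<alpha> s Q P * x_is \<alpha> s Q P)
     - of_real (\<alpha> * cot (\<theta> + \<alpha> * s)) * (x_is \<alpha> s Q P)\<^sup>2 / 2"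

lemma heat_ode_gauss: "heat_ode \<alpha> t heat_a (heat_b P Q) (heat_c P Q)"
  unfolding heat_ode_def
proof (intro ballI conjI)
  fix s assume s: "s \<in> {0..t}"
  define \<beta> where "\<beta> s = complex_of_real (\<alpha> * cot (\<theta> + \<alpha> * s))" for s
  have \<beta>: "(\<beta> has_vector_derivative - ((\<beta> s)\<^sup>2 + of_real (\<alpha>\<^sup>2))) (at s within {0..t})"
    using has_vector_derivative_of_real[OF cot_angle_has_real_derivative[OF s]]
    unfolding \<beta>_def[abs_def] by simp
  let ?X = "\<lambda>s. x_is \<alpha> s Q P" and ?P = "\<lambda>s. p_is \<alpha> s Q P"
  have X: "(?X has_vector_derivative \<i> * ?P s) (at s within {0..t})"
    and P: "(?P has_vector_derivative \<i> * of_real (\<alpha>\<^sup>2) * ?X s) (at s within {0..t})"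
    using \<alpha> by (intro x_is_has_vector_derivative p_is_has_vector_derivative; simp)+
  have a: "heat_a = (\<lambda>s. - \<beta> s / 2)" by (simp add: fun_eq_iff heat_a_def \<beta>_def)
  have b: "heat_b P Q = (\<lambda>s. \<beta> s * ?X s - \<i> * ?P s)" by (simp add: fun_eq_iff heat_b_def \<beta>_def)
  show "(heat_a has_vector_derivative 2 * (heat_a s)\<^sup>2 + of_real (\<alpha>\<^sup>2) / 2) (at s within {0..t})"
    using has_vector_derivative_divide[OF has_vector_derivative_minus[OF \<beta>], of 2]
    unfolding a by (simp add: field_simps power2_eq_square)
  show "(heat_b P Q has_vector_derivative 2 * heat_a s * heat_b P Q s) (at s within {0..t})"
    using has_vector_derivative_diff[OF has_vector_derivative_mult[OF \<beta> X] has_vector_derivative_mult_right[OF P, of \<i>]]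
    unfolding a b by (simp add: algebra_simps power2_eq_square)
  have N: "((\<lambda>s. complex_of_real (ln (sin \<theta> / sin (\<theta> + \<alpha> * s)) / 2 - ln (sqrt pi)))
      has_vector_derivative - \<beta> s / 2) (at s within {0..t})"
    using has_vector_derivative_of_real[OF log_sin_has_real_derivative[OF s], where 'a = complex]
    unfolding \<beta>_def by (simp only: of_real_minus of_real_divide of_real_numeral)
  have J: "((\<lambda>s. (?P s * ?X s - of_real (P * Q)) / (2 * \<i>)) has_vector_derivative
    L_H \<alpha> (?P s) (?X s)) (at s within {0..t})"
    using \<alpha> by (intro flow_product_has_vector_derivative) simp
  have PX: "((\<lambda>s. \<i> * (?P s * ?X s)) has_vector_derivative
      \<i> * (?P s * (\<i> * ?P s) + \<i> * of_real (\<alpha>\<^sup>2) * ?X s * ?X s)) (at s within {0..t})"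
    by (intro has_vector_derivative_mult_right has_vector_derivative_mult X P)
  have bX: "((\<lambda>s. \<beta> s * (?X s)\<^sup>2 / 2) has_vector_derivative
      (\<beta> s * (?X s * (\<i> * ?P s) + (\<i> * ?P s) * ?X s) + - ((\<beta> s)\<^sup>2 + of_real (\<alpha>\<^sup>2)) * (?X s * ?X s)) / 2)
      (at s within {0..t})"
    unfolding power2_eq_square[of "?X _"]
    by (intro has_vector_derivative_divide has_vector_derivative_mult \<beta> X)
  have c: "heat_c P Q = (\<lambda>s. of_real (ln (sin \<theta> / sin (\<theta> + \<alpha> * s)) / 2 - ln (sqrt pi))
     + (?P s * ?X s - of_real (P * Q)) / (2 * \<i>) + \<i> * (?P s * ?X s) - \<beta> s * (?X s)\<^sup>2 / 2)"
    by (simp add: fun_eq_iff heat_c_def \<beta>_def)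
  have "(heat_c P Q has_vector_derivative
      (- \<beta> s / 2 + L_H \<alpha> (?P s) (?X s)
       + \<i> * (?P s * (\<i> * ?P s) + \<i> * of_real (\<alpha>\<^sup>2) * ?X s * ?X s)
       - (\<beta> s * (?X s * (\<i> * ?P s) + (\<i> * ?P s) * ?X s) + - ((\<beta> s)\<^sup>2 + of_real (\<alpha>\<^sup>2)) * (?X s * ?X s)) / 2))
      (at s within {0..t})"
    unfolding c by (intro has_vector_derivative_add has_vector_derivative_diff N J PX bX)
  moreover have "- B / 2 + (p\<^sup>2 + A * x\<^sup>2) / 2
       + \<i> * (p * (\<i> * p) + \<i> * A * x * x)
       - (B * (x * (\<i> * p) + (\<i> * p) * x) + - (B\<^sup>2 + A) * (x * x)) / 2
     = - B / 2 + (B * x - \<i> * p)\<^sup>2 / 2" for B p x A :: complex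
    by (simp add: field_simps power2_eq_square)
  ultimately show "(heat_c P Q has_vector_derivative heat_a s + (heat_b P Q s)\<^sup>2 / 2) (at s within {0..t})"
    unfolding a b L_H_def by (simp only:)
qed

lemma tan_angle: "sin \<theta> = \<alpha> * cos \<theta>" "cos \<theta> > 0" "sin \<theta> > 0"
proof -
  show c: "cos \<theta> > 0" "sin \<theta> > 0" using \<theta> by (auto intro: cos_gt_zero sin_gt_zero)
  show "sin \<theta> = \<alpha> * cos \<theta>" using \<theta>(3) c by (simp add: tan_def field_simps)
qed

lemma heat_gauss_init:
  "psiY P Q x = exp (heat_a 0 * of_real (x\<^sup>2) + heat_b P Q 0 * of_real x + heat_c P Q 0)"
proof -
  have cot: "\<alpha> * cot \<theta> = 1" using tan_angle \<alpha> by (simp add: cot_def)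
  have "exp (- complex_of_real (ln (sqrt pi))) = of_real (1 / sqrt pi)"
    by (simp add: exp_minus exp_of_real field_simps flip: of_real_minus)
  moreover have "heat_a 0 * of_real (x\<^sup>2) + heat_b P Q 0 * of_real x + heat_c P Q 0
     = - of_real (ln (sqrt pi)) + (- \<i> * of_real P * of_real (x - Q) - of_real ((x - Q)\<^sup>2 / 2))"
    using cot tan_angle
    by (simp add: heat_a_def heat_b_def heat_c_def x_is_def p_is_def field_simps power2_eq_square)
  ultimately show ?thesis unfolding psiY_def by (simp only: exp_add)
qed

lemma heat_evol_psiY:
  "heat_evol \<alpha> t (psiY P Q) = (\<lambda>x. exp (heat_a t * of_real (x\<^sup>2) + heat_b P Q t * of_real x + heat_c P Q t))"
  using heat_evol_eqI[OF t(1) heat_ode_imp_sol[OF heat_ode_gauss heat_gauss_init]] .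

lemma entire_ext_heat_evol_psiY:
  "entire_ext (heat_evol \<alpha> t (psiY P Q)) = (\<lambda>w. exp (heat_a t * w\<^sup>2 + heat_b P Q t * w + heat_c P Q t))"
  unfolding heat_evol_psiY by (rule entire_ext_eqI) (auto intro!: holomorphic_intros)

lemma KSH_gauss_formula_flow:
  "KSH_gauss \<alpha> t P Q (x, p) =
    of_real (1 / sqrt pi * sqrt \<bar>sin \<theta> / sin (\<theta> + \<alpha> * t)\<bar>) *
    exp (- integral {0..t} (\<lambda>s. L_H \<alpha> (p_is \<alpha> s x p) (x_is \<alpha> s x p)
                                - L_H \<alpha> (p_is \<alpha> s Q P) (x_is \<alpha> s Q P))) *
    exp (- \<i> * p_is \<alpha> t Q P * (w_tau \<alpha> t x p - x_is \<alpha> t Q P)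
         - of_real (\<alpha> * cot (\<theta> + \<alpha> * t)) / 2 * (w_tau \<alpha> t x p - x_is \<alpha> t Q P)^2)"
proof -
  let ?w = "w_tau \<alpha> t x p" and ?X = "x_is \<alpha> t Q P" and ?P = "p_is \<alpha> t Q P"
    and ?\<beta> = "complex_of_real (\<alpha> * cot (\<theta> + \<alpha> * t))"
  define I where "I x p = (p_is \<alpha> t x p * x_is \<alpha> t x p - of_real (p * x)) / (2 * \<i>)" for x p
  define N where "N = complex_of_real (ln (sin \<theta> / sin (\<theta> + \<alpha> * t)) / 2 - ln (sqrt pi))"
  have I: "((\<lambda>s. L_H \<alpha> (p_is \<alpha> s x p) (x_is \<alpha> s x p)) has_integral I x p) {0..t}" for x p
    unfolding I_def using \<alpha> t by (intro L_H_flow_has_integral) auto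
  have D: "integral {0..t} (\<lambda>s. L_H \<alpha> (p_is \<alpha> s x p) (x_is \<alpha> s x p)
                                - L_H \<alpha> (p_is \<alpha> s Q P) (x_is \<alpha> s Q P)) = I x p - I Q P"
    by (rule integral_unique[OF has_integral_diff[OF I I]])
  have S: "sin (\<theta> + \<alpha> * t) > 0" using sin_angle_pos[of t] t by simp
  have "exp (ln (sin \<theta> / sin (\<theta> + \<alpha> * t)) / 2 - ln (sqrt pi)) = 1 / sqrt pi * sqrt \<bar>sin \<theta> / sin (\<theta> + \<alpha> * t)\<bar>"
    using S tan_angle(3) by (simp add: exp_diff ln_sqrt[symmetric])
  then have N: "exp N = of_real (1 / sqrt pi * sqrt \<bar>sin \<theta> / sin (\<theta> + \<alpha> * t)\<bar>)"
    unfolding N_def exp_of_real by simp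
  have "KSH_gauss \<alpha> t P Q (x, p) = exp (- I x p) * exp (heat_a t * ?w\<^sup>2 + heat_b P Q t * ?w + heat_c P Q t)"
    by (simp add: KSH_gauss_def exp_rhoH_def entire_ext_heat_evol_psiY integral_unique[OF I])
  \<comment> \<open>Completing the square about the transported centre undoes the expansion from
    which \<open>heat_b\<close> and \<open>heat_c\<close> were read off.\<close>
  also have "heat_a t * ?w\<^sup>2 + heat_b P Q t * ?w + heat_c P Q t
      = N + I Q P + (- \<i> * ?P * (?w - ?X) - ?\<beta> / 2 * (?w - ?X)\<^sup>2)"
    by (simp add: heat_a_def heat_b_def heat_c_def N_def I_def) (simp add: algebra_simps power2_eq_square add_divide_distrib diff_divide_distrib)
  finally have "KSH_gauss \<alpha> t P Q (x, p) = exp N * exp (- (I x p - I Q P)) *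
      exp (- \<i> * ?P * (?w - ?X) - ?\<beta> / 2 * (?w - ?X)\<^sup>2)"
    by (simp only: exp_add[symmetric]) (simp add: algebra_simps)
  then show ?thesis unfolding N D .
qed

lemma KSH_gauss_formula:
  "KSH_gauss \<alpha> t P Q (x, p) =
    of_real (1 / sqrt pi * sqrt \<bar>sin \<theta> / sin (\<theta> + \<alpha> * t)\<bar>) *
    exp (- \<i> * of_real (P * (x - Q))) *
    exp ((of_real (- cos \<theta> * sin (\<alpha> * t) * (p - P)^2 - sin \<theta> * cos (\<alpha> * t) * (x - Q)^2)
          - 2 * \<i> * of_real (cos \<theta> * sin (\<alpha> * t) * (x - Q) * (p - P)))
         / of_real (2 * sin (\<alpha> * t + \<theta>)))"
proof -
  define u v where "u = x - Q" and "v = p - P"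
  have xp: "x = Q + u" "p = P + v" by (auto simp: u_def v_def)
  define s c S C where "s = sin (\<alpha> * t)" and "c = cos (\<alpha> * t)"
    and "S = sin (\<theta> + \<alpha> * t)" and "C = cos (\<theta> + \<alpha> * t)"
  define I where "I x p = (p_is \<alpha> t x p * x_is \<alpha> t x p - of_real (p * x)) / (2 * \<i>)" for x p
  have I: "((\<lambda>s. L_H \<alpha> (p_is \<alpha> s x p) (x_is \<alpha> s x p)) has_integral I x p) {0..t}" for x p
    unfolding I_def using \<alpha> t by (intro L_H_flow_has_integral) auto
  have D: "integral {0..t} (\<lambda>s. L_H \<alpha> (p_is \<alpha> s x p) (x_is \<alpha> s x p)
                                - L_H \<alpha> (p_is \<alpha> s Q P) (x_is \<alpha> s Q P)) = I x p - I Q P"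
    by (rule integral_unique[OF has_integral_diff[OF I I]])
  have sc: "s\<^sup>2 + c\<^sup>2 = 1" by (simp add: s_def c_def)
  have S: "S > 0" using sin_angle_pos[of t] t by (simp add: S_def)
  \<comment> \<open>Addition theorems for theta = (theta + alpha t) - alpha t. After bringing the
    cotangent to the denominator 2 S, the numerators contain exactly these two combinations, which
    is how cos theta and sin theta enter the result.\<close>
  have r1: "s * S + c * C = cos \<theta>"
    using cos_diff[of "\<theta> + \<alpha> * t" "\<alpha> * t"] by (simp add: s_def c_def S_def C_def)
  have r2: "c * S - s * C = sin \<theta>"
    using sin_diff[of "\<theta> + \<alpha> * t" "\<alpha> * t"] by (simp add: s_def c_def S_def C_def)
  have Ieq: "I x p = of_real (s * c / (2 * \<alpha>) * (p\<^sup>2 + \<alpha>\<^sup>2 * x\<^sup>2)) + \<i> * of_real (s\<^sup>2 * x * p)" for x p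
  proof -
    have "p_is \<alpha> t x p * x_is \<alpha> t x p = \<i> * of_real (s * c / \<alpha> * (p\<^sup>2 + \<alpha>\<^sup>2 * x\<^sup>2)) + of_real ((c\<^sup>2 - s\<^sup>2) * (x * p))"
      using \<alpha> by (simp add: p_is_def x_is_def complex_eq_iff field_simps power2_eq_square flip: s_def c_def)
    moreover have "(c\<^sup>2 - s\<^sup>2) = 1 - 2 * s\<^sup>2" using sc by simp
    ultimately have "p_is \<alpha> t x p * x_is \<alpha> t x p - of_real (p * x)
       = (2 * \<i>) * (of_real (s * c / (2 * \<alpha>) * (p\<^sup>2 + \<alpha>\<^sup>2 * x\<^sup>2)) + \<i> * of_real (s\<^sup>2 * x * p))"
      by (simp add: complex_eq_iff algebra_simps)
    then show ?thesis unfolding I_def by simp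
  qed
  have w: "w_tau \<alpha> t x p - x_is \<alpha> t Q P = of_real (c * u) + \<i> * of_real (s / \<alpha> * v)"
    by (simp add: w_tau_def x_is_def xp complex_eq_iff algebra_simps flip: s_def c_def)
       (simp add: add_divide_distrib algebra_simps)
  have P\<tau>: "p_is \<alpha> t Q P = of_real (c * P) + \<i> * of_real (\<alpha> * s * Q)"
    by (simp add: p_is_def flip: s_def c_def)
  \<comment> \<open>The action \<open>I\<close> is a homogeneous quadratic form, so I(Q + u, P + v)
    - I(Q, P) - I(u, v) is bilinear in the two vectors. Added to the term with P_tau, everything
    cancels except i P u.\<close>
  have lin: "I x p - I Q P + \<i> * p_is \<alpha> t Q P * (w_tau \<alpha> t x p - x_is \<alpha> t Q P)
      = I u v + \<i> * of_real (P * u)"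
  proof -
    have Pu: "s * s * (P * u) + c * c * (P * u) = P * u"
      using sc by (simp only: power2_eq_square distrib_right[symmetric] mult_1_left)
    have "I x p - I Q P + \<i> * p_is \<alpha> t Q P * (w_tau \<alpha> t x p - x_is \<alpha> t Q P)
      = I u v + \<i> * of_real (s * s * (P * u) + c * c * (P * u))"
      unfolding w P\<tau> unfolding Ieq xp using \<alpha>
      by (simp add: complex_eq_iff field_simps power2_eq_square)
    then show ?thesis unfolding Pu .
  qed
  have quad: "I u v + of_real (\<alpha> * cot (\<theta> + \<alpha> * t)) / 2 * (w_tau \<alpha> t x p - x_is \<alpha> t Q P)\<^sup>2
      = of_real (cos \<theta> * s * v\<^sup>2 + sin \<theta> * c * u\<^sup>2) / of_real (2 * S)
        + 2 * \<i> * of_real (cos \<theta> * s * u * v) / of_real (2 * S)"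
  proof -
    have cot: "cot (\<theta> + \<alpha> * t) = C / S" by (simp add: cot_def S_def C_def)
    have w2: "(w_tau \<alpha> t x p - x_is \<alpha> t Q P)\<^sup>2 = of_real ((c * u)\<^sup>2 - (s / \<alpha> * v)\<^sup>2) + \<i> * of_real (2 * (c * u) * (s / \<alpha> * v))"
      unfolding w by (simp add: complex_eq_iff power2_eq_square)
    have re: "s * c / (2 * \<alpha>) * (v\<^sup>2 + \<alpha>\<^sup>2 * u\<^sup>2) + \<alpha> * (C / S) / 2 * ((c * u)\<^sup>2 - (s / \<alpha> * v)\<^sup>2)
        = (cos \<theta> * s * v\<^sup>2 + sin \<theta> * c * u\<^sup>2) / (2 * S)"
    proof -
      have "s * c / (2 * \<alpha>) * (v\<^sup>2 + \<alpha>\<^sup>2 * u\<^sup>2) + \<alpha> * (C / S) / 2 * ((c * u)\<^sup>2 - (s / \<alpha> * v)\<^sup>2)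
        = (((c * S - s * C) / \<alpha>) * s * v\<^sup>2 + \<alpha> * (s * S + c * C) * c * u\<^sup>2) / (2 * S)"
        using \<alpha> S by (simp add: field_simps power2_eq_square)
      also have "\<dots> = (cos \<theta> * s * v\<^sup>2 + sin \<theta> * c * u\<^sup>2) / (2 * S)"
        unfolding r1 r2 using tan_angle \<alpha> by simp
      finally show ?thesis .
    qed
    have im: "s\<^sup>2 * u * v + \<alpha> * (C / S) / 2 * (2 * (c * u) * (s / \<alpha> * v)) = 2 * (cos \<theta> * s * u * v) / (2 * S)"
      unfolding r1[symmetric] using \<alpha> S by (simp add: field_simps power2_eq_square)
    show ?thesis
      unfolding Ieq w2 cot using re im \<alpha> by (simp add: complex_eq_iff mult_ac)
  qed
  have "- (I x p - I Q P) + (- \<i> * p_is \<alpha> t Q P * (w_tau \<alpha> t x p - x_is \<alpha> t Q P)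
         - of_real (\<alpha> * cot (\<theta> + \<alpha> * t)) / 2 * (w_tau \<alpha> t x p - x_is \<alpha> t Q P)^2)
      = - (I x p - I Q P + \<i> * p_is \<alpha> t Q P * (w_tau \<alpha> t x p - x_is \<alpha> t Q P))
        - of_real (\<alpha> * cot (\<theta> + \<alpha> * t)) / 2 * (w_tau \<alpha> t x p - x_is \<alpha> t Q P)^2"
    by (simp add: algebra_simps)
  also have "\<dots> = - \<i> * of_real (P * u) - (I u v + of_real (\<alpha> * cot (\<theta> + \<alpha> * t)) / 2 * (w_tau \<alpha> t x p - x_is \<alpha> t Q P)\<^sup>2)"
    unfolding lin by (simp add: algebra_simps)
  also have "\<dots> = - \<i> * of_real (P * u) + (of_real (- cos \<theta> * s * v\<^sup>2 - sin \<theta> * c * u\<^sup>2)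
          - 2 * \<i> * of_real (cos \<theta> * s * u * v)) / of_real (2 * S)"
    unfolding quad using S by (simp add: field_simps)
  finally have E: "exp (- (I x p - I Q P)) * exp (- \<i> * p_is \<alpha> t Q P * (w_tau \<alpha> t x p - x_is \<alpha> t Q P)
         - of_real (\<alpha> * cot (\<theta> + \<alpha> * t)) / 2 * (w_tau \<alpha> t x p - x_is \<alpha> t Q P)^2)
      = exp (- \<i> * of_real (P * u)) * exp ((of_real (- cos \<theta> * s * v\<^sup>2 - sin \<theta> * c * u\<^sup>2)
          - 2 * \<i> * of_real (cos \<theta> * s * u * v)) / of_real (2 * S))"
    by (simp only: exp_add[symmetric])
  show ?thesis
    unfolding KSH_gauss_formula_flow D mult.assoc[of _ "exp (- (I x p - I Q P))"] E
    by (simp add: s_def c_def S_def u_def v_def mult.assoc add.commute[of "\<alpha> * t"])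
qed

end

section \<open>Density of the coherent states\<close>

lemma integrable_gaussian:
  fixes a :: real
  assumes "a > 0"
  shows "integrable lborel (\<lambda>x. exp (- (a * x\<^sup>2)))"
proof -
  have "integrable lborel (\<lambda>x. (sqrt (2 * pi) * (1 / sqrt (2 * a))) * normal_density 0 (1 / sqrt (2 * a)) x)"
    by (intro integrable_mult_right integrable_normal_density) (use assms in simp)
  moreover have "(sqrt (2 * pi) * (1 / sqrt (2 * a))) * normal_density 0 (1 / sqrt (2 * a)) x = exp (- (a * x\<^sup>2))" for x
    using assms by (simp add: normal_density_def real_sqrt_divide real_sqrt_mult power_divide power_mult_distrib)
  ultimately show ?thesis by simp
qed

text \<open>The substitution x = m + sigma y completes the square for the real part of b, leaving a
  standard normal density times a character of frequency sigma Im b; the integral is then a value of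
  the characteristic function of the normal distribution.\<close>

lemma complex_gaussian:
  fixes a :: real and b :: complex
  assumes a: "a > 0"
  shows "has_bochner_integral lborel (\<lambda>x. exp (b * of_real x - of_real (a * x\<^sup>2)))
    (of_real (sqrt (pi / a)) * exp (b\<^sup>2 / of_real (4 * a)))"
proof -
  define \<sigma> m where "\<sigma> = 1 / sqrt (2 * a)" and "m = Re b / (2 * a)"
  have \<sigma>: "\<sigma> > 0" "\<sigma>\<^sup>2 = 1 / (2 * a)" using a by (auto simp: \<sigma>_def power_divide)
  let ?F = "\<lambda>x. exp (b * of_real x - of_real (a * x\<^sup>2))"
  define k where "k = exp (of_real ((Re b)\<^sup>2 / (4 * a)) + \<i> * of_real (Im b * m))"
  have eq: "?F (m + \<sigma> * y) = (k * of_real (sqrt (2 * pi))) * (std_normal_density y *\<^sub>R iexp (Im b * \<sigma> * y))" for y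
  proof -
    have r: "- y\<^sup>2 / 2 + (Re b)\<^sup>2 / (4 * a) = Re b * (m + \<sigma> * y) - a * (m + \<sigma> * y)\<^sup>2"
    proof -
      have "a * (m + \<sigma> * y)\<^sup>2 = a * m\<^sup>2 + 2 * a * m * \<sigma> * y + a * \<sigma>\<^sup>2 * y\<^sup>2"
        by (simp add: power2_eq_square algebra_simps)
      also have "\<dots> = (Re b)\<^sup>2 / (4 * a) + Re b * \<sigma> * y + y\<^sup>2 / 2"
        using a \<sigma>(2) by (simp add: m_def power2_eq_square field_simps)
      finally show ?thesis using a by (simp add: m_def power2_eq_square field_simps)
    qed
    have "(k * of_real (sqrt (2 * pi))) * (std_normal_density y *\<^sub>R iexp (Im b * \<sigma> * y))
        = k * (of_real (exp (- y\<^sup>2 / 2)) * iexp (Im b * \<sigma> * y))"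
      by (simp add: std_normal_density_def scaleR_conv_of_real)
    also have "\<dots> = exp (of_real ((Re b)\<^sup>2 / (4 * a)) + \<i> * of_real (Im b * m) + (of_real (- y\<^sup>2 / 2) + \<i> * of_real (Im b * \<sigma> * y)))"
      unfolding k_def exp_of_real[symmetric] by (simp only: exp_add)
    also have "of_real ((Re b)\<^sup>2 / (4 * a)) + \<i> * of_real (Im b * m) + (of_real (- y\<^sup>2 / 2) + \<i> * of_real (Im b * \<sigma> * y))
      = of_real (- y\<^sup>2 / 2 + (Re b)\<^sup>2 / (4 * a)) + \<i> * of_real (Im b * (m + \<sigma> * y))"
      by (simp add: algebra_simps)
    also have "\<dots> = b * of_real (m + \<sigma> * y) - of_real (a * (m + \<sigma> * y)\<^sup>2)"
      unfolding r by (simp add: complex_eq_iff)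
    finally show ?thesis by simp
  qed
  have std: "has_bochner_integral lborel (\<lambda>y. std_normal_density y *\<^sub>R iexp (Im b * \<sigma> * y))
      (of_real (exp (- ((Im b * \<sigma>)\<^sup>2) / 2)))"
  proof -
    have i: "integrable lborel (\<lambda>y. std_normal_density y *\<^sub>R iexp (Im b * \<sigma> * y))"
      by (rule Bochner_Integration.integrable_bound[OF integrable_normal_density[of 1 0]]) auto
    have "(LINT y|lborel. std_normal_density y *\<^sub>R iexp (Im b * \<sigma> * y)) = char std_normal_distribution (Im b * \<sigma>)"
      unfolding char_def by (subst integral_density) (auto simp: mult_ac)
    then show ?thesis using i by (simp add: has_bochner_integral_iff char_std_normal_distribution)
  qed
  have "has_bochner_integral lborel (\<lambda>y. ?F (m + \<sigma> * y))
      ((k * of_real (sqrt (2 * pi))) * of_real (exp (- ((Im b * \<sigma>)\<^sup>2) / 2)))"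
    unfolding eq by (rule has_bochner_integral_mult_right[OF std])
  then have "has_bochner_integral lborel ?F
      (\<sigma> *\<^sub>R ((k * of_real (sqrt (2 * pi))) * of_real (exp (- ((Im b * \<sigma>)\<^sup>2) / 2))))"
    using \<sigma> lborel_has_bochner_integral_real_affine_iff[of \<sigma> ?F _ m] by simp
  moreover have "\<sigma> *\<^sub>R ((k * of_real (sqrt (2 * pi))) * of_real (exp (- ((Im b * \<sigma>)\<^sup>2) / 2)))
     = of_real (sqrt (pi / a)) * exp (b\<^sup>2 / of_real (4 * a))"
  proof -
    have 1: "\<sigma> * sqrt (2 * pi) = sqrt (pi / a)"
      using a by (simp add: \<sigma>_def real_sqrt_divide real_sqrt_mult)
    have "\<sigma> *\<^sub>R ((k * of_real (sqrt (2 * pi))) * of_real (exp (- ((Im b * \<sigma>)\<^sup>2) / 2)))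
      = of_real (\<sigma> * sqrt (2 * pi)) * (k * of_real (exp (- ((Im b * \<sigma>)\<^sup>2) / 2)))"
      by (simp add: scaleR_conv_of_real)
    also have "k * of_real (exp (- ((Im b * \<sigma>)\<^sup>2) / 2)) =
      exp (of_real ((Re b)\<^sup>2 / (4 * a)) + \<i> * of_real (Im b * m) + of_real (- ((Im b * \<sigma>)\<^sup>2) / 2))"
      unfolding k_def exp_of_real[symmetric] by (simp only: exp_add)
    also have "of_real ((Re b)\<^sup>2 / (4 * a)) + \<i> * of_real (Im b * m) + of_real (- ((Im b * \<sigma>)\<^sup>2) / 2) = b\<^sup>2 / of_real (4 * a)"
    proof -
      have "b\<^sup>2 / of_real (4 * a) = of_real (((Re b)\<^sup>2 - (Im b)\<^sup>2) / (4 * a)) + \<i> * of_real (2 * Re b * Im b / (4 * a))"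
      proof -
        have "b\<^sup>2 = of_real ((Re b)\<^sup>2 - (Im b)\<^sup>2) + \<i> * of_real (2 * Re b * Im b)"
          by (simp add: complex_eq_iff power2_eq_square)
        then show ?thesis using a by (simp add: add_divide_distrib diff_divide_distrib)
      qed
      moreover have "- ((Im b * \<sigma>)\<^sup>2) / 2 = - (Im b)\<^sup>2 / (4 * a)"
        using \<sigma>(2) a by (simp add: power_mult_distrib)
      moreover have "Im b * m = 2 * Re b * Im b / (4 * a)" using a by (simp add: m_def field_simps)
      ultimately show ?thesis by (simp add: diff_divide_distrib)
    qed
    finally show ?thesis unfolding 1 .
  qed
  ultimately show ?thesis by simp
qed

text \<open>Trigonometric polynomials with arbitrary real frequencies. The sign in the exponent is
  that of \<open>psiY\<close>, so multiplying by the Gaussian exp (- x^2 / 2) yields combinations of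
  coherent states with Q = 0.\<close>

inductive trig :: "(real \<Rightarrow> complex) \<Rightarrow> bool" where
  mono: "trig (\<lambda>x. c * exp (- \<i> * of_real P * of_real x))"
| add: "trig f \<Longrightarrow> trig g \<Longrightarrow> trig (\<lambda>x. f x + g x)"

lemma trig_mult_mono:
  "trig f \<Longrightarrow> trig (\<lambda>x. c * exp (- \<i> * of_real P * of_real x) * f x)"
proof (induction rule: trig.induct)
  case (mono d R)
  have "(\<lambda>x. c * exp (- \<i> * of_real P * of_real x) * (d * exp (- \<i> * of_real R * of_real x)))
    = (\<lambda>x. (c * d) * exp (- \<i> * of_real (P + R) * of_real x))"
    by (simp add: fun_eq_iff algebra_simps exp_add[symmetric] mult_exp_exp)
  then show ?case using trig.mono by metis
next
  case (add f g)
  then show ?case using trig.add[OF add.IH] by (simp add: distrib_left)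
qed

lemma trig_mult: "trig f \<Longrightarrow> trig g \<Longrightarrow> trig (\<lambda>x. f x * g x)"
proof (induction rule: trig.induct)
  case (mono c P)
  then show ?case using trig_mult_mono by simp
next
  case (add f f')
  then show ?case using trig.add[OF add.IH] by (simp add: distrib_right)
qed

lemma trig_const: "trig (\<lambda>x. c)"
  using trig.mono[of c 0] by simp

lemma trig_cos: "trig (\<lambda>x. of_real (cos (\<omega> * x)))"
proof -
  have "complex_of_real (cos (\<omega> * x)) = (1/2) * exp (- \<i> * of_real \<omega> * of_real x)
     + (1/2) * exp (- \<i> * of_real (- \<omega>) * of_real x)" for x
    by (simp add: cos_of_real[symmetric] cos_exp_eq field_simps)
  then show ?thesis using trig.add[OF trig.mono trig.mono, of "1/2" \<omega> "1/2" "-\<omega>"] by simp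
qed

lemma trig_sin: "trig (\<lambda>x. of_real (sin (\<omega> * x)))"
proof -
  have "complex_of_real (sin (\<omega> * x)) = (\<i>/2) * exp (- \<i> * of_real \<omega> * of_real x)
     + (-\<i>/2) * exp (- \<i> * of_real (- \<omega>) * of_real x)" for x
    by (simp add: sin_of_real[symmetric] sin_exp_eq field_simps)
  then show ?thesis using trig.add[OF trig.mono trig.mono, of "\<i>/2" \<omega> "-\<i>/2" "-\<omega>"] by simp
qed

text \<open>A real linear form on the plane restricted to the unit circle is a combination of cosine
  and sine, and \<open>trig\<close> is closed under sums and products. This lets polynomial
  approximation on the circle produce trigonometric polynomials.\<close>

lemma trig_real_polynomial_function:
  fixes g :: "complex \<Rightarrow> real"
  assumes "real_polynomial_function g"
  shows "trig (\<lambda>x. of_real (g (cis (\<omega> * x))))"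
  using assms
proof (induction rule: real_polynomial_function.induct)
  case (linear f)
  have "complex_of_real (f (cis y)) = of_real (f 1) * of_real (cos y) + of_real (f \<i>) * of_real (sin y)" for y
  proof -
    have "cis y = cos y *\<^sub>R 1 + sin y *\<^sub>R \<i>" by (simp add: complex_eq_iff)
    then have "f (cis y) = f (cos y *\<^sub>R 1 + sin y *\<^sub>R \<i>)" by simp
    also have "\<dots> = cos y * f 1 + sin y * f \<i>"
      using linear by (simp add: linear_simps)
    finally show ?thesis by simp
  qed
  then show ?case
    using trig.add[OF trig_mult[OF trig_const trig_cos] trig_mult[OF trig_const trig_sin]] by simp
next
  case (const c)
  then show ?case by (rule trig_const)
next
  case (add f g)
  then show ?case using trig.add[OF add.IH] by simp
next
  case (mult f g)
  then show ?case using trig_mult[OF mult.IH] by simp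
qed

text \<open>The matching condition at the endpoints makes \<open>h\<close> on [-L, L] a continuous
  function on the circle, where Stone-Weierstrass applies. The approximant is periodic and close to
  a bounded function on the whole circle, hence bounded by \<open>B + e\<close> on all of the real
  line.\<close>

lemma trig_approx_real:
  fixes h :: "real \<Rightarrow> real"
  assumes cont: "continuous_on UNIV h" and L: "L > 0" "h L = h (- L)"
    and B: "\<And>x. \<bar>h x\<bar> \<le> B" and e: "e > 0"
  obtains q where "trig (\<lambda>x. of_real (q x))" "\<And>x. x \<in> {-L..L} \<Longrightarrow> \<bar>h x - q x\<bar> < e" "\<And>x. \<bar>q x\<bar> \<le> B + e"
proof -
  \<comment> \<open>The point x corresponds to the angle pi x / L. On the upper half circle the
    angle is the arccos of the real part, on the lower half its negative; the two branches meet at 1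
    in \<open>h 0\<close>, and at -1 because \<open>h L = h (- L)\<close>.\<close>
  define H where "H z = (if 0 \<le> Im z then h (L / pi * arccos (Re z)) else h (- (L / pi * arccos (Re z))))" for z
  have "continuous_on (sphere 0 1) H"
  proof -
    have c: "continuous_on {z. cmod z = 1} (\<lambda>z. arccos (Re z))"
    proof (rule continuous_on_arccos)
      show "\<forall>z\<in>{z. cmod z = 1}. - 1 \<le> Re z \<and> Re z \<le> 1"
      proof
        fix z :: complex assume "z \<in> {z. cmod z = 1}"
        then show "- 1 \<le> Re z \<and> Re z \<le> 1" using abs_Re_le_cmod[of z] by (simp add: abs_le_iff)
      qed
    qed (intro continuous_intros)
    have "continuous_on ({z. cmod z = 1 \<and> 0 \<le> Im z} \<union> {z. cmod z = 1 \<and> Im z \<le> 0}) H"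
      unfolding H_def
    proof (rule continuous_on_cases)
      have "closed ({z. cmod z = 1} \<inter> {z. 0 \<le> Im z})"
        by (intro closed_Int closed_Collect_eq closed_Collect_le continuous_intros)
      moreover have "{z. cmod z = 1} \<inter> {z. 0 \<le> Im z} = {z. cmod z = 1 \<and> 0 \<le> Im z}" by auto
      ultimately show "closed {z. cmod z = 1 \<and> 0 \<le> Im z}" by simp
      have "closed ({z. cmod z = 1} \<inter> {z. Im z \<le> 0})"
        by (intro closed_Int closed_Collect_eq closed_Collect_le continuous_intros)
      moreover have "{z. cmod z = 1} \<inter> {z. Im z \<le> 0} = {z. cmod z = 1 \<and> Im z \<le> 0}" by auto
      ultimately show "closed {z. cmod z = 1 \<and> Im z \<le> 0}" by simp
      show "continuous_on {z. cmod z = 1 \<and> 0 \<le> Im z} (\<lambda>z. h (L / pi * arccos (Re z)))"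
        by (intro continuous_on_compose2[OF cont] continuous_intros continuous_on_subset[OF c]) auto
      show "continuous_on {z. cmod z = 1 \<and> Im z \<le> 0} (\<lambda>z. h (- (L / pi * arccos (Re z))))"
        by (intro continuous_on_compose2[OF cont] continuous_intros continuous_on_subset[OF c]) auto
      show "\<forall>z. z \<in> {z. cmod z = 1 \<and> 0 \<le> Im z} \<and> \<not> 0 \<le> Im z \<or> z \<in> {z. cmod z = 1 \<and> Im z \<le> 0} \<and> 0 \<le> Im z \<longrightarrow>
         h (L / pi * arccos (Re z)) = h (- (L / pi * arccos (Re z)))"
      proof (intro allI impI)
        fix z assume "z \<in> {z. cmod z = 1 \<and> 0 \<le> Im z} \<and> \<not> 0 \<le> Im z \<or> z \<in> {z. cmod z = 1 \<and> Im z \<le> 0} \<and> 0 \<le> Im z"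
        then have "Im z = 0" "cmod z = 1" by auto
        then have "\<bar>Re z\<bar> = 1" by (simp add: cmod_def)
        then have "Re z = 1 \<or> Re z = -1" by linarith
        then show "h (L / pi * arccos (Re z)) = h (- (L / pi * arccos (Re z)))"
          using L by auto
      qed
    qed
    moreover have "sphere 0 1 = {z. cmod z = 1 \<and> 0 \<le> Im z} \<union> {z. cmod z = 1 \<and> Im z \<le> 0}"
      by (auto simp: dist_norm)
    ultimately show ?thesis by simp
  qed
  then obtain g where g: "real_polynomial_function g" "\<And>z. z \<in> sphere 0 1 \<Longrightarrow> \<bar>H z - g z\<bar> < e"
    using Stone_Weierstrass_real_polynomial_function[OF compact_sphere _ e] by blast
  define q where "q x = g (cis (pi / L * x))" for x
  have HB: "\<bar>H z\<bar> \<le> B" for z by (simp add: H_def B)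
  have approx: "\<bar>H (cis (pi / L * x)) - q x\<bar> < e" for x
    unfolding q_def by (rule g(2)) (simp add: dist_norm)
  show ?thesis
  proof (rule that)
    show "trig (\<lambda>x. of_real (q x))" unfolding q_def by (rule trig_real_polynomial_function[OF g(1)])
    show "\<bar>q x\<bar> \<le> B + e" for x using approx[of x] HB[of "cis (pi / L * x)"] by linarith
    fix x assume x: "x \<in> {-L..L}"
    have "H (cis (pi / L * x)) = h x"
    proof (cases "x \<ge> 0")
      case True
      have r: "0 \<le> pi / L * x" "pi / L * x \<le> pi" using True x L by (auto simp: field_simps)
      have "sin (pi / L * x) \<ge> 0" using r by (intro sin_ge_zero) auto
      moreover have "arccos (cos (pi / L * x)) = pi / L * x" using r by (rule arccos_cos)
      ultimately show ?thesis using L by (simp add: H_def)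
    next
      case False
      have r: "0 \<le> pi / L * (- x)" "pi / L * (- x) \<le> pi"
        using False x L mult_left_mono[of "- x" L "pi / L"] by (auto intro!: divide_nonpos_pos mult_nonneg_nonpos)
      have ac: "arccos (cos (pi / L * x)) = pi / L * (- x)" using arccos_cos[OF r] by simp
      show ?thesis
      proof (cases "x = - L")
        \<comment> \<open>The endpoint -L lands on -1, which the upper branch of \<open>H\<close>
          evaluates as \<open>h L\<close>.\<close>
        case True
        then show ?thesis using L by (simp add: H_def)
      next
        case nL: False
        have "0 < pi / L * (- x)" "pi / L * (- x) < pi"
          using False x L nL mult_strict_left_mono[of "- x" L "pi / L"]
          by (auto intro!: divide_neg_pos mult_pos_neg)
        then have "sin (pi / L * (- x)) > 0" by (intro sin_gt_zero) auto
        then have "\<not> 0 \<le> sin (pi / L * x)" by simp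
        with ac show ?thesis using L by (simp add: H_def)
      qed
    qed
    with approx[of x] show "\<bar>h x - q x\<bar> < e" by simp
  qed
qed

lemma trig_approx:
  fixes h :: "real \<Rightarrow> complex"
  assumes cont: "continuous_on UNIV h" and L: "L > 0" "h L = h (- L)"
    and B: "\<And>x. cmod (h x) \<le> B" and e: "e > 0"
  obtains q where "trig q" "\<And>x. x \<in> {-L..L} \<Longrightarrow> cmod (h x - q x) < e" "\<And>x. cmod (q x) \<le> 2 * B + e"
proof -
  obtain q1 where q1: "trig (\<lambda>x. of_real (q1 x))" "\<And>x. x \<in> {-L..L} \<Longrightarrow> \<bar>Re (h x) - q1 x\<bar> < e / 2" "\<And>x. \<bar>q1 x\<bar> \<le> B + e / 2"
    by (rule trig_approx_real[of "\<lambda>x. Re (h x)" L B "e/2"])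
       (use assms in \<open>auto intro!: continuous_intros order_trans[OF abs_Re_le_cmod]\<close>)
  obtain q2 where q2: "trig (\<lambda>x. of_real (q2 x))" "\<And>x. x \<in> {-L..L} \<Longrightarrow> \<bar>Im (h x) - q2 x\<bar> < e / 2" "\<And>x. \<bar>q2 x\<bar> \<le> B + e / 2"
    by (rule trig_approx_real[of "\<lambda>x. Im (h x)" L B "e/2"])
       (use assms in \<open>auto intro!: continuous_intros order_trans[OF abs_Im_le_cmod]\<close>)
  show ?thesis
  proof (rule that[of "\<lambda>x. of_real (q1 x) + \<i> * of_real (q2 x)"])
    show "trig (\<lambda>x. of_real (q1 x) + \<i> * of_real (q2 x))"
      by (intro trig.add trig_mult trig_const q1 q2)
    show "cmod (h x - (of_real (q1 x) + \<i> * of_real (q2 x))) < e" if "x \<in> {-L..L}" for x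
      using cmod_le[of "h x - (of_real (q1 x) + \<i> * of_real (q2 x))"] q1(2)[OF that] q2(2)[OF that] by simp
    show "cmod (of_real (q1 x) + \<i> * of_real (q2 x)) \<le> 2 * B + e" for x
      using cmod_le[of "of_real (q1 x) + \<i> * of_real (q2 x)"] q1(3)[of x] q2(3)[of x] by simp
  qed
qed

section \<open>The span of the coherent states and its density\<close>

lemma in_V_psiY: "in_V (\<lambda>x. c * psiY P Q x)"
  unfolding in_V_def lin_comb_def
  by (intro exI[of _ 1] exI[of _ "\<lambda>_. c"] exI[of _ "\<lambda>_. P"] exI[of _ "\<lambda>_. Q"]) simp

lemma in_V_add:
  assumes "in_V f" "in_V g"
  shows "in_V (\<lambda>x. f x + g x)"
proof -
  obtain n c P Q m d R S where f: "f = lin_comb n c P Q" and g: "g = lin_comb m d R S"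
    using assms unfolding in_V_def by blast
  let ?j = "\<lambda>u v k. if k < n then u k else v (k - n)"
  have "f x + g x = lin_comb (n + m) (?j c d) (?j P R) (?j Q S) x" for x
  proof -
    have "lin_comb (n + m) (?j c d) (?j P R) (?j Q S) x
      = (\<Sum>k<n. c k * psiY (P k) (Q k) x) + (\<Sum>k=n..<n+m. d (k - n) * psiY (R (k - n)) (S (k - n)) x)"
      unfolding lin_comb_def
      by (subst sum.atLeastLessThan_concat[of 0 n "n + m", symmetric, unfolded atLeast0LessThan]) auto
    also have "(\<Sum>k=n..<n+m. d (k - n) * psiY (R (k - n)) (S (k - n)) x) = (\<Sum>k<m. d k * psiY (R k) (S k) x)"
      using sum.shift_bounds_nat_ivl[of "\<lambda>k. d (k - n) * psiY (R (k - n)) (S (k - n)) x" 0 n m]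
      by (simp add: atLeast0LessThan add.commute)
    finally show ?thesis by (simp add: f g lin_comb_def)
  qed
  then show ?thesis unfolding in_V_def by blast
qed

lemma in_V_cmult:
  assumes "in_V f"
  shows "in_V (\<lambda>x. c * f x)"
proof -
  obtain n d P Q where f: "f = lin_comb n d P Q"
    using assms unfolding in_V_def by blast
  have "(\<lambda>x. c * f x) = lin_comb n (\<lambda>k. c * d k) P Q"
    by (simp add: f lin_comb_def fun_eq_iff sum_distrib_left mult.assoc)
  then show ?thesis unfolding in_V_def by blast
qed

lemma trig_gauss_in_V: "trig q \<Longrightarrow> in_V (\<lambda>x. q x * of_real (exp (- (x\<^sup>2 / 2))))"
proof (induction rule: trig.induct)
  case (mono c P)
  have "c * exp (- \<i> * of_real P * of_real x) * of_real (exp (- (x\<^sup>2 / 2))) = (c * of_real (sqrt pi)) * psiY P 0 x" for x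
  proof -
    have "exp (- \<i> * of_real P * of_real x) * complex_of_real (exp (- (x\<^sup>2 / 2)))
        = exp (- \<i> * of_real P * of_real (x - 0) - of_real ((x - 0)\<^sup>2 / 2))"
      unfolding exp_of_real[symmetric] by (simp add: mult_exp_exp)
    then show ?thesis by (simp add: psiY_def)
  qed
  then show ?case using in_V_psiY by (simp only:)
next
  case (add f g)
  then show ?case using in_V_add[OF add.IH] by (simp add: distrib_right)
qed

lemma l2_dominated_tendsto:
  assumes [measurable]: "\<And>n. f n \<in> borel_measurable M" "g \<in> borel_measurable M"
    and lim: "AE x in M. (\<lambda>n. f n x) \<longlonglongrightarrow> g x"
    and w: "integrable M w" and dom: "\<And>n x. (cmod (f n x - g x))\<^sup>2 \<le> w x"
  shows "(\<lambda>n. l2 M (\<lambda>x. f n x - g x)) \<longlonglongrightarrow> 0"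
proof -
  have "(\<lambda>n. LINT x|M. (cmod (f n x - g x))\<^sup>2) \<longlonglongrightarrow> (LINT x|M. 0)"
  proof (rule integral_dominated_convergence[OF _ _ w])
    show "AE x in M. (\<lambda>n. (cmod (f n x - g x))\<^sup>2) \<longlonglongrightarrow> 0"
      using lim
    proof eventually_elim
      case (elim x)
      have "(\<lambda>n. (cmod (f n x - g x))\<^sup>2) \<longlonglongrightarrow> (cmod (g x - g x))\<^sup>2"
        by (intro tendsto_intros elim)
      then show ?case by simp
    qed
  qed (use dom in auto)
  then have "(\<lambda>n. sqrt (LINT x|M. (cmod (f n x - g x))\<^sup>2)) \<longlonglongrightarrow> sqrt 0"
    by (intro tendsto_real_sqrt) simp
  then show ?thesis by (simp add: l2_def)
qed

text \<open>Dividing by the Gaussian keeps \<open>f\<close> continuous with compact support, so the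
  quotient is approximated by trigonometric polynomials on growing intervals. Multiplying back by
  the Gaussian turns the uniform global bound on these polynomials into an integrable
  majorant.\<close>

lemma continuous_compact_support_approx_V:
  fixes f :: "real \<Rightarrow> complex"
  assumes cont: "continuous_on UNIV f" and supp: "\<And>x. \<bar>x\<bar> \<ge> R \<Longrightarrow> f x = 0" and e: "e > 0"
  obtains g where "in_V g" "l2 lborel (\<lambda>x. f x - g x) < e"
proof -
  define h where "h x = f x * of_real (exp (x\<^sup>2 / 2))" for x
  have hc: "continuous_on UNIV h"
    unfolding h_def by (intro continuous_intros cont) simp_all
  have "bounded (h ` {-\<bar>R\<bar>..\<bar>R\<bar>})"
    by (intro compact_imp_bounded compact_continuous_image continuous_on_subset[OF hc]) auto
  then obtain B0 where B0: "\<And>x. x \<in> {-\<bar>R\<bar>..\<bar>R\<bar>} \<Longrightarrow> cmod (h x) \<le> B0"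
    unfolding bounded_iff by blast
  define B where "B = max 0 B0"
  have B: "cmod (h x) \<le> B" for x
  proof (cases "x \<in> {-\<bar>R\<bar>..\<bar>R\<bar>}")
    case False
    then have "f x = 0" by (intro supp) auto
    then show ?thesis by (simp add: h_def B_def)
  qed (use B0[of x] in \<open>auto simp: B_def\<close>)
  \<comment> \<open>The endpoints |R| + n + 1 and their negatives lie outside the support, so
    \<open>h\<close> takes the value 0 at both, as the matching condition asks.\<close>
  have "\<exists>q. trig q \<and> (\<forall>x\<in>{-(\<bar>R\<bar> + real n + 1)..\<bar>R\<bar> + real n + 1}. cmod (h x - q x) < 1 / (real n + 1)) \<and>
      (\<forall>x. cmod (q x) \<le> 2 * B + 1 / (real n + 1))" for n
  proof -
    have "h (\<bar>R\<bar> + real n + 1) = h (- (\<bar>R\<bar> + real n + 1))"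
      using supp[of "\<bar>R\<bar> + real n + 1"] supp[of "- (\<bar>R\<bar> + real n + 1)"] by (simp add: h_def)
    then show ?thesis
      using trig_approx[OF hc _ _ B, of "\<bar>R\<bar> + real n + 1" "1 / (real n + 1)"]
      by (metis add_nonneg_pos abs_ge_zero of_nat_0_le_iff add_nonneg_nonneg zero_less_one divide_pos_pos)
  qed
  then obtain q where q: "\<And>n. trig (q n)"
     "\<And>n x. x \<in> {-(\<bar>R\<bar> + real n + 1)..\<bar>R\<bar> + real n + 1} \<Longrightarrow> cmod (h x - q n x) < 1 / (real n + 1)"
     "\<And>n x. cmod (q n x) \<le> 2 * B + 1 / (real n + 1)"
    by metis
  define g where "g n x = q n x * of_real (exp (- (x\<^sup>2 / 2)))" for n x
  have gV: "in_V (g n)" for n unfolding g_def[abs_def] by (rule trig_gauss_in_V[OF q(1)])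
  have psi_m: "psiY P Q \<in> borel_measurable borel" for P Q
    unfolding psiY_def by (intro borel_measurable_continuous_onI continuous_intros) auto
  have gm: "g n \<in> borel_measurable borel" for n
    using gV[of n] psi_m unfolding in_V_def lin_comb_def by auto
  have fm: "f \<in> borel_measurable borel" by (rule borel_measurable_continuous_onI[OF cont])
  have fh: "f x = h x * of_real (exp (- (x\<^sup>2 / 2)))" for x
    by (simp add: h_def exp_minus)
  have diff: "cmod (g n x - f x) = cmod (h x - q n x) * exp (- (x\<^sup>2 / 2))" for n x
    by (simp add: g_def fh norm_minus_commute norm_mult flip: left_diff_distrib)
  have inv1: "1 / (real n + 1) \<le> 1" for n by simp
  have "(\<lambda>n. l2 lborel (\<lambda>x. g n x - f x)) \<longlonglongrightarrow> 0"
  proof (rule l2_dominated_tendsto)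
    show "integrable lborel (\<lambda>x. (3 * B + 1)\<^sup>2 * exp (- (1 * x\<^sup>2)))"
      by (intro integrable_mult_right integrable_gaussian) auto
    fix n x
    have "cmod (h x - q n x) \<le> 3 * B + 1"
      using norm_triangle_ineq4[of "h x" "q n x"] B[of x] q(3)[of n x] inv1[of n] by linarith
    then have "(cmod (g n x - f x))\<^sup>2 \<le> ((3 * B + 1) * exp (- (x\<^sup>2 / 2)))\<^sup>2"
      unfolding diff by (intro power_mono mult_right_mono) auto
    also have "\<dots> = (3 * B + 1)\<^sup>2 * exp (- (1 * x\<^sup>2))"
      by (simp add: power_mult_distrib flip: exp_double)
    finally show "(cmod (g n x - f x))\<^sup>2 \<le> (3 * B + 1)\<^sup>2 * exp (- (1 * x\<^sup>2))" .
  next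
    have "(\<lambda>n. g n x) \<longlonglongrightarrow> f x" for x
    proof -
      have "(\<lambda>n. g n x - f x) \<longlonglongrightarrow> 0"
      proof (rule Lim_null_comparison)
        show "(\<lambda>n. 1 / (real n + 1)) \<longlonglongrightarrow> 0"
          using LIMSEQ_inverse_real_of_nat by (simp add: inverse_eq_divide add.commute)
        obtain N where N: "real N \<ge> \<bar>x\<bar>" using real_arch_simple by blast
        show "\<forall>\<^sub>F n in sequentially. norm (g n x - f x) \<le> 1 / (real n + 1)"
          unfolding eventually_sequentially
        proof (intro exI allI impI)
          fix n assume "N \<le> n"
          then have "x \<in> {-(\<bar>R\<bar> + real n + 1)..\<bar>R\<bar> + real n + 1}" using N by auto
          from q(2)[OF this] have "cmod (h x - q n x) * exp (- (x\<^sup>2 / 2)) \<le> 1 / (real n + 1) * 1"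
            by (intro mult_mono) auto
          then show "norm (g n x - f x) \<le> 1 / (real n + 1)" by (simp add: diff)
        qed
      qed
      then show ?thesis by (simp add: LIM_zero_iff)
    qed
    then show "AE x in lborel. (\<lambda>n. g n x) \<longlonglongrightarrow> f x" by auto
  qed (use gm fm in auto)
  from LIMSEQ_D[OF this e] obtain n where "l2 lborel (\<lambda>x. g n x - f x) < e" by auto
  then show ?thesis using that[OF gV[of n]] l2_minus_commute[of lborel f "g n"] by simp
qed

text \<open>Radial retraction of the plane onto the closed disc of radius \<open>k\<close>.\<close>

definition clip :: "real \<Rightarrow> complex \<Rightarrow> complex" where
  "clip k z = of_real (1 / max 1 (cmod z / k)) * z"

lemma continuous_on_clip: "k > 0 \<Longrightarrow> continuous_on UNIV (clip k)"
  unfolding clip_def by (intro continuous_intros) auto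

lemma clip_eq: "cmod z \<le> k \<Longrightarrow> k > 0 \<Longrightarrow> clip k z = z"
  by (simp add: clip_def max_def field_simps)

lemma cmod_clip: "k > 0 \<Longrightarrow> cmod (clip k z) \<le> k"
  by (auto simp: clip_def norm_mult norm_divide max_def field_simps)

lemma cmod_clip_diff: "k > 0 \<Longrightarrow> cmod (clip k z - z) \<le> cmod z"
proof -
  assume k: "k > 0"
  let ?m = "max 1 (cmod z / k)"
  have "clip k z - z = of_real (1 / ?m - 1) * z" by (simp add: clip_def algebra_simps)
  moreover have "\<bar>1 / ?m - 1\<bar> \<le> 1" by (simp add: abs_le_iff max_def field_simps)
  ultimately show ?thesis
    by (simp only: norm_mult norm_of_real) (simp add: mult_left_le_one_le)
qed

text \<open>A measurable function is almost everywhere the limit of continuous ones. Cutting these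
  off and retracting them into the disc of radius \<open>k\<close> leaves the limit unchanged,
  because \<open>f\<close> already respects both constraints, and makes dominated convergence
  available.\<close>

lemma bounded_compact_support_approx_continuous:
  fixes f :: "real \<Rightarrow> complex"
  assumes fm: "f \<in> borel_measurable borel" and k: "k > 0" and bd: "\<And>x. cmod (f x) \<le> k"
    and supp: "\<And>x. \<bar>x\<bar> > k \<Longrightarrow> f x = 0" and e: "e > 0"
  obtains g where "continuous_on UNIV g" "\<And>x. \<bar>x\<bar> \<ge> k + 1 \<Longrightarrow> g x = 0"
    "\<And>x. cmod (g x) \<le> k" "l2 lborel (\<lambda>x. f x - g x) < e"
proof -
  have "f \<in> borel_measurable (lebesgue_on UNIV)"
    using fm by (simp add: lebesgue_on_UNIV_eq measurable_completion)
  then have "f measurable_on UNIV"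
    by (subst measurable_on_iff_borel_measurable) auto
  then obtain N g where N: "negligible N" and g: "\<And>n. continuous_on UNIV (g n)"
    and lim: "\<And>x. x \<notin> N \<Longrightarrow> (\<lambda>n. g n x) \<longlonglongrightarrow> f x"
    unfolding measurable_on_def by auto
  \<comment> \<open>A tent-shaped cutoff: 1 on [-k, k] and 0 outside [-k - 1, k + 1].\<close>
  define cut where "cut x = max 0 (min 1 (k + 1 - \<bar>x\<bar>))" for x :: real
  define G where "G n x = of_real (cut x) * clip k (g n x)" for n x
  have Gc: "continuous_on UNIV (G n)" for n
    unfolding G_def cut_def
    by (intro continuous_intros continuous_on_compose2[OF continuous_on_clip[OF k]] g) auto
  have Gb: "cmod (G n x) \<le> k" for n x
  proof -
    have "\<bar>cut x\<bar> * cmod (clip k (g n x)) \<le> 1 * k"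
      by (intro mult_mono cmod_clip k) (auto simp: cut_def)
    then show ?thesis by (simp add: G_def norm_mult)
  qed
  have G0: "G n x = 0" if "\<bar>x\<bar> \<ge> k + 1" for n x
    using that by (simp add: G_def cut_def)
  have "(\<lambda>n. l2 lborel (\<lambda>x. G n x - f x)) \<longlonglongrightarrow> 0"
  proof (rule l2_dominated_tendsto)
    show "G n \<in> borel_measurable lborel" for n
      using borel_measurable_continuous_onI[OF Gc] by simp
    show "integrable lborel (\<lambda>x. (2 * k)\<^sup>2 * indicator {-(k+1)..k+1} x)"
      by (intro integrable_mult_right integrable_real_indicator) (auto simp: emeasure_lborel_Icc_eq)
    show "(cmod (G n x - f x))\<^sup>2 \<le> (2 * k)\<^sup>2 * indicator {-(k+1)..k+1} x" for n x
    proof (cases "x \<in> {-(k+1)..k+1}")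
      case True
      have "cmod (G n x - f x) \<le> 2 * k"
        using norm_triangle_ineq4[of "G n x" "f x"] Gb[of n x] bd[of x] by linarith
      from power_mono[OF this, of 2] show ?thesis using True by simp
    next
      case False
      then show ?thesis using G0[of x n] supp[of x] k by auto
    qed
    have "AE x in lebesgue. x \<notin> N"
      using N by (simp add: negligible_iff_null_sets AE_not_in)
    then have "AE x in lebesgue. (\<lambda>n. G n x) \<longlonglongrightarrow> f x"
    proof eventually_elim
      case (elim x)
      have "isCont (clip k) (f x)"
        using continuous_on_clip[OF k] by (simp add: continuous_on_eq_continuous_at)
      from isCont_tendsto_compose[OF this lim[OF elim]]
      have "(\<lambda>n. G n x) \<longlonglongrightarrow> of_real (cut x) * clip k (f x)"
        unfolding G_def by (intro tendsto_intros)
      moreover have "of_real (cut x) * clip k (f x) = f x"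
      proof (cases "\<bar>x\<bar> > k")
        case True
        then show ?thesis using supp[of x] by (simp add: clip_def)
      next
        case False
        then show ?thesis using bd[of x] k by (simp add: clip_eq cut_def)
      qed
      ultimately show ?case by simp
    qed
    then show "AE x in lborel. (\<lambda>n. G n x) \<longlonglongrightarrow> f x"
      by (subst (asm) AE_completion_iff) auto
  qed (use fm in auto)
  from LIMSEQ_D[OF this e] obtain n where "l2 lborel (\<lambda>x. G n x - f x) < e" by auto
  then show ?thesis using that[OF Gc[of n] G0 Gb] l2_minus_commute[of lborel f "G n"] by simp
qed

lemma sqint_psiY: "sqint lborel (psiY P Q)"
proof (rule sqint_bound)
  have "psiY P Q \<in> borel_measurable borel"
    unfolding psiY_def by (intro borel_measurable_continuous_onI continuous_intros) auto
  then show "psiY P Q \<in> borel_measurable lborel" by simp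
  have "integrable lborel (\<lambda>x. exp (- (1 * (- Q + 1 * x)\<^sup>2)))"
    by (subst lborel_integrable_real_affine_iff) (use integrable_gaussian[of 1] in auto)
  then show "integrable lborel (\<lambda>x. 1 / pi * exp (- (x - Q)\<^sup>2))"
    by (intro integrable_mult_right) simp
  show "(cmod (psiY P Q x))\<^sup>2 \<le> 1 / pi * exp (- (x - Q)\<^sup>2)" for x
    by (simp add: psiY_def norm_mult norm_divide power_mult_distrib power_divide flip: exp_double)
qed

lemma in_V_sqint: "in_V f \<Longrightarrow> sqint lborel f"
  unfolding in_V_def lin_comb_def by (auto intro!: sqint_sum sqint_cmult sqint_psiY)

text \<open>Three approximations, each costing a third of \<open>e\<close>: truncate domain and
  values, replace the result by a continuous function of compact support, and approximate that by
  coherent states.\<close>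

lemma V_dense:
  assumes f: "sqint lborel f" and e: "e > 0"
  obtains g where "in_V g" "l2 lborel (\<lambda>x. f x - g x) < e"
proof -
  have fm: "f \<in> borel_measurable borel" using f by (simp add: sqint_def)
  define F where "F n x = (if \<bar>x\<bar> > real n + 1 then 0 else clip (real n + 1) (f x))" for n x
  have cm: "clip (real n + 1) \<in> borel_measurable borel" for n
    by (intro borel_measurable_continuous_onI continuous_on_clip) simp
  have Fm: "F n \<in> borel_measurable borel" for n
    unfolding F_def[abs_def] using measurable_compose[OF fm cm] by measurable
  have "(\<lambda>n. l2 lborel (\<lambda>x. F n x - f x)) \<longlonglongrightarrow> 0"
  proof (rule l2_dominated_tendsto)
    show "integrable lborel (\<lambda>x. (cmod (f x))\<^sup>2)" using f by (simp add: sqint_def)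
    show "(cmod (F n x - f x))\<^sup>2 \<le> (cmod (f x))\<^sup>2" for n x
      using cmod_clip_diff[of "real n + 1" "f x"] by (auto simp: F_def intro!: power_mono)
    have "(\<lambda>n. F n x) \<longlonglongrightarrow> f x" for x
    proof (rule tendsto_eventually)
      obtain N where N: "real N \<ge> max \<bar>x\<bar> (cmod (f x))" using real_arch_simple by blast
      show "\<forall>\<^sub>F n in sequentially. F n x = f x"
        unfolding eventually_sequentially
        by (intro exI[of _ N]) (use N in \<open>auto simp: F_def intro!: clip_eq\<close>)
    qed
    then show "AE x in lborel. (\<lambda>n. F n x) \<longlonglongrightarrow> f x" by auto
  qed (use Fm fm in auto)
  from LIMSEQ_D[OF this, of "e/3"] e obtain n where "l2 lborel (\<lambda>x. F n x - f x) < e / 3" by auto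
  then have 1: "l2 lborel (\<lambda>x. f x - F n x) < e / 3" by (simp add: l2_minus_commute[of lborel f])
  define k where "k = real n + 1"
  have k: "k > 0" by (simp add: k_def)
  have Fb: "cmod (F n x) \<le> k" for x using cmod_clip[OF k, of "f x"] k by (auto simp: F_def k_def)
  have F0: "F n x = 0" if "\<bar>x\<bar> > k" for x using that by (auto simp: F_def k_def)
  obtain h where h: "continuous_on UNIV h" "\<And>x. \<bar>x\<bar> \<ge> k + 1 \<Longrightarrow> h x = 0"
    "\<And>x. cmod (h x) \<le> k" "l2 lborel (\<lambda>x. F n x - h x) < e / 3"
    by (rule bounded_compact_support_approx_continuous[OF Fm k Fb F0, of "e/3"])
       (use e in auto)
  obtain g where g: "in_V g" "l2 lborel (\<lambda>x. h x - g x) < e / 3"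
    by (rule continuous_compact_support_approx_V[OF h(1,2), of "k + 1" "e/3"]) (use e in auto)
  have ind: "integrable lborel (\<lambda>x. k\<^sup>2 * indicator {-(k+1)..k+1} x)" 
    by (intro integrable_mult_right integrable_real_indicator) (auto simp: emeasure_lborel_Icc_eq)
  have Fs: "sqint lborel (F n)"
  proof (rule sqint_bound[OF _ ind])
    show "(cmod (F n x))\<^sup>2 \<le> k\<^sup>2 * indicator {-(k+1)..k+1} x" for x
      using Fb[of x] F0[of x] by (cases "\<bar>x\<bar> > k") (auto intro!: power_mono simp: indicator_def)
  qed (use Fm in simp)
  have hs: "sqint lborel h"
  proof (rule sqint_bound[OF _ ind])
    show "(cmod (h x))\<^sup>2 \<le> k\<^sup>2 * indicator {-(k+1)..k+1} x" for x
      using h(2)[of x] h(3)[of x] by (cases "\<bar>x\<bar> \<ge> k + 1") (auto intro!: power_mono simp: indicator_def)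
  qed (use borel_measurable_continuous_onI[OF h(1)] in simp)
  have "l2 lborel (\<lambda>x. f x - g x) < e"
    using l2_triangle_diff[OF f Fs in_V_sqint[OF g(1)]] l2_triangle_diff[OF Fs hs in_V_sqint[OF g(1)]]
      1 h(4) g(2) by linarith
  with g(1) show ?thesis using that by blast
qed

section \<open>The Gaussian windowed Fourier transform\<close>

definition gabor_kernel :: "real \<Rightarrow> real \<times> real \<Rightarrow> real \<Rightarrow> complex" where
  "gabor_kernel \<gamma> z y = exp (- \<i> * of_real (snd z * (fst z - y)) - of_real (\<gamma> / 2 * (fst z - y)\<^sup>2))"

definition gabor :: "real \<Rightarrow> (real \<Rightarrow> complex) \<Rightarrow> real \<times> real \<Rightarrow> complex" where
  "gabor \<gamma> f z = (LINT y|lborel. gabor_kernel \<gamma> z y * f y)"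

lemma cmod_gabor_kernel: "cmod (gabor_kernel \<gamma> z y) = exp (- (\<gamma> / 2 * (fst z - y)\<^sup>2))"
  by (simp add: gabor_kernel_def)

lemma gabor_kernel_measurable [measurable]:
  "(\<lambda>w. gabor_kernel \<gamma> (fst w) (snd w)) \<in> borel_measurable borel"
  unfolding gabor_kernel_def by (intro borel_measurable_continuous_onI continuous_intros)

lemma gabor_kernel_measurable_snd [measurable]: "gabor_kernel \<gamma> z \<in> borel_measurable borel"
  unfolding gabor_kernel_def by (intro borel_measurable_continuous_onI continuous_intros)

lemma sets_lborel_triple: "sets (lborel \<Otimes>\<^sub>M lborel :: ((real \<times> real) \<times> real) measure) = sets borel"
  by (metis lborel_prod sets_lborel)

lemma gabor_kernel_measurable_pair [measurable]:
  "(\<lambda>w::(real \<times> real) \<times> real. gabor_kernel \<gamma> (fst w) (snd w)) \<in> borel_measurable (lborel \<Otimes>\<^sub>M lborel)"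
  using gabor_kernel_measurable by (simp add: measurable_cong_sets[OF sets_lborel_triple refl])

lemma gabor_measurable:
  assumes [measurable]: "f \<in> borel_measurable borel"
  shows "gabor \<gamma> f \<in> borel_measurable borel"
proof -
  have "(\<lambda>z. LINT y|lborel. gabor_kernel \<gamma> z y * f y) \<in> borel_measurable lborel"
  proof (rule lborel.borel_measurable_lebesgue_integral)
    show "(\<lambda>(z, y). gabor_kernel \<gamma> z y * f y) \<in> borel_measurable (lborel \<Otimes>\<^sub>M lborel)"
      unfolding split_beta' by measurable
  qed
  then show ?thesis unfolding gabor_def[abs_def] by simp
qed

lemma gaussian_shift:
  fixes a :: real and b :: complex
  assumes a: "a > 0"
  shows "has_bochner_integral lborel (\<lambda>x. exp (b * of_real (x - m) - of_real (a * (x - m)\<^sup>2)))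
    (of_real (sqrt (pi / a)) * exp (b\<^sup>2 / of_real (4 * a)))"
  using lborel_has_bochner_integral_real_affine_iff[of 1 "\<lambda>x. exp (b * of_real (x - m) - of_real (a * (x - m)\<^sup>2))" _ m]
    complex_gaussian[OF a, of b] by simp

lemma real_gaussian_shift:
  fixes a :: real
  assumes a: "a > 0"
  shows "has_bochner_integral lborel (\<lambda>x. exp (- (a * (x - m)\<^sup>2))) (sqrt (pi / a))"
proof -
  have "has_bochner_integral lborel (\<lambda>x. complex_of_real (exp (- (a * (x - m)\<^sup>2)))) (of_real (sqrt (pi / a)))"
    using gaussian_shift[OF a, of 0 m] unfolding exp_of_real[symmetric] by simp
  then have "has_bochner_integral lborel (\<lambda>x. Re (complex_of_real (exp (- (a * (x - m)\<^sup>2))))) (Re (complex_of_real (sqrt (pi / a))))"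
    by (rule has_bochner_integral_bounded_linear[OF bounded_linear_Re])
  then show ?thesis by simp
qed

lemma gabor_kernel_l2:
  assumes \<gamma>: "\<gamma> > 0"
  shows "sqint lborel (gabor_kernel \<gamma> z)" "l2 lborel (gabor_kernel \<gamma> z) = sqrt (sqrt (pi / \<gamma>))"
proof -
  have sq: "(cmod (gabor_kernel \<gamma> z y))\<^sup>2 = exp (- (\<gamma> * (y - fst z)\<^sup>2))" for y
    by (simp add: cmod_gabor_kernel power2_commute[of "fst z"] flip: exp_double)
  show "sqint lborel (gabor_kernel \<gamma> z)" "l2 lborel (gabor_kernel \<gamma> z) = sqrt (sqrt (pi / \<gamma>))"
    using real_gaussian_shift[OF \<gamma>, of "fst z"]
    unfolding sqint_def l2_def sq has_bochner_integral_iff by auto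
qed

lemma gabor_integrable:
  assumes "\<gamma> > 0" "sqint lborel f"
  shows "integrable lborel (\<lambda>y. gabor_kernel \<gamma> z y * f y)"
  by (intro sqint_mult_integrable gabor_kernel_l2 assms)

lemma cmod_gabor_le:
  assumes "\<gamma> > 0" "sqint lborel f"
  shows "cmod (gabor \<gamma> f z) \<le> sqrt (sqrt (pi / \<gamma>)) * l2 lborel f"
  using norm_integral_mult_le_l2[OF gabor_kernel_l2(1)[OF assms(1), of z] assms(2)]
  by (simp add: gabor_def gabor_kernel_l2(2)[OF assms(1)])

lemma gabor_add:
  assumes "\<gamma> > 0" "sqint lborel f" "sqint lborel g"
  shows "gabor \<gamma> (\<lambda>x. f x + g x) z = gabor \<gamma> f z + gabor \<gamma> g z"
  using gabor_integrable[OF assms(1,2), of z] gabor_integrable[OF assms(1,3), of z]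
  by (simp add: gabor_def distrib_left)

lemma gabor_cmult: "gabor \<gamma> (\<lambda>x. c * f x) z = c * gabor \<gamma> f z"
  by (simp add: gabor_def mult.left_commute)

lemma gabor_diff:
  assumes "\<gamma> > 0" "sqint lborel f" "sqint lborel g"
  shows "gabor \<gamma> (\<lambda>x. f x - g x) z = gabor \<gamma> f z - gabor \<gamma> g z"
  using gabor_integrable[OF assms(1,2), of z] gabor_integrable[OF assms(1,3), of z]
  by (simp add: gabor_def right_diff_distrib)

lemma gabor_sum:
  assumes "\<gamma> > 0" "\<And>i. i \<in> I \<Longrightarrow> sqint lborel (f i)"
  shows "gabor \<gamma> (\<lambda>x. \<Sum>i\<in>I. f i x) z = (\<Sum>i\<in>I. gabor \<gamma> (f i) z)"
  using assms by (simp add: gabor_def sum_distrib_left gabor_integrable)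

text \<open>The kernel at \<open>z\<close> has the same norm for every \<open>z\<close>, so by
  Cauchy-Schwarz point evaluation is continuous on L2. Norm limits thus become limits at every
  point.\<close>

lemma gabor_tendsto:
  assumes \<gamma>: "\<gamma> > 0" and f: "\<And>n. sqint lborel (f n)" "sqint lborel g"
    and lim: "(\<lambda>n. l2 lborel (\<lambda>x. f n x - g x)) \<longlonglongrightarrow> 0"
  shows "(\<lambda>n. gabor \<gamma> (f n) z) \<longlonglongrightarrow> gabor \<gamma> g z"
proof -
  have "(\<lambda>n. gabor \<gamma> (f n) z - gabor \<gamma> g z) \<longlonglongrightarrow> 0"
  proof (rule Lim_null_comparison)
    show "(\<lambda>n. sqrt (sqrt (pi / \<gamma>)) * l2 lborel (\<lambda>x. f n x - g x)) \<longlonglongrightarrow> 0"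
      using tendsto_mult_right_zero[OF lim] .
    show "\<forall>\<^sub>F n in sequentially. norm (gabor \<gamma> (f n) z - gabor \<gamma> g z)
        \<le> sqrt (sqrt (pi / \<gamma>)) * l2 lborel (\<lambda>x. f n x - g x)"
      using cmod_gabor_le[OF \<gamma> sqint_diff[OF f]] by (simp add: gabor_diff[OF \<gamma> f])
  qed
  then show ?thesis by (simp add: LIM_zero_iff)
qed

section \<open>Covariance under the Heisenberg group\<close>

lemma gabor_V0: "gabor \<gamma> (V0 P0 f) = Vtau P0 (gabor \<gamma> f)"
proof
  fix z :: "real \<times> real"
  obtain x p where z: "z = (x, p)" by (cases z)
  \<comment> \<open>In the exponent, p (x - y) + P0 y = P0 x + (p - P0) (x - y).\<close>
  have "gabor_kernel \<gamma> (x, p) y * (exp (- \<i> * of_real (P0 * y)) * f y)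
      = exp (- \<i> * of_real (P0 * x)) * (gabor_kernel \<gamma> (x, p - P0) y * f y)" for y
    unfolding gabor_kernel_def mult.assoc[symmetric] mult_exp_exp
    by (simp add: algebra_simps)
  note eq = this
  show "gabor \<gamma> (V0 P0 f) z = Vtau P0 (gabor \<gamma> f) z"
    unfolding gabor_def V0_def Vtau_def z split_conv eq by simp
qed

lemma gabor_W0: "gabor \<gamma> (W0 Q0 f) = Wtau Q0 (gabor \<gamma> f)"
proof
  fix z :: "real \<times> real"
  obtain x p where z: "z = (x, p)" by (cases z)
  have "gabor \<gamma> (W0 Q0 f) (x, p) = (LINT y|lborel. gabor_kernel \<gamma> (x, p) (Q0 + 1 * y) * f (Q0 + 1 * y - Q0))"
    unfolding gabor_def W0_def using lborel_integral_real_affine[of 1 "\<lambda>y. gabor_kernel \<gamma> (x, p) y * f (y - Q0)" Q0]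
    by simp
  also have "\<dots> = gabor \<gamma> f (x - Q0, p)"
    unfolding gabor_def by (simp add: gabor_kernel_def algebra_simps)
  finally show "gabor \<gamma> (W0 Q0 f) z = Wtau Q0 (gabor \<gamma> f) z"
    by (simp add: Wtau_def z)
qed

text \<open>With y measured from \<open>Q\<close>, window and state combine to one Gaussian: the
  quadratic coefficients add up to a = (1 + gamma) / 2, and the linear coefficient is b = gamma (x -
  Q) + i (p - P).\<close>

lemma gabor_psiY:
  assumes \<gamma>: "\<gamma> > 0"
  shows "gabor \<gamma> (psiY P Q) (x, p) = of_real (1 / sqrt pi * sqrt (2 * pi / (1 + \<gamma>))) *
    exp (- \<i> * of_real (P * (x - Q))
      + (of_real (- (1 / (1 + \<gamma>)) * (p - P)\<^sup>2 - \<gamma> / (1 + \<gamma>) * (x - Q)\<^sup>2)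
         - 2 * \<i> * of_real (1 / (1 + \<gamma>) * ((x - Q) * (p - P)))) / 2)"
proof -
  define u v where "u = x - Q" and "v = p - P"
  define a where "a = (1 + \<gamma>) / 2"
  define b where "b = of_real (\<gamma> * u) + \<i> * of_real v"
  define k where "k = - \<i> * of_real (p * u) - of_real (\<gamma> / 2 * u\<^sup>2)"
  have a: "a > 0" using \<gamma> by (simp add: a_def)
  have "gabor_kernel \<gamma> (x, p) y * psiY P Q y
    = (of_real (1 / sqrt pi) * exp k) * exp (b * of_real (y - Q) - of_real (a * (y - Q)\<^sup>2))" for y
  proof -
    define \<eta> where "\<eta> = y - Q"
    have y: "x - y = u - \<eta>" by (simp add: u_def \<eta>_def)
    have "(- \<i> * of_real (p * (u - \<eta>)) - of_real (\<gamma> / 2 * (u - \<eta>)\<^sup>2)) + (- \<i> * of_real P * of_real \<eta> - of_real (\<eta>\<^sup>2 / 2))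
       = k + (b * of_real \<eta> - of_real (a * \<eta>\<^sup>2))"
      unfolding k_def b_def a_def v_def
      by (simp add: complex_eq_iff) (simp add: field_simps power2_eq_square)
    then show ?thesis
      unfolding gabor_kernel_def psiY_def fst_conv snd_conv y \<eta>_def[symmetric]
      by (metis (no_types, lifting) exp_add mult.assoc mult.left_commute)
  qed
  then have "gabor \<gamma> (psiY P Q) (x, p) = (of_real (1 / sqrt pi) * exp k) * (of_real (sqrt (pi / a)) * exp (b\<^sup>2 / of_real (4 * a)))"
    unfolding gabor_def using gaussian_shift[OF a, of b Q]
    by (simp add: has_bochner_integral_iff)
  also have "\<dots> = of_real (1 / sqrt pi * sqrt (pi / a)) * exp (k + b\<^sup>2 / of_real (4 * a))"
    by (simp add: exp_add)
  also have "pi / a = 2 * pi / (1 + \<gamma>)" by (simp add: a_def)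
  also have "k + b\<^sup>2 / of_real (4 * a) = - \<i> * of_real (P * u)
      + (of_real (- (1 / (1 + \<gamma>)) * v\<^sup>2 - \<gamma> / (1 + \<gamma>) * u\<^sup>2)
         - 2 * \<i> * of_real (1 / (1 + \<gamma>) * (u * v))) / 2"
  proof -
    have p: "p = P + v" by (simp add: v_def)
    have b2: "b\<^sup>2 / of_real (4 * a) = of_real (((\<gamma> * u)\<^sup>2 - v\<^sup>2) / (2 * (1 + \<gamma>))) + \<i> * of_real (2 * \<gamma> * u * v / (2 * (1 + \<gamma>)))"
    proof -
      have "b\<^sup>2 = of_real ((\<gamma> * u)\<^sup>2 - v\<^sup>2) + \<i> * of_real (2 * \<gamma> * u * v)"
        by (simp add: b_def complex_eq_iff power2_eq_square)
      moreover have "4 * a = 2 * (1 + \<gamma>)" by (simp add: a_def)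
      ultimately show ?thesis by (simp only: add_divide_distrib of_real_divide) simp
    qed
    have "1 + \<gamma> \<noteq> 0" using \<gamma> by simp
    then have re: "- (\<gamma> / 2 * u\<^sup>2) + ((\<gamma> * u)\<^sup>2 - v\<^sup>2) / (2 * (1 + \<gamma>)) = (- (1 / (1 + \<gamma>)) * v\<^sup>2 - \<gamma> / (1 + \<gamma>) * u\<^sup>2) / 2"
      and im: "- (p * u) + 2 * \<gamma> * u * v / (2 * (1 + \<gamma>)) = - (P * u) - (1 / (1 + \<gamma>) * (u * v))"
      unfolding p by (auto simp: divide_simps power2_eq_square) (auto simp: algebra_simps)
    have "k + b\<^sup>2 / of_real (4 * a) = of_real (- (\<gamma> / 2 * u\<^sup>2) + ((\<gamma> * u)\<^sup>2 - v\<^sup>2) / (2 * (1 + \<gamma>)))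
        + \<i> * of_real (- (p * u) + 2 * \<gamma> * u * v / (2 * (1 + \<gamma>)))"
      unfolding b2 k_def by (simp add: algebra_simps)
    then show ?thesis unfolding re im by (simp add: field_simps)
  qed
  finally show ?thesis unfolding u_def v_def .
qed

section \<open>Gram matrices of the coherent states and of their transforms\<close>

lemma lborel_product_integral:
  fixes f :: "'a::euclidean_space \<Rightarrow> complex" and g :: "'b::euclidean_space \<Rightarrow> complex"
  assumes f: "has_bochner_integral lborel f A" and g: "has_bochner_integral lborel g B"
  shows "has_bochner_integral lborel (\<lambda>z. f (fst z) * g (snd z)) (A * B)"
proof -
  have [measurable]: "f \<in> borel_measurable borel" "g \<in> borel_measurable borel"
    and fi: "integrable lborel f" and gi: "integrable lborel g"
    and AB: "integral\<^sup>L lborel f = A" "integral\<^sup>L lborel g = B"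
    using f g by (auto simp: has_bochner_integral_iff)
  have i: "integrable (lborel \<Otimes>\<^sub>M lborel) (\<lambda>z. f (fst z) * g (snd z))"
  proof (rule lborel_pair.Fubini_integrable)
    show "(\<lambda>z. f (fst z) * g (snd z)) \<in> borel_measurable (lborel \<Otimes>\<^sub>M lborel)" by measurable
    show "integrable lborel (\<lambda>x. LINT y|lborel. norm (f (fst (x, y)) * g (snd (x, y))))"
      using fi by (simp add: norm_mult)
    show "AE x in lborel. integrable lborel (\<lambda>y. f (fst (x, y)) * g (snd (x, y)))"
      using gi by simp
  qed
  moreover have "(LINT z|(lborel \<Otimes>\<^sub>M lborel). f (fst z) * g (snd z)) = A * B"
    using lborel_pair.integral_fst'[OF i] AB by simp
  ultimately show ?thesis unfolding lborel_prod by (simp add: has_bochner_integral_iff)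
qed

text \<open>Serves to verify products of the shape (constant times exponential) by checking the
  constants and the exponents separately.\<close>

lemma mult_regroup:
  fixes a b x y :: "'a::comm_semiring"
  assumes "a * b = c" "x * y = z"
  shows "(a * x) * (b * y) = c * z"
  unfolding assms[symmetric] by (simp only: mult_ac)

text \<open>About the midpoint \<open>m\<close> of the two centres the real exponents add to -(x -
  m)^2 plus a constant, and the only linear term left is the phase with frequency P' - P.\<close>

lemma psiY_inner:
  "has_bochner_integral lborel (\<lambda>x. cnj (psiY P Q x) * psiY P' Q' x)
    (of_real (1 / sqrt pi) * exp (of_real (- (Q' - Q)\<^sup>2 / 4 - (P' - P)\<^sup>2 / 4)
      + \<i> * of_real (P' * Q' - P * Q - (P' - P) * ((Q + Q') / 2))))"
proof -
  define m where "m = (Q + Q') / 2"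
  define k where "k = of_real (- (Q' - Q)\<^sup>2 / 4) + \<i> * of_real (P' * Q' - P * Q - (P' - P) * m)"
  have c: "cnj (psiY P Q x) * psiY P' Q' x
      = (of_real (1 / pi) * exp k) * exp (- \<i> * of_real (P' - P) * of_real (x - m) - of_real (1 * (x - m)\<^sup>2))" for x
  proof -
    have e: "(\<i> * of_real P * of_real (x - Q) - of_real ((x - Q)\<^sup>2 / 2))
       + (- \<i> * of_real P' * of_real (x - Q') - of_real ((x - Q')\<^sup>2 / 2))
       = k + (- \<i> * of_real (P' - P) * of_real (x - m) - of_real (1 * (x - m)\<^sup>2))"
      unfolding k_def m_def
      by (simp add: complex_eq_iff) (simp add: field_simps power2_eq_square)
    have r: "complex_of_real (1 / sqrt pi) * of_real (1 / sqrt pi) = of_real (1 / pi)"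
      by (simp flip: of_real_mult)
    have c: "cnj (psiY P Q x) = of_real (1 / sqrt pi) * exp (\<i> * of_real P * of_real (x - Q) - of_real ((x - Q)\<^sup>2 / 2))"
      by (simp add: psiY_def exp_cnj)
    show ?thesis
      unfolding c psiY_def[of P'] mult.assoc[of _ "exp k"]
      by (rule mult_regroup[OF r]) (simp only: exp_add[symmetric] e)
  qed
  have "has_bochner_integral lborel (\<lambda>x. cnj (psiY P Q x) * psiY P' Q' x)
    ((of_real (1 / pi) * exp k) * (of_real (sqrt (pi / 1)) * exp ((- \<i> * of_real (P' - P))\<^sup>2 / of_real (4 * 1))))"
    unfolding c by (intro has_bochner_integral_mult_right gaussian_shift) simp
  moreover have "(of_real (1 / pi) * exp k) * (of_real (sqrt (pi / 1)) * exp ((- \<i> * of_real (P' - P))\<^sup>2 / of_real (4 * 1)))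
     = of_real (1 / sqrt pi) * exp (of_real (- (Q' - Q)\<^sup>2 / 4 - (P' - P)\<^sup>2 / 4)
      + \<i> * of_real (P' * Q' - P * Q - (P' - P) * m))"
  proof -
    have "k + (- \<i> * of_real (P' - P))\<^sup>2 / of_real (4 * 1) = of_real (- (Q' - Q)\<^sup>2 / 4 - (P' - P)\<^sup>2 / 4)
      + \<i> * of_real (P' * Q' - P * Q - (P' - P) * m)"
      by (simp add: k_def power_mult_distrib)
    then have e: "exp k * exp ((- \<i> * of_real (P' - P))\<^sup>2 / of_real (4 * 1)) = exp (of_real (- (Q' - Q)\<^sup>2 / 4 - (P' - P)\<^sup>2 / 4)
      + \<i> * of_real (P' * Q' - P * Q - (P' - P) * m))"
      by (simp only: exp_add[symmetric])
    have "1 / pi * sqrt (pi / 1) = 1 / sqrt pi" by (simp add: field_simps)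
    then have r: "complex_of_real (1 / pi) * of_real (sqrt (pi / 1)) = of_real (1 / sqrt pi)"
      by (simp only: of_real_mult[symmetric])
    show ?thesis by (rule mult_regroup[OF r e])
  qed
  ultimately show ?thesis unfolding m_def by simp
qed

text \<open>The weights mu = 1 / (1 + gamma) and nu = gamma / (1 + gamma) add up to 1. Because of
  this the cross terms in x and p cancel once both variables are measured from the midpoints, and
  the plane integral splits into two one-dimensional Gaussian ones.\<close>

lemma gabor_psiY_inner:
  assumes \<gamma>: "\<gamma> > 0"
  shows "has_bochner_integral lborel (\<lambda>z. cnj (gabor \<gamma> (psiY P Q) z) * gabor \<gamma> (psiY P' Q') z)
    (of_real (2 * pi * sqrt (pi / \<gamma>)) * (LINT x|lborel. cnj (psiY P Q x) * psiY P' Q' x))"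
proof -
  define \<mu> \<nu> where "\<mu> = 1 / (1 + \<gamma>)" and "\<nu> = \<gamma> / (1 + \<gamma>)"
  have pos: "\<mu> > 0" "\<nu> > 0" using \<gamma> by (auto simp: \<mu>_def \<nu>_def)
  have \<nu>: "\<nu> = 1 - \<mu>" using \<gamma> by (simp add: \<mu>_def \<nu>_def field_simps)
  define c where "c = 1 / sqrt pi * sqrt (2 * pi / (1 + \<gamma>))"
  have c2: "c * c = 2 * \<mu>"
    using \<gamma> by (simp add: c_def \<mu>_def real_sqrt_divide real_sqrt_mult field_simps)
  define m n where "m = (Q + Q') / 2" and "n = (P + P') / 2"
  define k where "k = of_real (- \<nu> * (Q' - Q)\<^sup>2 / 4 - \<mu> * (P' - P)\<^sup>2 / 4) + \<i> * of_real (P' * Q' - P * Q - (P' - P) * m)"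
  have eq: "cnj (gabor \<gamma> (psiY P Q) z) * gabor \<gamma> (psiY P' Q') z
     = (of_real (2 * \<mu>) * exp k) * (exp (- \<i> * of_real (\<nu> * (P' - P)) * of_real (fst z - m) - of_real (\<nu> * (fst z - m)\<^sup>2))
       * exp (\<i> * of_real (\<mu> * (Q' - Q)) * of_real (snd z - n) - of_real (\<mu> * (snd z - n)\<^sup>2)))" for z
  proof -
    obtain x p where z: "z = (x, p)" by (cases z)
    define e where "e P Q = - \<i> * of_real (P * (x - Q))
      + (of_real (- \<mu> * (p - P)\<^sup>2 - \<nu> * (x - Q)\<^sup>2) - 2 * \<i> * of_real (\<mu> * ((x - Q) * (p - P)))) / 2" for P Q
    have g: "gabor \<gamma> (psiY P Q) z = of_real c * exp (e P Q)" for P Q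
      unfolding z gabor_psiY[OF \<gamma>] e_def c_def \<mu>_def \<nu>_def by simp
    have "cnj (e P Q) + e P' Q' = k + ((- \<i> * of_real (\<nu> * (P' - P)) * of_real (x - m) - of_real (\<nu> * (x - m)\<^sup>2))
       + (\<i> * of_real (\<mu> * (Q' - Q)) * of_real (p - n) - of_real (\<mu> * (p - n)\<^sup>2)))"
      unfolding e_def k_def m_def n_def \<nu>
      by (simp add: complex_eq_iff) (simp add: field_simps power2_eq_square)
    then have e: "exp (cnj (e P Q)) * exp (e P' Q') = exp k * (exp (- \<i> * of_real (\<nu> * (P' - P)) * of_real (x - m) - of_real (\<nu> * (x - m)\<^sup>2))
       * exp (\<i> * of_real (\<mu> * (Q' - Q)) * of_real (p - n) - of_real (\<mu> * (p - n)\<^sup>2)))"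
      by (simp only: exp_add[symmetric])
    have r: "complex_of_real c * of_real c = of_real (2 * \<mu>)" unfolding c2[symmetric] by simp
    have cg: "cnj (gabor \<gamma> (psiY P Q) z) = of_real c * exp (cnj (e P Q))" by (simp add: g exp_cnj)
    show ?thesis
      unfolding cg g[of P'] unfolding fst_conv snd_conv z mult.assoc[of _ "exp k"]
      by (rule mult_regroup[OF r e])
  qed
  have "has_bochner_integral lborel (\<lambda>z. cnj (gabor \<gamma> (psiY P Q) z) * gabor \<gamma> (psiY P' Q') z)
     ((of_real (2 * \<mu>) * exp k) * ((of_real (sqrt (pi / \<nu>)) * exp ((- \<i> * of_real (\<nu> * (P' - P)))\<^sup>2 / of_real (4 * \<nu>)))
       * (of_real (sqrt (pi / \<mu>)) * exp ((\<i> * of_real (\<mu> * (Q' - Q)))\<^sup>2 / of_real (4 * \<mu>)))))"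
    unfolding eq using pos
    by (intro has_bochner_integral_mult_right lborel_product_integral gaussian_shift)
  moreover have "(of_real (2 * \<mu>) * exp k) * ((of_real (sqrt (pi / \<nu>)) * exp ((- \<i> * of_real (\<nu> * (P' - P)))\<^sup>2 / of_real (4 * \<nu>)))
       * (of_real (sqrt (pi / \<mu>)) * exp ((\<i> * of_real (\<mu> * (Q' - Q)))\<^sup>2 / of_real (4 * \<mu>))))
     = of_real (2 * pi * sqrt (pi / \<gamma>)) * (LINT x|lborel. cnj (psiY P Q x) * psiY P' Q' x)"
  proof -
    have sq: "(- \<i> * of_real r)\<^sup>2 = of_real (- (r\<^sup>2))" "(\<i> * of_real r)\<^sup>2 = of_real (- (r\<^sup>2))" for r :: real
      by (simp_all add: power_mult_distrib)
    have e1: "(- \<i> * of_real (\<nu> * (P' - P)))\<^sup>2 / of_real (4 * \<nu>) = of_real (- \<nu> * (P' - P)\<^sup>2 / 4)"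
      unfolding sq of_real_divide[symmetric] of_real_eq_iff
      using pos by (simp add: field_simps power2_eq_square)
    have e2: "(\<i> * of_real (\<mu> * (Q' - Q)))\<^sup>2 / of_real (4 * \<mu>) = of_real (- \<mu> * (Q' - Q)\<^sup>2 / 4)"
      unfolding sq of_real_divide[symmetric] of_real_eq_iff
      using pos by (simp add: field_simps power2_eq_square)
    \<comment> \<open>Each squared difference receives -nu / 4 from one side and -mu / 4 from the
      other, so gamma disappears from the exponent and survives only in the constant.\<close>
    have "k + (of_real (- \<nu> * (P' - P)\<^sup>2 / 4) + of_real (- \<mu> * (Q' - Q)\<^sup>2 / 4))
      = of_real (- (Q' - Q)\<^sup>2 / 4 - (P' - P)\<^sup>2 / 4) + \<i> * of_real (P' * Q' - P * Q - (P' - P) * m)"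
      unfolding k_def \<nu> by (simp add: complex_eq_iff) (simp add: field_simps)
    then have e: "exp k * (exp (of_real (- \<nu> * (P' - P)\<^sup>2 / 4)) * exp (of_real (- \<mu> * (Q' - Q)\<^sup>2 / 4)))
      = exp (of_real (- (Q' - Q)\<^sup>2 / 4 - (P' - P)\<^sup>2 / 4) + \<i> * of_real (P' * Q' - P * Q - (P' - P) * m))"
      by (simp only: exp_add[symmetric])
    \<comment> \<open>Since mu nu = mu^2 gamma, the prefactor 2 mu pi / sqrt (mu nu) equals 2 pi /
      sqrt gamma.\<close>
    have "2 * \<mu> * (sqrt (pi / \<nu>) * sqrt (pi / \<mu>)) = 2 * \<mu> * (pi / sqrt (\<mu> * \<nu>))"
      by (simp add: real_sqrt_divide real_sqrt_mult)
    also have "sqrt (\<mu> * \<nu>) = \<mu> * sqrt \<gamma>"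
    proof -
      have "\<mu> * \<nu> = \<mu>\<^sup>2 * \<gamma>" by (simp add: \<mu>_def \<nu>_def power2_eq_square)
      then show ?thesis using pos by (simp add: real_sqrt_mult)
    qed
    also have "2 * \<mu> * (pi / (\<mu> * sqrt \<gamma>)) = 2 * pi * sqrt (pi / \<gamma>) * (1 / sqrt pi)"
      using pos \<gamma> by (simp add: real_sqrt_divide field_simps)
    finally have s: "complex_of_real (2 * \<mu>) * (of_real (sqrt (pi / \<nu>)) * of_real (sqrt (pi / \<mu>))) = of_real (2 * pi * sqrt (pi / \<gamma>)) * of_real (1 / sqrt pi)"
      by (simp only: of_real_mult[symmetric])
    have l: "(LINT x|lborel. cnj (psiY P Q x) * psiY P' Q' x) = of_real (1 / sqrt pi) * exp (of_real (- (Q' - Q)\<^sup>2 / 4 - (P' - P)\<^sup>2 / 4)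
      + \<i> * of_real (P' * Q' - P * Q - (P' - P) * m))"
      using psiY_inner[of P Q P' Q'] by (simp add: has_bochner_integral_iff m_def)
    show ?thesis
      unfolding e1 e2 l e[symmetric] mult.assoc[symmetric, of _ "of_real (1 / sqrt pi)"] s[symmetric]
      by (simp only: mult_ac)
  qed
  ultimately show ?thesis by (simp only:)
qed

lemma cnj_mult_self: "cnj z * z = of_real ((cmod z)\<^sup>2)"
  by (simp only: complex_norm_square mult.commute)

lemma sqintI_inner:
  assumes "f \<in> borel_measurable M" "integrable M (\<lambda>x. cnj (f x) * f x)"
  shows "sqint M f"
  unfolding sqint_def
proof
  have "integrable M (\<lambda>x. Re (cnj (f x) * f x))" using assms(2) by (rule integrable_Re)
  then show "integrable M (\<lambda>x. (cmod (f x))\<^sup>2)" unfolding cnj_mult_self by simp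
qed fact

lemma sqint_gabor_psiY: "\<gamma> > 0 \<Longrightarrow> sqint lborel (gabor \<gamma> (psiY P Q))"
  using gabor_psiY_inner[of \<gamma> P Q P Q] sqint_psiY[of P Q]
  by (intro sqintI_inner) (auto intro!: gabor_measurable simp: has_bochner_integral_iff sqint_def)

lemma l2_power2_complex:
  assumes "sqint M f"
  shows "complex_of_real ((l2 M f)\<^sup>2) = (LINT x|M. cnj (f x) * f x)"
  unfolding cnj_mult_self l2_power2 by (simp only: integral_complex_of_real)

lemma inner_sum_sum:
  assumes "\<And>k. k < n \<Longrightarrow> sqint M (f k)"
  shows "(LINT x|M. cnj (\<Sum>k<n. c k * f k x) * (\<Sum>k<n. c k * f k x))
    = (\<Sum>j<n. \<Sum>k<n. cnj (c j) * c k * (LINT x|M. cnj (f j x) * f k x))"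
proof -
  have "cnj (\<Sum>k<n. c k * f k x) * (\<Sum>k<n. c k * f k x)
     = (\<Sum>j<n. \<Sum>k<n. cnj (c j) * c k * (cnj (f j x) * f k x))" for x
    by (simp only: cnj_sum sum_product) (simp only: complex_cnj_mult mult_ac)
  moreover have I: "integrable M (\<lambda>x. cnj (c j) * c k * (cnj (f j x) * f k x))" if "j < n" "k < n" for j k
    using that assms by (intro integrable_mult_right sqint_cnj_mult_integrable) auto
  ultimately have "(LINT x|M. cnj (\<Sum>k<n. c k * f k x) * (\<Sum>k<n. c k * f k x))
      = (LINT x|M. (\<Sum>j<n. \<Sum>k<n. cnj (c j) * c k * (cnj (f j x) * f k x)))" by (simp only:)
  also have "\<dots> = (\<Sum>j<n. LINT x|M. (\<Sum>k<n. cnj (c j) * c k * (cnj (f j x) * f k x)))"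
    by (intro Bochner_Integration.integral_sum Bochner_Integration.integrable_sum I) auto
  also have "\<dots> = (\<Sum>j<n. \<Sum>k<n. LINT x|M. cnj (c j) * c k * (cnj (f j x) * f k x))"
    by (intro sum.cong refl Bochner_Integration.integral_sum I) auto
  finally show ?thesis by simp
qed

text \<open>The constant of the orthogonality relation of the windowed Fourier transform: 2 pi times
  the squared norm of the window.\<close>

definition gconst :: "real \<Rightarrow> real" where
  "gconst \<gamma> = 2 * pi * sqrt (pi / \<gamma>)"

lemma gconst_pos: "\<gamma> > 0 \<Longrightarrow> gconst \<gamma> > 0"
  by (simp add: gconst_def)

lemma gabor_isometry_V:
  assumes \<gamma>: "\<gamma> > 0" and f: "in_V f"
  shows "sqint lborel (gabor \<gamma> f)" "l2 lborel (gabor \<gamma> f) = sqrt (gconst \<gamma>) * l2 lborel f"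
proof -
  obtain n c P Q where "f = lin_comb n c P Q"
    using f unfolding in_V_def by blast
  then have f: "f = (\<lambda>x. \<Sum>k<n. c k * psiY (P k) (Q k) x)" by (simp add: lin_comb_def)
  have g: "gabor \<gamma> f = (\<lambda>z. \<Sum>k<n. c k * gabor \<gamma> (psiY (P k) (Q k)) z)"
    unfolding f by (simp add: fun_eq_iff gabor_sum[OF \<gamma>] sqint_cmult sqint_psiY gabor_cmult)
  show s: "sqint lborel (gabor \<gamma> f)"
    unfolding g by (intro sqint_sum sqint_cmult sqint_gabor_psiY \<gamma>)
  have sf: "sqint lborel f" unfolding f by (intro sqint_sum sqint_cmult sqint_psiY)
  have "complex_of_real ((l2 lborel (gabor \<gamma> f))\<^sup>2) = of_real (gconst \<gamma>) * of_real ((l2 lborel f)\<^sup>2)"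
  proof -
    have "(LINT z|lborel. cnj (gabor \<gamma> (psiY (P j) (Q j)) z) * gabor \<gamma> (psiY (P k) (Q k)) z)
        = of_real (gconst \<gamma>) * (LINT x|lborel. cnj (psiY (P j) (Q j) x) * psiY (P k) (Q k) x)" for j k
      using gabor_psiY_inner[OF \<gamma>] by (simp only: has_bochner_integral_iff gconst_def)
    then have "(LINT z|lborel. cnj (\<Sum>k<n. c k * gabor \<gamma> (psiY (P k) (Q k)) z) * (\<Sum>k<n. c k * gabor \<gamma> (psiY (P k) (Q k)) z))
        = of_real (gconst \<gamma>) * (LINT x|lborel. cnj (\<Sum>k<n. c k * psiY (P k) (Q k) x) * (\<Sum>k<n. c k * psiY (P k) (Q k) x))"
      unfolding inner_sum_sum[OF sqint_gabor_psiY[OF \<gamma>]] inner_sum_sum[OF sqint_psiY]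
      by (simp only: sum_distrib_left mult_ac)
    then show ?thesis
      unfolding l2_power2_complex[OF s] l2_power2_complex[OF sf] unfolding g unfolding f .
  qed
  then have "(l2 lborel (gabor \<gamma> f))\<^sup>2 = (sqrt (gconst \<gamma>) * l2 lborel f)\<^sup>2"
    using gconst_pos[OF \<gamma>] by (simp add: power_mult_distrib flip: of_real_mult of_real_power)
  then show "l2 lborel (gabor \<gamma> f) = sqrt (gconst \<gamma>) * l2 lborel f"
    using gconst_pos[OF \<gamma>] by (simp add: power2_eq_iff_nonneg)
qed

lemma V_dense_seq:
  assumes f: "sqint lborel f"
  obtains g where "\<And>n. in_V (g n)" "(\<lambda>n. l2 lborel (\<lambda>x. g n x - f x)) \<longlonglongrightarrow> 0"
proof -
  have "\<exists>g. in_V g \<and> l2 lborel (\<lambda>x. f x - g x) < 1 / (real n + 1)" for n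
    using V_dense[OF f, of "1 / (real n + 1)"] by (metis add_nonneg_pos of_nat_0_le_iff zero_less_one divide_pos_pos)
  then obtain g where g: "\<And>n. in_V (g n)" "\<And>n. l2 lborel (\<lambda>x. f x - g n x) < 1 / (real n + 1)" by metis
  have "(\<lambda>n. l2 lborel (\<lambda>x. g n x - f x)) \<longlonglongrightarrow> 0"
  proof (rule Lim_null_comparison)
    show "(\<lambda>n. 1 / (real n + 1)) \<longlonglongrightarrow> 0"
      using LIMSEQ_inverse_real_of_nat by (simp add: inverse_eq_divide add.commute)
    show "\<forall>\<^sub>F n in sequentially. norm (l2 lborel (\<lambda>x. g n x - f x)) \<le> 1 / (real n + 1)"
      using g(2) by (simp add: l2_minus_commute[of lborel "g _"] less_imp_le)
  qed
  with g(1) show ?thesis using that by blast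
qed

lemma in_V_diff: "in_V f \<Longrightarrow> in_V g \<Longrightarrow> in_V (\<lambda>x. f x - g x)"
  using in_V_add[of f "\<lambda>x. (-1) * g x"] in_V_cmult[of g "-1"] by simp

text \<open>Approximants from the span converge at every point after the transform, and their
  transforms are Cauchy. Fatou turns this into norm convergence to \<open>gabor \<gamma> f\<close>,
  so the norm identity passes to the limit.\<close>

lemma gabor_isometry:
  assumes \<gamma>: "\<gamma> > 0" and f: "sqint lborel f"
  shows "sqint lborel (gabor \<gamma> f)" "l2 lborel (gabor \<gamma> f) = sqrt (gconst \<gamma>) * l2 lborel f"
proof -
  obtain g where gV: "\<And>n. in_V (g n)" and lim: "(\<lambda>n. l2 lborel (\<lambda>x. g n x - f x)) \<longlonglongrightarrow> 0"
    by (rule V_dense_seq[OF f]) (rule that)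
  have gs: "sqint lborel (g n)" for n by (rule in_V_sqint[OF gV])
  have pt: "(\<lambda>n. gabor \<gamma> (g n) z) \<longlonglongrightarrow> gabor \<gamma> f z" for z
    by (rule gabor_tendsto[OF \<gamma> gs f lim])
  have fm: "f \<in> borel_measurable borel" using f by (simp add: sqint_def)
  have m: "gabor \<gamma> f \<in> borel_measurable lborel" using gabor_measurable[OF fm] by simp
  let ?s = "sqrt (gconst \<gamma>)"
  have diff: "sqint lborel (\<lambda>z. gabor \<gamma> (g m) z - gabor \<gamma> (g n) z)"
    "l2 lborel (\<lambda>z. gabor \<gamma> (g m) z - gabor \<gamma> (g n) z) = ?s * l2 lborel (\<lambda>x. g m x - g n x)" for m n
    using gabor_isometry_V[OF \<gamma> in_V_diff[OF gV[of m] gV[of n]]] gabor_diff[OF \<gamma> gs[of m] gs[of n]]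
    by (simp_all add: gabor_diff[OF \<gamma> gs[of m] gs[of n], abs_def] cong: sqint_def)
  \<comment> \<open>The summand \<open>e\<close> absorbs the distance of \<open>g m\<close> from
    \<open>f\<close> for late \<open>m\<close>; afterwards it is taken to be 1 / (n + 1).\<close>
  have small: "sqint lborel (\<lambda>z. gabor \<gamma> f z - gabor \<gamma> (g n) z)"
    "l2 lborel (\<lambda>z. gabor \<gamma> f z - gabor \<gamma> (g n) z) \<le> ?s * (e + l2 lborel (\<lambda>x. g n x - f x))" if e: "e > 0" for n e
  proof -
    obtain N where N: "\<And>m. m \<ge> N \<Longrightarrow> l2 lborel (\<lambda>x. g m x - f x) < e"
      using LIMSEQ_D[OF lim e] by auto
    have le: "l2 lborel (\<lambda>z. gabor \<gamma> (g m) z - gabor \<gamma> (g n) z) \<le> ?s * (e + l2 lborel (\<lambda>x. g n x - f x))"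
      if "m \<ge> N" for m
      unfolding diff using gconst_pos[OF \<gamma>] N[OF that] l2_triangle_diff[OF gs[of m] f gs[of n]] l2_minus_commute[of lborel f "g n"]
      by (intro mult_left_mono) auto
    have "AE z in lborel. (\<lambda>m. gabor \<gamma> (g m) z - gabor \<gamma> (g n) z) \<longlonglongrightarrow> gabor \<gamma> f z - gabor \<gamma> (g n) z"
      by (intro AE_I2 tendsto_intros pt)
    note fat = l2_fatou[OF diff(1) _ this le]
    have "(\<lambda>z. gabor \<gamma> f z - gabor \<gamma> (g n) z) \<in> borel_measurable lborel"
      using m gabor_isometry_V(1)[OF \<gamma> gV[of n]] by (auto simp: sqint_def)
    from fat[OF this] show "sqint lborel (\<lambda>z. gabor \<gamma> f z - gabor \<gamma> (g n) z)"
      "l2 lborel (\<lambda>z. gabor \<gamma> f z - gabor \<gamma> (g n) z) \<le> ?s * (e + l2 lborel (\<lambda>x. g n x - f x))" by auto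
  qed
  show s: "sqint lborel (gabor \<gamma> f)"
    using sqint_add[OF small(1)[of 1 0] gabor_isometry_V(1)[OF \<gamma> gV[of 0]]] by simp
  have "(\<lambda>n. l2 lborel (\<lambda>z. gabor \<gamma> (g n) z - gabor \<gamma> f z)) \<longlonglongrightarrow> 0"
  proof (rule Lim_null_comparison)
    show "(\<lambda>n. ?s * (1 / (real n + 1) + l2 lborel (\<lambda>x. g n x - f x))) \<longlonglongrightarrow> 0"
      using LIMSEQ_inverse_real_of_nat
      by (intro tendsto_mult_right_zero tendsto_add_zero lim) (simp add: inverse_eq_divide add.commute)
    show "\<forall>\<^sub>F n in sequentially. norm (l2 lborel (\<lambda>z. gabor \<gamma> (g n) z - gabor \<gamma> f z)) \<le> ?s * (1 / (real n + 1) + l2 lborel (\<lambda>x. g n x - f x))"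
      using small(2) by (simp add: l2_minus_commute[of lborel "gabor \<gamma> (g _)"])
  qed
  then have "(\<lambda>n. l2 lborel (gabor \<gamma> (g n))) \<longlonglongrightarrow> l2 lborel (gabor \<gamma> f)"
    by (intro l2_tendsto gabor_isometry_V(1)[OF \<gamma> gV] s)
  moreover have "(\<lambda>n. ?s * l2 lborel (g n)) \<longlonglongrightarrow> ?s * l2 lborel f"
    by (intro tendsto_mult_left l2_tendsto gs f lim)
  ultimately show "l2 lborel (gabor \<gamma> f) = ?s * l2 lborel f"
    unfolding gabor_isometry_V(2)[OF \<gamma> gV] by (rule LIMSEQ_unique)
qed

section \<open>Adjoint and reproducing property\<close>

definition gabor_adj :: "real \<Rightarrow> (real \<times> real \<Rightarrow> complex) \<Rightarrow> real \<Rightarrow> complex" where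
  "gabor_adj \<gamma> \<phi> y = (LINT z|lborel. cnj (gabor_kernel \<gamma> z y) * \<phi> z)"

text \<open>The modulus of the kernel depends on x - y alone, so the kernel is not square integrable
  in z = (x, p) and the integral in \<open>gabor_adj\<close> has no general meaning on L2. On
  bounded functions supported in a square it converges absolutely.\<close>

definition box_bounded :: "real \<Rightarrow> real \<Rightarrow> (real \<times> real \<Rightarrow> complex) \<Rightarrow> bool" where
  "box_bounded R B \<phi> \<longleftrightarrow> \<phi> \<in> borel_measurable borel \<and>
     (\<forall>z. cmod (\<phi> z) \<le> B * indicator (cbox (-R, -R) (R, R)) z)"

lemma box_bounded_bound: "box_bounded R B \<phi> \<Longrightarrow> cmod (\<phi> z) \<le> B * indicator (cbox (-R, -R) (R, R)) z"
  unfolding box_bounded_def by blast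

lemma box_bounded_measurable: "box_bounded R B \<phi> \<Longrightarrow> \<phi> \<in> borel_measurable borel"
  by (simp add: box_bounded_def)

lemma integrable_box_indicator:
  "integrable lborel (\<lambda>z::real \<times> real. c * indicator (cbox a b) z :: real)"
  by (intro integrable_mult_right integrable_real_indicator) (use emeasure_bounded_finite[OF bounded_cbox[of a b]] in auto)

lemma box_bounded_integrable:
  assumes "box_bounded R B \<phi>"
  shows "integrable lborel \<phi>"
proof (rule Bochner_Integration.integrable_bound[OF integrable_box_indicator[of B "(-R, -R)" "(R, R)"]])
  show "\<phi> \<in> borel_measurable lborel" using box_bounded_measurable[OF assms] by simp
  show "AE z in lborel. norm (\<phi> z) \<le> norm (B * indicator (cbox (-R, -R) (R, R)) z)"
    by (intro AE_I2 order_trans[OF box_bounded_bound[OF assms]]) (simp only: real_norm_def abs_ge_self)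
qed

lemma box_bounded_sqint:
  assumes "box_bounded R B \<phi>"
  shows "sqint lborel \<phi>"
proof (rule sqint_bound[OF _ integrable_box_indicator[of "B\<^sup>2" "(-R, -R)" "(R, R)"]])
  show "\<phi> \<in> borel_measurable lborel" using box_bounded_measurable[OF assms] by simp
  show "(cmod (\<phi> z))\<^sup>2 \<le> B\<^sup>2 * indicator (cbox (-R, -R) (R, R)) z" for z
    using power_mono[OF box_bounded_bound[OF assms, of z] norm_ge_zero, of 2]
    by (cases "z \<in> cbox (-R, -R) (R, R)") (simp_all add: power_mult_distrib)
qed

lemma cmod_gabor_kernel_le_1: "\<gamma> > 0 \<Longrightarrow> cmod (gabor_kernel \<gamma> z y) \<le> 1"
  by (simp add: cmod_gabor_kernel)

lemma gabor_kernel_measurable_fst [measurable]: "(\<lambda>z. gabor_kernel \<gamma> z y) \<in> borel_measurable borel"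
  unfolding gabor_kernel_def by (intro borel_measurable_continuous_onI continuous_intros)

lemma gabor_adj_integrable:
  assumes \<gamma>: "\<gamma> > 0" and \<phi>: "box_bounded R B \<phi>"
  shows "integrable lborel (\<lambda>z. cnj (gabor_kernel \<gamma> z y) * \<phi> z)"
proof (rule Bochner_Integration.integrable_bound[OF box_bounded_integrable[OF \<phi>]])
  note box_bounded_measurable[OF \<phi>, measurable]
  show "(\<lambda>z. cnj (gabor_kernel \<gamma> z y) * \<phi> z) \<in> borel_measurable lborel" by measurable
  show "AE z in lborel. norm (cnj (gabor_kernel \<gamma> z y) * \<phi> z) \<le> norm (\<phi> z)"
    using cmod_gabor_kernel_le_1[OF \<gamma>] by (auto simp: norm_mult intro!: mult_left_le_one_le)
qed

lemma gabor_adj_measurable: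
  assumes [measurable]: "\<phi> \<in> borel_measurable borel"
  shows "gabor_adj \<gamma> \<phi> \<in> borel_measurable borel"
proof -
  have s: "sets (lborel \<Otimes>\<^sub>M lborel :: (real \<times> real \<times> real) measure) = sets borel"
    by (metis lborel_prod sets_lborel)
  have "(\<lambda>w::real \<times> real \<times> real. gabor_kernel \<gamma> (snd w) (fst w)) \<in> borel_measurable borel"
    unfolding gabor_kernel_def by (intro borel_measurable_continuous_onI continuous_intros)
  then have [measurable]: "(\<lambda>w::real \<times> real \<times> real. gabor_kernel \<gamma> (snd w) (fst w)) \<in> borel_measurable (lborel \<Otimes>\<^sub>M lborel)"
    by (simp add: measurable_cong_sets[OF s refl])
  have "(\<lambda>y. LINT z|lborel. cnj (gabor_kernel \<gamma> z y) * \<phi> z) \<in> borel_measurable lborel"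
  proof (rule lborel.borel_measurable_lebesgue_integral)
    show "(\<lambda>(y, z). cnj (gabor_kernel \<gamma> z y) * \<phi> z) \<in> borel_measurable (lborel \<Otimes>\<^sub>M lborel)"
      unfolding split_beta' by measurable
  qed
  then show ?thesis unfolding gabor_adj_def[abs_def] by simp
qed

text \<open>Points of the support have |x| at most \<open>R\<close>, and y^2 is at most 2 (x - y)^2
  + 2 x^2. So the Gaussian decay in x - y becomes decay in y at half the rate, at the price of the
  factor exp (gamma R^2 / 2).\<close>

lemma sqint_gabor_adj:
  assumes \<gamma>: "\<gamma> > 0" and \<phi>: "box_bounded R B \<phi>"
  shows "sqint lborel (gabor_adj \<gamma> \<phi>)"
proof -
  define c where "c = (LINT z|lborel. (B * exp (\<gamma> / 2 * R\<^sup>2)) * indicator (cbox (-R, -R) (R, R)) z :: real)"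
  have bound: "cmod (gabor_adj \<gamma> \<phi> y) \<le> c * exp (- (\<gamma> / 4 * y\<^sup>2))" for y
  proof -
    have "cmod (gabor_adj \<gamma> \<phi> y) \<le> (LINT z|lborel. cmod (cnj (gabor_kernel \<gamma> z y) * \<phi> z))"
      unfolding gabor_adj_def by (rule integral_norm_bound)
    also have "\<dots> \<le> (LINT z|lborel. ((B * exp (\<gamma> / 2 * R\<^sup>2)) * indicator (cbox (-R, -R) (R, R)) z) * exp (- (\<gamma> / 4 * y\<^sup>2)))"
    proof (rule integral_mono)
      show "integrable lborel (\<lambda>z. cmod (cnj (gabor_kernel \<gamma> z y) * \<phi> z))"
        by (intro integrable_norm gabor_adj_integrable[OF \<gamma> \<phi>])
      show "integrable lborel (\<lambda>z. ((B * exp (\<gamma> / 2 * R\<^sup>2)) * indicator (cbox (-R, -R) (R, R)) z) * exp (- (\<gamma> / 4 * y\<^sup>2)))"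
        by (intro integrable_mult_left integrable_box_indicator)
      fix z :: "real \<times> real"
      show "cmod (cnj (gabor_kernel \<gamma> z y) * \<phi> z)
        \<le> ((B * exp (\<gamma> / 2 * R\<^sup>2)) * indicator (cbox (-R, -R) (R, R)) z) * exp (- (\<gamma> / 4 * y\<^sup>2))"
      proof (cases "z \<in> cbox (-R, -R) (R, R)")
        case True
        then have "\<bar>fst z\<bar> \<le> R" by (cases z) (auto simp: cbox_Pair_eq)
        then have x: "(fst z)\<^sup>2 \<le> R\<^sup>2" by (metis abs_ge_zero power2_abs power_mono)
        have "y\<^sup>2 = ((y - fst z) + fst z)\<^sup>2" by simp
        also have "\<dots> \<le> 2 * (y - fst z)\<^sup>2 + 2 * (fst z)\<^sup>2" by (rule power2_add_le)
        finally have "\<gamma> / 4 * y\<^sup>2 \<le> \<gamma> / 4 * (2 * (fst z - y)\<^sup>2 + 2 * R\<^sup>2)"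
          using x \<gamma> by (intro mult_left_mono) (auto simp: power2_commute)
        then have "exp (- (\<gamma> / 2 * (fst z - y)\<^sup>2)) \<le> exp (\<gamma> / 2 * R\<^sup>2 + - (\<gamma> / 4 * y\<^sup>2))"
          by (simp add: algebra_simps)
        then have k: "cmod (gabor_kernel \<gamma> z y) \<le> exp (\<gamma> / 2 * R\<^sup>2) * exp (- (\<gamma> / 4 * y\<^sup>2))"
          unfolding cmod_gabor_kernel by (simp only: exp_add)
        have "cmod (\<phi> z) \<le> B" using box_bounded_bound[OF \<phi>, of z] True by simp
        with k have "cmod (gabor_kernel \<gamma> z y) * cmod (\<phi> z) \<le> (exp (\<gamma> / 2 * R\<^sup>2) * exp (- (\<gamma> / 4 * y\<^sup>2))) * B"
          by (intro mult_mono) auto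
        then show ?thesis using True by (simp add: norm_mult mult_ac)
      next
        case False
        then show ?thesis using box_bounded_bound[OF \<phi>, of z] by simp
      qed
    qed
    also have "\<dots> = c * exp (- (\<gamma> / 4 * y\<^sup>2))" unfolding c_def by simp
    finally show ?thesis .
  qed
  show ?thesis
  proof (rule sqint_bound)
    show "gabor_adj \<gamma> \<phi> \<in> borel_measurable lborel"
      using gabor_adj_measurable[OF box_bounded_measurable[OF \<phi>]] by simp
    show "integrable lborel (\<lambda>y. c\<^sup>2 * exp (- (\<gamma> / 2 * y\<^sup>2)))"
      using \<gamma> by (intro integrable_mult_right integrable_gaussian) simp
    show "(cmod (gabor_adj \<gamma> \<phi> y))\<^sup>2 \<le> c\<^sup>2 * exp (- (\<gamma> / 2 * y\<^sup>2))" for y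
      using power_mono[OF bound[of y] norm_ge_zero, of 2]
      by (simp add: power_mult_distrib flip: exp_double)
  qed
qed

text \<open>Exchange of integrals. Absolute integrability comes from Cauchy-Schwarz in y: the inner
  integral is at most a constant times \<open>cmod (\<phi> z)\<close>, as the norm of the kernel is
  independent of z.\<close>

lemma gabor_adj_inner:
  assumes \<gamma>: "\<gamma> > 0" and \<phi>: "box_bounded R B \<phi>" and f: "sqint lborel f"
  shows "(LINT y|lborel. cnj (f y) * gabor_adj \<gamma> \<phi> y) = (LINT z|lborel. cnj (gabor \<gamma> f z) * \<phi> z)"
proof -
  have [measurable]: "f \<in> borel_measurable borel" using f by (simp add: sqint_def)
  note box_bounded_measurable[OF \<phi>, measurable]
  define F where "F z y = cnj (f y) * (cnj (gabor_kernel \<gamma> z y) * \<phi> z)" for z y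
  have Fi: "integrable lborel (F z)" for z
    unfolding F_def using gabor_integrable[OF \<gamma> f, of z, THEN integrable_cnj] 
    by (simp add: mult.assoc[symmetric] mult.commute[of "cnj (f _)"])
  have [measurable]: "(\<lambda>w. F (fst w) (snd w)) \<in> borel_measurable (lborel \<Otimes>\<^sub>M lborel)"
    unfolding F_def by measurable
  have i: "integrable (lborel \<Otimes>\<^sub>M lborel) (\<lambda>(z, y). F z y)"
  proof (rule lborel_pair.Fubini_integrable)
    show "(\<lambda>(z, y). F z y) \<in> borel_measurable (lborel \<Otimes>\<^sub>M lborel)"
      unfolding split_beta' by measurable
    show "AE z in lborel. integrable lborel (\<lambda>y. case (z, y) of (z, y) \<Rightarrow> F z y)"
      using Fi by simp
    have "integrable lborel (\<lambda>z. LINT y|lborel. norm (F z y))"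
    proof (rule Bochner_Integration.integrable_bound)
      show "integrable lborel (\<lambda>z. (sqrt (sqrt (pi / \<gamma>)) * l2 lborel f) * cmod (\<phi> z))"
        by (intro integrable_mult_right integrable_norm box_bounded_integrable[OF \<phi>])
      show "(\<lambda>z. LINT y|lborel. norm (F z y)) \<in> borel_measurable lborel"
        by (rule lborel.borel_measurable_lebesgue_integral) (unfold split_beta', measurable)
      have "norm (LINT y|lborel. norm (F z y)) \<le> norm (sqrt (sqrt (pi / \<gamma>)) * l2 lborel f * cmod (\<phi> z))" for z
      proof -
        have "(LINT y|lborel. norm (F z y)) = (LINT y|lborel. cmod (gabor_kernel \<gamma> z y) * cmod (f y)) * cmod (\<phi> z)"
          by (simp add: F_def norm_mult mult_ac flip: integral_mult_left_zero)
        also have "\<dots> \<le> (l2 lborel (gabor_kernel \<gamma> z) * l2 lborel f) * cmod (\<phi> z)"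
          by (intro mult_right_mono integral_norm_mult_le_l2 gabor_kernel_l2 \<gamma> f) simp
        finally show ?thesis using gabor_kernel_l2(2)[OF \<gamma>, of z] by (simp add: \<gamma> less_imp_le)
      qed
      then show "AE z in lborel. norm (LINT y|lborel. norm (F z y)) \<le> norm (sqrt (sqrt (pi / \<gamma>)) * l2 lborel f * cmod (\<phi> z))"
        by simp
    qed
    then show "integrable lborel (\<lambda>z. LINT y|lborel. norm (case (z, y) of (z, y) \<Rightarrow> F z y))" by simp
  qed
  have "(LINT y|lborel. cnj (f y) * gabor_adj \<gamma> \<phi> y) = (LINT y|lborel. LINT z|lborel. F z y)"
    unfolding F_def gabor_adj_def by simp
  also have "\<dots> = (LINT z|lborel. LINT y|lborel. F z y)"
    by (rule lborel_pair.Fubini_integral[OF i])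
  also have "\<dots> = (LINT z|lborel. cnj (gabor \<gamma> f z) * \<phi> z)"
  proof -
    have "F z = (\<lambda>y. cnj (gabor_kernel \<gamma> z y * f y) * \<phi> z)" for z
      by (simp add: fun_eq_iff F_def mult_ac)
    then show ?thesis by (simp add: gabor_def del: complex_cnj_mult)
  qed
  finally show ?thesis .
qed

text \<open>Pair the adjoint image with itself, move the adjoint across, and use the isometry on the
  image; one factor of its norm cancels.\<close>

lemma gabor_adj_contraction:
  assumes \<gamma>: "\<gamma> > 0" and \<phi>: "box_bounded R B \<phi>"
  shows "l2 lborel (gabor_adj \<gamma> \<phi>) \<le> sqrt (gconst \<gamma>) * l2 lborel \<phi>"
proof -
  let ?f = "gabor_adj \<gamma> \<phi>"
  have f: "sqint lborel ?f" by (rule sqint_gabor_adj[OF assms])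
  have "(l2 lborel ?f)\<^sup>2 = cmod (complex_of_real ((l2 lborel ?f)\<^sup>2))"
    by (simp only: norm_of_real abs_power2)
  also have "\<dots> = cmod (LINT z|lborel. cnj (gabor \<gamma> ?f z) * \<phi> z)"
    unfolding l2_power2_complex[OF f] gabor_adj_inner[OF \<gamma> \<phi> f] ..
  also have "\<dots> \<le> l2 lborel (gabor \<gamma> ?f) * l2 lborel \<phi>"
    by (intro norm_inner_le_l2 gabor_isometry \<gamma> f box_bounded_sqint[OF \<phi>])
  also have "\<dots> = l2 lborel ?f * (sqrt (gconst \<gamma>) * l2 lborel \<phi>)"
    by (simp add: gabor_isometry(2)[OF \<gamma> f])
  finally have le: "l2 lborel ?f * l2 lborel ?f \<le> l2 lborel ?f * (sqrt (gconst \<gamma>) * l2 lborel \<phi>)"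
    by (simp add: power2_eq_square)
  show ?thesis
  proof (cases "l2 lborel ?f = 0")
    case True
    then show ?thesis using gconst_pos[OF \<gamma>] by simp
  next
    case False
    then have "l2 lborel ?f > 0" using l2_nonneg[of lborel ?f] by linarith
    with le show ?thesis by (simp only: mult_le_cancel_left_pos)
  qed
qed

section \<open>Area-preserving linear maps of the plane\<close>

lemma lborel_shear_fst:
  "distr lborel borel (\<lambda>z::real \<times> real. (fst z + a * snd z, snd z)) = lborel"
proof (rule measure_eqI)
  fix A assume "A \<in> sets (distr lborel borel (\<lambda>z::real \<times> real. (fst z + a * snd z, snd z)))"
  then have [measurable]: "A \<in> sets borel" by simp
  have [measurable]: "(\<lambda>z::real \<times> real. (fst z + a * snd z, snd z)) \<in> borel_measurable borel"
    by (intro borel_measurable_continuous_onI continuous_intros)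
  have "emeasure (distr lborel borel (\<lambda>z::real \<times> real. (fst z + a * snd z, snd z))) A
    = (\<integral>\<^sup>+ z. indicator A z \<partial>distr lborel borel (\<lambda>z::real \<times> real. (fst z + a * snd z, snd z)))"
    by simp
  also have "\<dots> = (\<integral>\<^sup>+ z. indicator A (fst z + a * snd z, snd z) \<partial>(lborel \<Otimes>\<^sub>M lborel))"
    unfolding lborel_prod by (subst nn_integral_distr) auto
  also have "\<dots> = (\<integral>\<^sup>+ y. \<integral>\<^sup>+ x. indicator A (x + a * y, y) \<partial>lborel \<partial>lborel)"
    by (subst lborel_pair.nn_integral_snd[symmetric]) (auto simp: lborel_prod)
  also have "\<dots> = (\<integral>\<^sup>+ y. \<integral>\<^sup>+ x. indicator A (x, y) \<partial>lborel \<partial>lborel)"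
  proof (rule nn_integral_cong)
    fix y :: real
    have "(\<lambda>x. (x, y)) \<in> borel_measurable borel"
      by (intro borel_measurable_continuous_onI continuous_intros)
    then have "(\<lambda>x. indicator A (x, y) :: ennreal) \<in> borel_measurable borel"
      using measurable_compose by (metis borel_measurable_indicator \<open>A \<in> sets borel\<close>)
    from nn_integral_real_affine[OF this, of 1 "a * y"]
    show "(\<integral>\<^sup>+ x. indicator A (x + a * y, y) \<partial>lborel) = (\<integral>\<^sup>+ x. indicator A (x, y) \<partial>lborel)"
      by (simp add: add.commute)
  qed
  also have "\<dots> = (\<integral>\<^sup>+ z. indicator A z \<partial>(lborel \<Otimes>\<^sub>M lborel))"
    by (subst lborel_pair.nn_integral_snd[symmetric]) (auto simp: lborel_prod)
  also have "\<dots> = emeasure lborel A" unfolding lborel_prod by simp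
  finally show "emeasure (distr lborel borel (\<lambda>z::real \<times> real. (fst z + a * snd z, snd z))) A = emeasure lborel A" .
qed simp

lemma lborel_swap: "distr lborel borel (\<lambda>z::real \<times> real. (snd z, fst z)) = lborel"
proof -
  have "(lborel :: (real \<times> real) measure) = distr lborel lborel (\<lambda>(x, y). (y, x))"
    using lborel_pair.distr_pair_swap[where ?'a = real and ?'b = real] unfolding lborel_prod .
  also have "\<dots> = distr lborel borel (\<lambda>z. (snd z, fst z))" by (rule distr_cong) auto
  finally show ?thesis by simp
qed

lemma lborel_shear_snd:
  "distr lborel borel (\<lambda>z::real \<times> real. (fst z, snd z + a * fst z)) = lborel"
proof -
  let ?S = "\<lambda>z::real \<times> real. (fst z + a * snd z, snd z)" and ?w = "\<lambda>z::real \<times> real. (snd z, fst z)"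
  have m: "?S \<in> borel_measurable borel" "?w \<in> borel_measurable borel"
    by (intro borel_measurable_continuous_onI continuous_intros)+
  have "distr lborel borel (?w \<circ> (?S \<circ> ?w)) = distr (distr (distr lborel borel ?w) borel ?S) borel ?w"
    using m by (simp add: distr_distr measurable_comp comp_assoc)
  also have "\<dots> = lborel" by (simp only: lborel_shear_fst lborel_swap)
  finally show ?thesis by (simp add: o_def)
qed

text \<open>A matrix of determinant 1 with nonzero lower left entry \<open>c\<close> is a product of
  three shears. The entries d and a fix the outer shears e = (d - 1) / c and f = (a - 1) / c, and
  the determinant then yields b.\<close>

lemma lborel_SL2:
  fixes a b c d :: real
  assumes det: "a * d - b * c = 1" and c: "c \<noteq> 0"
  shows "distr lborel borel (\<lambda>z::real \<times> real. (a * fst z + b * snd z, c * fst z + d * snd z)) = lborel"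
proof -
  define e f where "e = (d - 1) / c" and "f = (a - 1) / c"
  let ?S1 = "\<lambda>z::real \<times> real. (fst z + e * snd z, snd z)"
  let ?S2 = "\<lambda>z::real \<times> real. (fst z, snd z + c * fst z)"
  let ?S3 = "\<lambda>z::real \<times> real. (fst z + f * snd z, snd z)"
  have m: "?S1 \<in> borel_measurable borel" "?S2 \<in> borel_measurable borel" "?S3 \<in> borel_measurable borel"
    by (intro borel_measurable_continuous_onI continuous_intros)+
  have 1: "c * e = d - 1" "c * f = a - 1" using c by (auto simp: e_def f_def)
  have 2: "e + f * d = b"
  proof -
    have "c * (e + f * d) = (d - 1) + (a - 1) * d" using 1 by (simp add: distrib_left mult.assoc[symmetric])
    also have "\<dots> = c * b" using det by (simp add: algebra_simps)
    finally show ?thesis using c by simp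
  qed
  have S: "(?S3 \<circ> (?S2 \<circ> ?S1)) z = (a * fst z + b * snd z, c * fst z + d * snd z)" for z
  proof -
    have s: "snd z + c * (fst z + e * snd z) = c * fst z + d * snd z"
      using 1(1) by (simp add: distrib_left mult.assoc[symmetric]) (simp add: algebra_simps)
    have "fst z + e * snd z + f * (c * fst z + d * snd z) = (1 + c * f) * fst z + (e + f * d) * snd z"
      by (simp add: algebra_simps)
    then have "fst z + e * snd z + f * (c * fst z + d * snd z) = a * fst z + b * snd z"
      unfolding 2 1 by simp
    with s show ?thesis by simp
  qed
  have eq: "(\<lambda>z. (a * fst z + b * snd z, c * fst z + d * snd z)) = ?S3 \<circ> (?S2 \<circ> ?S1)"
    by (rule ext) (rule S[symmetric])
  have "distr lborel borel (?S3 \<circ> (?S2 \<circ> ?S1)) = distr (distr (distr lborel borel ?S1) borel ?S2) borel ?S3"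
    using m by (simp add: distr_distr measurable_comp comp_assoc)
  also have "\<dots> = lborel" by (simp only: lborel_shear_fst lborel_shear_snd)
  finally show ?thesis unfolding eq .
qed

text \<open>Cauchy's formula on the unit circle for the function z -> F (z w), whose value at the
  centre is F 0.\<close>

lemma mean_value_circle:
  assumes F: "F holomorphic_on UNIV"
  shows "((\<lambda>s. F (exp (2 * of_real pi * \<i> * of_real s) * w)) has_integral F 0) {0..1}"
proof (cases "w = 0")
  case True
  then show ?thesis using has_integral_const_real[of "F 0" 0 1] by simp
next
  case False
  define G where "G z = F (z * w)" for z
  have G: "G holomorphic_on UNIV"
    unfolding G_def
    by (rule holomorphic_on_compose_gen[OF _ F, unfolded o_def]) (auto intro!: holomorphic_intros)
  have "((\<lambda>u. G u / (u - 0)) has_contour_integral (2 * of_real pi * \<i> * G 0)) (circlepath 0 1)"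
    by (rule Cauchy_integral_circlepath_simple[OF holomorphic_on_subset[OF G]]) auto
  then have "((\<lambda>s. G (circlepath 0 1 s) / circlepath 0 1 s * vector_derivative (circlepath 0 1) (at s)) has_integral
      (2 * of_real pi * \<i> * G 0)) {0..1}"
    by (simp add: has_contour_integral)
  then have "((\<lambda>s. (2 * of_real pi * \<i>) * G (exp (2 * of_real pi * \<i> * of_real s))) has_integral
      (2 * of_real pi * \<i>) * G 0) {0..1}"
    by (rule has_integral_eq[rotated]) (simp add: vector_derivative_circlepath, simp add: circlepath field_simps)
  from has_integral_mult_right[OF this, of "1 / (2 * of_real pi * \<i>)"]
  show ?thesis by (simp add: G_def)
qed

text \<open>The complex coordinate (gamma x + i p) / sqrt gamma, a positive multiple of w_tau when
  gamma = alpha cot (alpha t). The square roots make it area-preserving, and its squared modulus is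
  gamma x^2 + p^2 / gamma.\<close>

definition bargmann_coord :: "real \<Rightarrow> real \<times> real \<Rightarrow> complex" where
  "bargmann_coord \<gamma> z = Complex (sqrt \<gamma> * fst z) (snd z / sqrt \<gamma>)"

lemma continuous_on_bargmann_coord: "continuous_on S (bargmann_coord \<gamma>)"
proof -
  have "bargmann_coord \<gamma> = (\<lambda>z. of_real (sqrt \<gamma> * fst z) + \<i> * of_real (snd z / sqrt \<gamma>))"
    by (simp add: fun_eq_iff bargmann_coord_def complex_eq_iff)
  moreover have "continuous_on S (\<lambda>z. of_real (sqrt \<gamma> * fst z) + \<i> * complex_of_real (snd z * (1 / sqrt \<gamma>)))"
    by (intro continuous_intros)
  ultimately show ?thesis by simp
qed

lemma integral_measure_preserving:
  fixes h :: "'a::euclidean_space \<Rightarrow> 'b::{banach, second_countable_topology}"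
  assumes d: "distr lborel borel g = lborel" and [measurable]: "g \<in> borel_measurable borel" "h \<in> borel_measurable borel"
  shows "(LINT z|lborel. h (g z)) = (LINT z|lborel. h z)"
    and "integrable lborel (\<lambda>z. h (g z)) \<longleftrightarrow> integrable lborel h"
proof -
  have [measurable]: "g \<in> measurable lborel borel" by simp
  have "(LINT z|lborel. h z) = (LINT z|distr lborel borel g. h z)" by (simp only: d)
  also have "\<dots> = (LINT z|lborel. h (g z))" by (rule integral_distr) auto
  finally show "(LINT z|lborel. h (g z)) = (LINT z|lborel. h z)" by simp
  have "integrable lborel h \<longleftrightarrow> integrable (distr lborel borel g) h" by (simp only: d)
  also have "\<dots> \<longleftrightarrow> integrable lborel (\<lambda>z. h (g z))" by (rule integrable_distr_eq) auto
  finally show "integrable lborel (\<lambda>z. h (g z)) \<longleftrightarrow> integrable lborel h" by simp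
qed

lemma gaussian_weight_integral:
  assumes \<gamma>: "\<gamma> > 0"
  shows "(LINT z|lborel. complex_of_real (exp (- ((cmod (bargmann_coord \<gamma> z))\<^sup>2 / 2)))) = of_real (2 * pi)"
proof -
  have 1: "has_bochner_integral lborel (\<lambda>x. complex_of_real (exp (- (\<gamma> / 2 * (x - 0)\<^sup>2)))) (of_real (sqrt (pi / (\<gamma> / 2))))"
    using \<gamma> by (intro has_bochner_integral_of_real real_gaussian_shift) simp
  have 2: "has_bochner_integral lborel (\<lambda>x. complex_of_real (exp (- (1 / (2 * \<gamma>) * (x - 0)\<^sup>2)))) (of_real (sqrt (pi / (1 / (2 * \<gamma>)))))"
    using \<gamma> by (intro has_bochner_integral_of_real real_gaussian_shift) simp
  have e: "complex_of_real (exp (- ((cmod (bargmann_coord \<gamma> z))\<^sup>2 / 2)))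
    = of_real (exp (- (\<gamma> / 2 * (fst z - 0)\<^sup>2))) * of_real (exp (- (1 / (2 * \<gamma>) * (snd z - 0)\<^sup>2)))" for z
    using \<gamma> by (simp add: bargmann_coord_def cmod_power2 power_mult_distrib power_divide field_simps
        flip: of_real_mult exp_add)
  have "sqrt (pi / (\<gamma> / 2)) * sqrt (pi / (1 / (2 * \<gamma>))) = sqrt ((2 * pi)\<^sup>2)"
    unfolding real_sqrt_mult[symmetric] using \<gamma> by (simp add: power2_eq_square)
  also have "\<dots> = 2 * pi" by (rule real_sqrt_unique) auto
  finally have s: "complex_of_real (sqrt (pi / (\<gamma> / 2))) * of_real (sqrt (pi / (1 / (2 * \<gamma>)))) = of_real (2 * pi)"
    by (simp only: of_real_mult[symmetric])
  show ?thesis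
    unfolding e using lborel_product_integral[OF 1 2] unfolding s has_bochner_integral_iff by blast
qed

text \<open>The Gaussian weight is invariant under rotations, so the integral does not change when the
  integrand is averaged over them; the average of an entire function over a circle is its value
  at the centre.\<close>

lemma gaussian_mean_value:
  assumes \<gamma>: "\<gamma> > 0" and F: "F holomorphic_on UNIV"
    and int: "integrable lborel (\<lambda>z. complex_of_real (exp (- ((cmod (bargmann_coord \<gamma> z))\<^sup>2 / 2))) * F (bargmann_coord \<gamma> z))"
  shows "(LINT z|lborel. complex_of_real (exp (- ((cmod (bargmann_coord \<gamma> z))\<^sup>2 / 2))) * F (bargmann_coord \<gamma> z))
    = of_real (2 * pi) * F 0"
proof -
  define W where "W z = complex_of_real (exp (- ((cmod (bargmann_coord \<gamma> z))\<^sup>2 / 2)))" for z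
  define h where "h z = W z * F (bargmann_coord \<gamma> z)" for z
  \<comment> \<open>Rotation by 2 pi s in the rescaled coordinates: in terms of
    \<open>bargmann_coord\<close> it is multiplication by \<open>e s\<close>.\<close>
  define rot where "rot s z = (cos (2 * pi * s) * fst z + (- sin (2 * pi * s) / \<gamma>) * snd z,
      (\<gamma> * sin (2 * pi * s)) * fst z + cos (2 * pi * s) * snd z)" for s and z :: "real \<times> real"
  define e where "e s = exp (2 * of_real pi * \<i> * of_real s)" for s :: real
  have Fc: "continuous_on UNIV F" by (rule holomorphic_on_imp_continuous_on[OF F])
  have Wc: "continuous_on UNIV W"
    unfolding W_def by (intro continuous_intros continuous_on_bargmann_coord) auto
  have hc: "continuous_on UNIV h"
    unfolding h_def by (intro continuous_intros Wc continuous_on_compose2[OF Fc continuous_on_bargmann_coord]) auto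
  have hm: "h \<in> borel_measurable borel" by (rule borel_measurable_continuous_onI[OF hc])
  have hi: "integrable lborel h" using int unfolding h_def[abs_def] W_def .
  have e_cis: "e s = cis (2 * pi * s)" for s
    by (simp add: e_def cis_conv_exp mult_ac)
  have rot_coord: "bargmann_coord \<gamma> (rot s z) = e s * bargmann_coord \<gamma> z" for s z
  proof -
    have s2: "\<gamma> = sqrt \<gamma> * sqrt \<gamma>" "sqrt \<gamma> \<noteq> 0" using \<gamma> by auto
    have 1: "sqrt \<gamma> * (- sin (2 * pi * s) / \<gamma>) = - (sin (2 * pi * s) / sqrt \<gamma>)"
      by (subst s2(1)) (use s2(2) in \<open>simp add: divide_simps\<close>)
    have 2: "\<gamma> * sin (2 * pi * s) / sqrt \<gamma> = sqrt \<gamma> * sin (2 * pi * s)"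
      using real_div_sqrt[of \<gamma>] \<gamma> by (metis less_imp_le times_divide_eq_left)
    have re: "sqrt \<gamma> * (cos (2 * pi * s) * fst z + (- sin (2 * pi * s) / \<gamma>) * snd z)
       = cos (2 * pi * s) * (sqrt \<gamma> * fst z) - sin (2 * pi * s) * (snd z / sqrt \<gamma>)"
      unfolding distrib_left mult.assoc[symmetric] 1 by simp
    have im: "((\<gamma> * sin (2 * pi * s)) * fst z + cos (2 * pi * s) * snd z) / sqrt \<gamma>
       = cos (2 * pi * s) * (snd z / sqrt \<gamma>) + sin (2 * pi * s) * (sqrt \<gamma> * fst z)"
    proof -
      have "\<gamma> * sin (2 * pi * s) * fst z / sqrt \<gamma> = sqrt \<gamma> * sin (2 * pi * s) * fst z"
        using 2 by (metis times_divide_eq_left)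
      then show ?thesis unfolding add_divide_distrib by simp
    qed
    show ?thesis
      unfolding e_cis bargmann_coord_def rot_def fst_conv snd_conv re im by (simp add: complex_eq_iff)
  qed
  have h_rot: "h (rot s z) = W z * F (e s * bargmann_coord \<gamma> z)" for s z
  proof -
    have "cmod (e s) = 1" by (simp add: e_cis)
    then show ?thesis by (simp add: h_def W_def rot_coord norm_mult)
  qed
  \<comment> \<open>At 0, 1/2 and 1 the lower left entry of the rotation matrix vanishes and
    \<open>lborel_SL2\<close> does not apply; these parameters form a null set.\<close>
  define S where "S = {0<..<1::real} - {1/2}"
  have Sm [measurable]: "S \<in> sets borel" unfolding S_def by measurable
  have rot_inv: "integrable lborel (\<lambda>z. h (rot s z))" "(LINT z|lborel. h (rot s z)) = (LINT z|lborel. h z)"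
     "(LINT z|lborel. norm (h (rot s z))) = (LINT z|lborel. norm (h z))" if "s \<in> S" for s
  proof -
    have "sin (2 * pi * s) \<noteq> 0"
    proof
      assume "sin (2 * pi * s) = 0"
      then obtain i :: int where "2 * pi * s = of_int i * pi" by (auto simp: sin_zero_iff_int2)
      then have "of_int i = 2 * s" by simp
      moreover have "0 < 2 * s" "2 * s < 2" "2 * s \<noteq> 1" using that by (auto simp: S_def)
      ultimately have "0 < i" "i < 2" "i \<noteq> 1" by linarith+
      then show False by linarith
    qed
    then have d: "distr lborel borel (rot s) = lborel"
      unfolding rot_def using \<gamma> by (intro lborel_SL2) (auto simp flip: power2_eq_square)
    have rm: "rot s \<in> borel_measurable borel"
      unfolding rot_def by (intro borel_measurable_continuous_onI continuous_intros)
    show "integrable lborel (\<lambda>z. h (rot s z))" "(LINT z|lborel. h (rot s z)) = (LINT z|lborel. h z)"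
      using integral_measure_preserving[OF d rm hm] hi by auto
    have "(\<lambda>z. norm (h z)) \<in> borel_measurable borel" using hm by measurable
    from integral_measure_preserving(1)[OF d rm this]
    show "(LINT z|lborel. norm (h (rot s z))) = (LINT z|lborel. norm (h z))" .
  qed
  define \<Phi> where "\<Phi> s z = indicator S s *\<^sub>R h (rot s z)" for s z
  have m: "(\<lambda>w::real \<times> real \<times> real. \<Phi> (fst w) (snd w)) \<in> borel_measurable (lborel \<Otimes>\<^sub>M lborel)"
  proof -
    have st: "sets (lborel \<Otimes>\<^sub>M lborel :: (real \<times> real \<times> real) measure) = sets borel"
      by (metis lborel_prod sets_lborel)
    have "continuous_on UNIV (\<lambda>w::real \<times> real \<times> real. rot (fst w) (snd w))"
      unfolding rot_def using \<gamma> by (intro continuous_intros) auto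
    then have "(\<lambda>w::real \<times> real \<times> real. h (rot (fst w) (snd w))) \<in> borel_measurable borel"
      by (intro borel_measurable_continuous_onI continuous_on_compose2[OF hc]) auto
    then have [measurable]: "(\<lambda>w::real \<times> real \<times> real. h (rot (fst w) (snd w))) \<in> borel_measurable (lborel \<Otimes>\<^sub>M lborel)"
      by (simp add: measurable_cong_sets[OF st refl])
    show ?thesis unfolding \<Phi>_def by measurable
  qed
  have Si: "integrable lborel (\<lambda>s. indicator S s :: real)" "(LINT s|lborel. indicator S s :: real) = 1"
  proof -
    have ae: "AE s in lborel. (indicator S s :: real) = indicator {0..1} s"
    proof -
      have "AE s in lborel. s \<noteq> (0::real)" "AE s in lborel. s \<noteq> (1::real)" "AE s in lborel. s \<noteq> (1/2::real)"
        by (rule AE_lborel_singleton)+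
      then show ?thesis by eventually_elim (auto simp: S_def indicator_def)
    qed
    have "integrable lborel (\<lambda>s. indicator {0..1::real} s :: real)" by simp
    then show "integrable lborel (\<lambda>s. indicator S s :: real)"
      by (subst integrable_cong_AE[OF _ _ ae]) auto
    have "(LINT s|lborel. indicator S s :: real) = (LINT s|lborel. indicator {0..1::real} s)"
      by (rule integral_cong_AE[OF _ _ ae]) auto
    then show "(LINT s|lborel. indicator S s :: real) = 1" by simp
  qed
  have i: "integrable (lborel \<Otimes>\<^sub>M lborel) (\<lambda>(s, z). \<Phi> s z)"
  proof (rule lborel_pair.Fubini_integrable)
    show "(\<lambda>(s, z). \<Phi> s z) \<in> borel_measurable (lborel \<Otimes>\<^sub>M lborel)" unfolding split_beta' by (rule m)
    have "(LINT z|lborel. norm (\<Phi> s z)) = indicator S s * (LINT z|lborel. norm (h z))" for s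
      using rot_inv(3)[of s] by (cases "s \<in> S") (auto simp: \<Phi>_def)
    then show "integrable lborel (\<lambda>s. LINT z|lborel. norm (case (s, z) of (s, z) \<Rightarrow> \<Phi> s z))"
      using Si(1) by simp
    have "integrable lborel (\<Phi> s)" for s
      using rot_inv(1)[of s] by (cases "s \<in> S") (auto simp: \<Phi>_def[abs_def])
    then show "AE s in lborel. integrable lborel (\<lambda>z. case (s, z) of (s, z) \<Rightarrow> \<Phi> s z)" by simp
  qed
  have 1: "(LINT s|lborel. LINT z|lborel. \<Phi> s z) = (LINT z|lborel. h z)"
  proof -
    have "(LINT z|lborel. \<Phi> s z) = indicator S s *\<^sub>R (LINT z|lborel. h z)" for s
      using rot_inv(2)[of s] by (cases "s \<in> S") (auto simp: \<Phi>_def)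
    then show ?thesis using Si by simp
  qed
  have 2: "(LINT s|lborel. \<Phi> s z) = W z * F 0" for z
  proof -
    let ?g = "\<lambda>s. F (e s * bargmann_coord \<gamma> z)"
    have gc: "continuous_on UNIV ?g"
      unfolding e_def by (intro continuous_on_compose2[OF Fc] continuous_intros) auto
    have gm: "?g \<in> borel_measurable borel" by (rule borel_measurable_continuous_onI[OF gc])
    have gi: "set_integrable lborel {0..1} ?g"
      by (intro borel_integrable_atLeastAtMost' continuous_on_subset[OF gc]) auto
    have "(LINT s|lborel. indicator S s *\<^sub>R ?g s) = (LINT s:{0..1}|lborel. ?g s)"
      unfolding set_lebesgue_integral_def
    proof (rule integral_cong_AE)
      have "AE s in lborel. s \<noteq> (0::real)" "AE s in lborel. s \<noteq> (1::real)" "AE s in lborel. s \<noteq> (1/2::real)"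
        by (rule AE_lborel_singleton)+
      then show "AE s in lborel. indicator S s *\<^sub>R ?g s = indicator {0..1} s *\<^sub>R ?g s"
        by eventually_elim (auto simp: S_def indicator_def)
    qed (use gm in measurable)
    also have "\<dots> = integral {0..1} ?g" by (rule set_borel_integral_eq_integral(2)[OF gi])
    also have "\<dots> = F 0"
      using mean_value_circle[OF F, of "bargmann_coord \<gamma> z"] unfolding e_def by (rule integral_unique)
    finally have g0: "(LINT s|lborel. indicator S s *\<^sub>R ?g s) = F 0" .
    have "\<Phi> s z = W z * (indicator S s *\<^sub>R ?g s)" for s
      by (simp add: \<Phi>_def h_rot)
    then show ?thesis by (simp only: integral_mult_right_zero g0)
  qed
  have "(LINT z|lborel. h z) = (LINT z|lborel. LINT s|lborel. \<Phi> s z)"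
    using lborel_pair.Fubini_integral[OF i] 1 by simp
  also have "\<dots> = (LINT z|lborel. W z) * F 0" by (simp add: 2)
  also have "(LINT z|lborel. W z) = of_real (2 * pi)"
    unfolding W_def by (rule gaussian_weight_integral[OF \<gamma>])
  finally show ?thesis unfolding h_def W_def .
qed

text \<open>The covariant derivative along the Hamiltonian field of w_tau divided by sin (alpha t) /
  alpha, which leaves gamma = alpha cot (alpha t) as the only parameter.\<close>

definition gabor_polarized :: "real \<Rightarrow> (real \<times> real \<Rightarrow> complex) \<Rightarrow> bool" where
  "gabor_polarized \<gamma> \<psi> \<longleftrightarrow> (\<forall>z. \<exists>D. (\<psi> has_derivative D) (at z) \<and>
     \<i> * D (1, 0) - of_real \<gamma> * D (0, 1) - of_real (snd z) * \<psi> z = 0)"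

lemma linear_pair_expand:
  fixes D :: "real \<times> real \<Rightarrow> complex"
  assumes "linear D"
  shows "D (a, b) = of_real a * D (1, 0) + of_real b * D (0, 1)"
proof -
  have "(a, b) = a *\<^sub>R (1, 0) + b *\<^sub>R ((0, 1) :: real \<times> real)" by simp
  then have "D (a, b) = D (a *\<^sub>R (1, 0) + b *\<^sub>R (0, 1))" by simp
  also have "\<dots> = a *\<^sub>R D (1, 0) + b *\<^sub>R D (0, 1)"
    by (simp only: linear_add[OF assms] linear_scale[OF assms])
  finally show ?thesis by (simp add: scaleR_conv_of_real)
qed

text \<open>Up to a constant the prefactor is the reciprocal of the transform of the centred
  Gaussian, a nowhere vanishing solution of the same first order equation. In the quotient of two
  solutions the connection term drops out and the Cauchy-Riemann equation remains.\<close>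

lemma gabor_polarized_holomorphic:
  assumes \<gamma>: "\<gamma> > 0" and pol: "gabor_polarized \<gamma> \<psi>"
  shows "(\<lambda>\<zeta>. exp (\<i> * of_real (Re \<zeta> * Im \<zeta> / 2) + of_real (((Re \<zeta>)\<^sup>2 + (Im \<zeta>)\<^sup>2) / 4))
     * \<psi> (Re \<zeta> / sqrt \<gamma>, sqrt \<gamma> * Im \<zeta>)) holomorphic_on UNIV"
proof -
  define q where "q \<zeta> = \<i> * of_real (Re \<zeta> * Im \<zeta> / 2) + of_real (((Re \<zeta>)\<^sup>2 + (Im \<zeta>)\<^sup>2) / 4)" for \<zeta>
  let ?\<psi> = "\<lambda>\<zeta>. \<psi> (Re \<zeta> / sqrt \<gamma>, sqrt \<gamma> * Im \<zeta>)"
  have "\<exists>c. ((\<lambda>\<zeta>. exp (q \<zeta>) * ?\<psi> \<zeta>) has_field_derivative c) (at \<zeta>)" for \<zeta>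
  proof -
    obtain D where D: "(\<psi> has_derivative D) (at (Re \<zeta> / sqrt \<gamma>, sqrt \<gamma> * Im \<zeta>))"
      and pz: "\<i> * D (1, 0) - of_real \<gamma> * D (0, 1) - of_real (sqrt \<gamma> * Im \<zeta>) * ?\<psi> \<zeta> = 0"
      using pol unfolding gabor_polarized_def by force
    have lin: "D (a, b) = of_real a * D (1, 0) + of_real b * D (0, 1)" for a b
      by (rule linear_pair_expand[OF has_derivative_linear[OF D]])
    have d1: "((\<lambda>\<zeta>. (Re \<zeta> / sqrt \<gamma>, sqrt \<gamma> * Im \<zeta>)) has_derivative (\<lambda>h. (Re h / sqrt \<gamma>, sqrt \<gamma> * Im h))) (at \<zeta>)"
    proof -
      have "((\<lambda>\<zeta>. (Re \<zeta> * (1 / sqrt \<gamma>), sqrt \<gamma> * Im \<zeta>)) has_derivative (\<lambda>h. (Re h * (1 / sqrt \<gamma>), sqrt \<gamma> * Im h))) (at \<zeta>)"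
        by (intro has_derivative_Pair has_derivative_mult_left has_derivative_mult_right
          bounded_linear.has_derivative[OF bounded_linear_Re] bounded_linear.has_derivative[OF bounded_linear_Im]
          has_derivative_ident)
      then show ?thesis by simp
    qed
    have d2: "(?\<psi> has_derivative (\<lambda>h. D (Re h / sqrt \<gamma>, sqrt \<gamma> * Im h))) (at \<zeta>)"
      by (rule has_derivative_compose[OF d1 D])
    have dq: "(q has_derivative (\<lambda>h. \<i> * of_real ((Re \<zeta> * Im h + Re h * Im \<zeta>) / 2)
        + of_real ((2 * Re \<zeta> * Re h + 2 * Im \<zeta> * Im h) / 4))) (at \<zeta>)"
      unfolding q_def by (rule derivative_eq_intros refl | simp)+ (simp add: fun_eq_iff algebra_simps)
    have de: "((\<lambda>\<zeta>. exp (q \<zeta>)) has_derivative (\<lambda>h. exp (q \<zeta>) * (\<i> * of_real ((Re \<zeta> * Im h + Re h * Im \<zeta>) / 2)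
        + of_real ((2 * Re \<zeta> * Re h + 2 * Im \<zeta> * Im h) / 4)))) (at \<zeta>)"
      by (rule has_derivative_compose[OF dq has_field_derivative_imp_has_derivative[OF DERIV_exp]])
    \<comment> \<open>The derivative in the real direction h = 1; it remains to see that the real
      derivative is multiplication by this number.\<close>
    define c where "c = exp (q \<zeta>) * (\<zeta> / 2 * ?\<psi> \<zeta> + D (1, 0) / of_real (sqrt \<gamma>))"
    have "((\<lambda>\<zeta>. exp (q \<zeta>) * ?\<psi> \<zeta>) has_derivative
       (\<lambda>h. exp (q \<zeta>) * D (Re h / sqrt \<gamma>, sqrt \<gamma> * Im h) + exp (q \<zeta>) * (\<i> * of_real ((Re \<zeta> * Im h + Re h * Im \<zeta>) / 2)
        + of_real ((2 * Re \<zeta> * Re h + 2 * Im \<zeta> * Im h) / 4)) * ?\<psi> \<zeta>)) (at \<zeta>)"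
      by (rule has_derivative_mult[OF de d2])
    moreover have "exp (q \<zeta>) * D (Re h / sqrt \<gamma>, sqrt \<gamma> * Im h) + exp (q \<zeta>) * (\<i> * of_real ((Re \<zeta> * Im h + Re h * Im \<zeta>) / 2)
        + of_real ((2 * Re \<zeta> * Re h + 2 * Im \<zeta> * Im h) / 4)) * ?\<psi> \<zeta> = c * h" for h
    proof -
      define A B P r where "A = D (1, 0)" and "B = D (0, 1)" and "P = ?\<psi> \<zeta>" and "r = complex_of_real (sqrt \<gamma>)"
      have r: "r \<noteq> 0" "of_real \<gamma> = r * r" using \<gamma> by (auto simp: r_def simp flip: of_real_mult)
      \<comment> \<open>The polarization equation expresses the p-derivative through the
        x-derivative and the value. Inserting it makes the derivative complex linear in h.\<close>
      have B: "r * B = \<i> * A / r - of_real (Im \<zeta>) * P"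
      proof -
        have "r * (r * B) = \<i> * A - r * of_real (Im \<zeta>) * P"
          using pz unfolding r(2) A_def B_def P_def r_def by (simp add: algebra_simps)
        also have "\<dots> = r * (\<i> * A / r - of_real (Im \<zeta>) * P)" using r by (simp add: algebra_simps)
        finally show ?thesis using r by simp
      qed
      have "D (Re h / sqrt \<gamma>, sqrt \<gamma> * Im h) = of_real (Re h) * A / r + of_real (Im h) * (r * B)"
        unfolding lin[of "Re h / sqrt \<gamma>"] A_def B_def r_def by simp
      also have "\<dots> = of_real (Re h) * A / r + of_real (Im h) * (\<i> * A / r - of_real (Im \<zeta>) * P)"
        unfolding B ..
      also have "\<dots> = (of_real (Re h) + \<i> * of_real (Im h)) * (A / r) - of_real (Im h * Im \<zeta>) * P"
        by (simp add: algebra_simps add_divide_distrib)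
      also have "of_real (Re h) + \<i> * of_real (Im h) = h" by (simp add: complex_eq_iff)
      finally have Dh: "D (Re h / sqrt \<gamma>, sqrt \<gamma> * Im h) = h * (A / r) - of_real (Im h * Im \<zeta>) * P" .
      have "\<i> * of_real ((Re \<zeta> * Im h + Re h * Im \<zeta>) / 2) + of_real ((2 * Re \<zeta> * Re h + 2 * Im \<zeta> * Im h) / 4)
         = \<zeta> / 2 * h + of_real (Im h * Im \<zeta>)"
        by (simp add: complex_eq_iff field_simps)
      then show ?thesis
        unfolding Dh c_def A_def[symmetric] P_def[symmetric] r_def[symmetric] by (simp add: algebra_simps)
    qed
    ultimately show ?thesis unfolding has_field_derivative_def by auto
  qed
  then show ?thesis unfolding q_def[symmetric] holomorphic_on_def field_differentiable_def by auto
qed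

lemma gabor_polarized_continuous:
  assumes "gabor_polarized \<gamma> \<psi>"
  shows "continuous_on UNIV \<psi>"
  using assms unfolding gabor_polarized_def
  by (meson continuous_at_imp_continuous_on has_derivative_continuous)

section \<open>The reproducing property on polarized functions\<close>

lemma gabor_gauss:
  assumes \<gamma>: "\<gamma> > 0"
  shows "gabor \<gamma> (\<lambda>y. of_real (exp (- (\<gamma> / 2 * y\<^sup>2)))) (x, p)
    = of_real (sqrt (pi / \<gamma>)) * exp (- \<i> * of_real (x * p / 2) - of_real (\<gamma> * x\<^sup>2 / 4 + p\<^sup>2 / (4 * \<gamma>)))"
proof -
  define b where "b = of_real (\<gamma> * x) + \<i> * of_real p"
  define k where "k = - \<i> * of_real (p * x) - of_real (\<gamma> / 2 * x\<^sup>2)"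
  have "gabor_kernel \<gamma> (x, p) y * of_real (exp (- (\<gamma> / 2 * y\<^sup>2))) = exp k * exp (b * of_real y - of_real (\<gamma> * y\<^sup>2))" for y
    unfolding gabor_kernel_def exp_of_real[symmetric] mult_exp_exp fst_conv snd_conv k_def b_def
    by (rule arg_cong[where f = exp]) (simp add: complex_eq_iff, simp add: field_simps power2_eq_square)
  then have "gabor \<gamma> (\<lambda>y. of_real (exp (- (\<gamma> / 2 * y\<^sup>2)))) (x, p) = exp k * (of_real (sqrt (pi / \<gamma>)) * exp (b\<^sup>2 / of_real (4 * \<gamma>)))"
    unfolding gabor_def using complex_gaussian[OF \<gamma>, of b] by (simp add: has_bochner_integral_iff)
  also have "\<dots> = of_real (sqrt (pi / \<gamma>)) * exp (k + b\<^sup>2 / of_real (4 * \<gamma>))" by (simp add: exp_add)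
  also have "k + b\<^sup>2 / of_real (4 * \<gamma>) = - \<i> * of_real (x * p / 2) - of_real (\<gamma> * x\<^sup>2 / 4 + p\<^sup>2 / (4 * \<gamma>))"
  proof -
    have "b\<^sup>2 = of_real ((\<gamma> * x)\<^sup>2 - p\<^sup>2) + \<i> * of_real (2 * \<gamma> * x * p)"
      by (simp add: b_def complex_eq_iff power2_eq_square)
    then have b2: "b\<^sup>2 / of_real (4 * \<gamma>) = of_real (((\<gamma> * x)\<^sup>2 - p\<^sup>2) / (4 * \<gamma>)) + \<i> * of_real (2 * \<gamma> * x * p / (4 * \<gamma>))"
      by (simp only: add_divide_distrib of_real_divide) simp
    have e1: "((\<gamma> * x)\<^sup>2 - p\<^sup>2) / (4 * \<gamma>) = \<gamma> * x\<^sup>2 / 4 - p\<^sup>2 / (4 * \<gamma>)"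
      and e2: "2 * \<gamma> * x * p / (4 * \<gamma>) = x * p / 2"
      using \<gamma> by (simp_all add: field_simps power2_eq_square)
    show ?thesis unfolding b2 e1 e2 k_def by (simp add: complex_eq_iff)
  qed
  finally show ?thesis .
qed

lemma sqint_gauss:
  assumes "\<gamma> > 0"
  shows "sqint lborel (\<lambda>y. complex_of_real (exp (- (\<gamma> / 2 * y\<^sup>2))))"
proof -
  have "complex_of_real (exp (- (\<gamma> / 2 * y\<^sup>2))) = gabor_kernel \<gamma> (0, 0) y" for y
    by (simp add: gabor_kernel_def exp_of_real[symmetric])
  then show ?thesis using gabor_kernel_l2(1)[OF assms, of "(0, 0)"] by simp
qed

text \<open>The conjugated transform of the Gaussian carries the phase of the holomorphic prefactor
  and half of the weight's decay. So the integrand is a constant times the rotation invariant weight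
  times an entire function, and the mean value property returns its value at 0; the constants
  multiply to sqrt (pi / gamma) 2 pi = \<open>gconst \<gamma>\<close>.\<close>

lemma reproducing_at_origin:
  assumes \<gamma>: "\<gamma> > 0" and pol: "gabor_polarized \<gamma> \<psi>" and sq: "sqint lborel \<psi>"
  shows "(LINT z|lborel. cnj (gabor \<gamma> (\<lambda>y. of_real (exp (- (\<gamma> / 2 * y\<^sup>2)))) z) * \<psi> z) = of_real (gconst \<gamma>) * \<psi> (0, 0)"
proof -
  let ?g = "\<lambda>y. complex_of_real (exp (- (\<gamma> / 2 * y\<^sup>2)))"
  define F where "F \<zeta> = exp (\<i> * of_real (Re \<zeta> * Im \<zeta> / 2) + of_real (((Re \<zeta>)\<^sup>2 + (Im \<zeta>)\<^sup>2) / 4))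
     * \<psi> (Re \<zeta> / sqrt \<gamma>, sqrt \<gamma> * Im \<zeta>)" for \<zeta>
  have F: "F holomorphic_on UNIV"
    unfolding F_def by (rule gabor_polarized_holomorphic[OF \<gamma> pol])
  let ?W = "\<lambda>z. complex_of_real (exp (- ((cmod (bargmann_coord \<gamma> z))\<^sup>2 / 2)))"
  have eq: "cnj (gabor \<gamma> ?g z) * \<psi> z = of_real (sqrt (pi / \<gamma>)) * (?W z * F (bargmann_coord \<gamma> z))" for z
  proof -
    obtain x p where z: "z = (x, p)" by (cases z)
    have c: "Re (bargmann_coord \<gamma> z) = sqrt \<gamma> * x" "Im (bargmann_coord \<gamma> z) = p / sqrt \<gamma>"
      by (simp_all add: z bargmann_coord_def)
    have a: "(Re (bargmann_coord \<gamma> z) / sqrt \<gamma>, sqrt \<gamma> * Im (bargmann_coord \<gamma> z)) = z"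
      unfolding c using \<gamma> by (simp add: z)
    have pr: "Re (bargmann_coord \<gamma> z) * Im (bargmann_coord \<gamma> z) = x * p" unfolding c using \<gamma> by simp
    have n: "(Re (bargmann_coord \<gamma> z))\<^sup>2 + (Im (bargmann_coord \<gamma> z))\<^sup>2 = \<gamma> * x\<^sup>2 + p\<^sup>2 / \<gamma>"
      unfolding c using \<gamma> by (simp add: power_mult_distrib power_divide)
    have "cnj (exp (- \<i> * of_real (x * p / 2) - of_real (\<gamma> * x\<^sup>2 / 4 + p\<^sup>2 / (4 * \<gamma>))))
      = exp (of_real (- ((\<gamma> * x\<^sup>2 + p\<^sup>2 / \<gamma>) / 2))) * exp (\<i> * of_real (x * p / 2) + of_real ((\<gamma> * x\<^sup>2 + p\<^sup>2 / \<gamma>) / 4))"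
      unfolding exp_cnj mult_exp_exp
      by (rule arg_cong[where f = exp]) (use \<gamma> in \<open>simp add: complex_eq_iff field_simps\<close>)
    then show ?thesis
      unfolding F_def a pr cmod_power2 n exp_of_real[symmetric]
      unfolding exp_of_real z gabor_gauss[OF \<gamma>] complex_cnj_mult
      by (simp add: mult.assoc)
  qed
  have "integrable lborel (\<lambda>z. cnj (gabor \<gamma> ?g z) * \<psi> z)"
    by (intro sqint_cnj_mult_integrable gabor_isometry \<gamma> sqint_gauss sq)
  then have "integrable lborel (\<lambda>z. inverse (complex_of_real (sqrt (pi / \<gamma>))) * (cnj (gabor \<gamma> ?g z) * \<psi> z))"
    by (intro integrable_mult_right)
  moreover have c: "complex_of_real (sqrt (pi / \<gamma>)) \<noteq> 0" using \<gamma> by simp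
  ultimately have i: "integrable lborel (\<lambda>z. ?W z * F (bargmann_coord \<gamma> z))"
    by (simp only: eq mult.assoc[symmetric] left_inverse[OF c] mult_1_left)
  have "(LINT z|lborel. cnj (gabor \<gamma> ?g z) * \<psi> z) = of_real (sqrt (pi / \<gamma>)) * (of_real (2 * pi) * F 0)"
    unfolding eq using gaussian_mean_value[OF \<gamma> F i] by simp
  also have "\<dots> = of_real (gconst \<gamma>) * \<psi> (0, 0)"
    by (simp add: F_def gconst_def)
  finally show ?thesis .
qed

text \<open>Heisenberg covariance moves the base point: the conjugated kernel at \<open>z0\<close>
  is, up to a phase, the centred Gaussian shifted by x0 and p0, and its transform is shifted
  accordingly. Translating the integration variable reduces the claim to the origin.\<close>

lemma reproducing:
  assumes \<gamma>: "\<gamma> > 0" and pol: "gabor_polarized \<gamma> \<psi>" and sq: "sqint lborel \<psi>"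
  shows "(LINT z|lborel. cnj (gabor \<gamma> (\<lambda>y. cnj (gabor_kernel \<gamma> z0 y)) z) * \<psi> z) = of_real (gconst \<gamma>) * \<psi> z0"
proof -
  obtain x0 p0 where z0: "z0 = (x0, p0)" by (cases z0)
  let ?g = "\<lambda>y. complex_of_real (exp (- (\<gamma> / 2 * y\<^sup>2)))"
  \<comment> \<open>A plain translation would replace p by p0 + p in the polarization equation; the
    phase contributes -p0 under i d/dx and restores it.\<close>
  define \<psi>' where "\<psi>' w = exp (\<i> * of_real (p0 * fst w)) * \<psi> (z0 + w)" for w
  have "(\<lambda>y. cnj (gabor_kernel \<gamma> z0 y)) = (\<lambda>y. exp (\<i> * of_real (p0 * x0)) * V0 p0 (W0 x0 ?g) y)"
    unfolding gabor_kernel_def V0_def W0_def exp_of_real[symmetric] exp_cnj mult_exp_exp z0 fst_conv snd_conv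
    by (rule ext, rule arg_cong[where f = exp]) (simp add: algebra_simps power2_commute)
  then have g: "gabor \<gamma> (\<lambda>y. cnj (gabor_kernel \<gamma> z0 y)) z = exp (\<i> * of_real (p0 * x0)) * Vtau p0 (Wtau x0 (gabor \<gamma> ?g)) z" for z
    by (simp add: gabor_cmult gabor_V0 gabor_W0 del: of_real_mult)
  have \<psi>'m: "\<psi>' \<in> borel_measurable borel"
    unfolding \<psi>'_def
    by (intro borel_measurable_continuous_onI continuous_intros
        continuous_on_compose2[OF gabor_polarized_continuous[OF pol]]) auto
  have pol': "gabor_polarized \<gamma> \<psi>'"
    unfolding gabor_polarized_def
  proof
    fix w
    obtain D where D: "(\<psi> has_derivative D) (at (z0 + w))"
      and pz: "\<i> * D (1, 0) - of_real \<gamma> * D (0, 1) - of_real (snd (z0 + w)) * \<psi> (z0 + w) = 0"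
      using pol unfolding gabor_polarized_def by blast
    have d1: "((\<lambda>w. \<psi> (z0 + w)) has_derivative D) (at w)"
    proof -
      have "((+) z0 has_derivative (\<lambda>h. 0 + h)) (at w)"
        by (intro has_derivative_add has_derivative_const has_derivative_ident)
      from has_derivative_compose[OF this D] show ?thesis by simp
    qed
    have dq: "((\<lambda>w. \<i> * of_real (p0 * fst w)) has_derivative (\<lambda>h. \<i> * of_real (p0 * fst h))) (at w)"
      by (rule derivative_eq_intros refl | simp)+
    have de: "((\<lambda>w. exp (\<i> * of_real (p0 * fst w))) has_derivative (\<lambda>h. exp (\<i> * of_real (p0 * fst w)) * (\<i> * of_real (p0 * fst h)))) (at w)"
      by (rule has_derivative_compose[OF dq has_field_derivative_imp_has_derivative[OF DERIV_exp]])
    define E where "E = exp (\<i> * of_real (p0 * fst w))"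
    let ?D = "\<lambda>h. E * D h + E * (\<i> * of_real (p0 * fst h)) * \<psi> (z0 + w)"
    have "(\<psi>' has_derivative ?D) (at w)"
      unfolding \<psi>'_def E_def by (rule has_derivative_mult[OF de d1])
    moreover have "\<psi>' w = E * \<psi> (z0 + w)" by (simp add: \<psi>'_def E_def)
    then have "\<i> * ?D (1, 0) - of_real \<gamma> * ?D (0, 1) - of_real (snd w) * \<psi>' w
       = E * (\<i> * D (1, 0) - of_real \<gamma> * D (0, 1) - of_real (snd (z0 + w)) * \<psi> (z0 + w))"
      by (simp add: z0 algebra_simps)
    ultimately show "\<exists>D. (\<psi>' has_derivative D) (at w) \<and> \<i> * D (1, 0) - of_real \<gamma> * D (0, 1) - of_real (snd w) * \<psi>' w = 0"
      unfolding pz by auto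
  qed
  have shift: "distr lborel borel ((+) z0) = lborel" by (rule lborel_distr_plus)
  have sm: "(+) z0 \<in> borel_measurable borel" by (intro borel_measurable_continuous_onI continuous_intros)
  have \<psi>m: "\<psi> \<in> borel_measurable borel" using sq by (simp add: sqint_def)
  have sq': "sqint lborel \<psi>'"
    unfolding sqint_def
  proof
    show "\<psi>' \<in> borel_measurable lborel" using \<psi>'m by simp
    have "integrable lborel (\<lambda>z. (cmod (\<psi> (z0 + z)))\<^sup>2)"
      using integral_measure_preserving(2)[OF shift sm, of "\<lambda>z. (cmod (\<psi> z))\<^sup>2"] sq \<psi>m by (simp add: sqint_def)
    then show "integrable lborel (\<lambda>x. (cmod (\<psi>' x))\<^sup>2)" by (simp add: \<psi>'_def norm_mult)
  qed
  let ?h = "\<lambda>z. cnj (gabor \<gamma> (\<lambda>y. cnj (gabor_kernel \<gamma> z0 y)) z) * \<psi> z"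
  have km: "(\<lambda>y. cnj (gabor_kernel \<gamma> z0 y)) \<in> borel_measurable borel" by measurable
  have hm: "?h \<in> borel_measurable borel"
    using gabor_measurable[OF km, of \<gamma>] \<psi>m by measurable
  have "?h (z0 + w) = cnj (gabor \<gamma> ?g w) * \<psi>' w" for w
  proof -
    have gw: "gabor \<gamma> (\<lambda>y. cnj (gabor_kernel \<gamma> z0 y)) (z0 + w)
        = exp (\<i> * of_real (p0 * x0)) * (exp (- \<i> * of_real (p0 * (x0 + fst w))) * gabor \<gamma> ?g w)"
      unfolding g by (simp add: Vtau_def Wtau_def split_beta z0 del: of_real_mult of_real_add)
    have e: "cnj (exp (\<i> * of_real (p0 * x0))) * cnj (exp (- \<i> * of_real (p0 * (x0 + fst w)))) = exp (\<i> * of_real (p0 * fst w))"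
      unfolding exp_cnj mult_exp_exp by (rule arg_cong[where f = exp]) (simp add: algebra_simps)
    show ?thesis
      unfolding gw complex_cnj_mult \<psi>'_def e[symmetric] by (simp only: mult_ac)
  qed
  then have "(LINT z|lborel. ?h z) = (LINT w|lborel. cnj (gabor \<gamma> ?g w) * \<psi>' w)"
    using integral_measure_preserving(1)[OF shift sm hm] by simp
  also have "\<dots> = of_real (gconst \<gamma>) * \<psi>' (0, 0)"
    by (rule reproducing_at_origin[OF \<gamma> pol' sq'])
  also have "\<psi>' (0, 0) = \<psi> z0" by (simp add: \<psi>'_def z0)
  finally show ?thesis .
qed

text \<open>The adjoint is applied to the cutoffs of \<open>\<psi>\<close> to squares; its norm
  bound makes the images Cauchy. The limit has transform \<open>gconst \<gamma>\<close> times
  \<open>\<psi>\<close> at every point by the reproducing property, so dividing by that constant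
  gives a preimage on the nose rather than almost everywhere.\<close>

lemma gabor_surj_polarized:
  assumes \<gamma>: "\<gamma> > 0" and pol: "gabor_polarized \<gamma> \<psi>" and sq: "sqint lborel \<psi>"
  obtains f where "sqint lborel f" "gabor \<gamma> f = \<psi>"
proof -
  define \<phi> where "\<phi> n z = indicator (cbox (- real n, - real n) (real n, real n)) z *\<^sub>R \<psi> z" for n z
  have \<psi>c: "continuous_on UNIV \<psi>" by (rule gabor_polarized_continuous[OF pol])
  have \<psi>m [measurable]: "\<psi> \<in> borel_measurable borel" using sq by (simp add: sqint_def)
  have \<phi>m: "\<phi> n \<in> borel_measurable borel" for n unfolding \<phi>_def[abs_def] by measurable
  have bb: "\<exists>B. box_bounded (real k) B f"
    if f: "f \<in> borel_measurable borel"
      and le: "\<And>z. cmod (f z) \<le> indicator (cbox (- real k, - real k) (real k, real k)) z * cmod (\<psi> z)" for k f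
  proof -
    have "bounded (\<psi> ` cbox (- real k, - real k) (real k, real k))"
      by (intro compact_imp_bounded compact_continuous_image continuous_on_subset[OF \<psi>c]) auto
    then obtain B where B: "\<And>z. z \<in> cbox (- real k, - real k) (real k, real k) \<Longrightarrow> cmod (\<psi> z) \<le> B"
      unfolding bounded_iff by blast
    have "cmod (f z) \<le> B * indicator (cbox (- real k, - real k) (real k, real k)) z" for z
      using le[of z] B[of z] by (auto simp: indicator_def split: if_splits)
    with f show ?thesis unfolding box_bounded_def by blast
  qed
  have bb1: "\<exists>B. box_bounded (real n) B (\<phi> n)" for n
    by (rule bb[OF \<phi>m]) (simp add: \<phi>_def)
  define f where "f n = gabor_adj \<gamma> (\<phi> n)" for n
  have fs: "sqint lborel (f n)" for n
    using bb1[of n] sqint_gabor_adj[OF \<gamma>] unfolding f_def by blast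
  have \<phi>s: "sqint lborel (\<phi> n)" for n using bb1[of n] box_bounded_sqint by blast
  have \<phi>lim: "(\<lambda>n. l2 lborel (\<lambda>z. \<phi> n z - \<psi> z)) \<longlonglongrightarrow> 0"
  proof (rule l2_dominated_tendsto)
    show "integrable lborel (\<lambda>z. (cmod (\<psi> z))\<^sup>2)" using sq by (simp add: sqint_def)
    show "(cmod (\<phi> n z - \<psi> z))\<^sup>2 \<le> (cmod (\<psi> z))\<^sup>2" for n z by (simp add: \<phi>_def indicator_def)
    have "(\<lambda>n. \<phi> n z) \<longlonglongrightarrow> \<psi> z" for z
    proof (rule tendsto_eventually)
      obtain N where N: "real N \<ge> max \<bar>fst z\<bar> \<bar>snd z\<bar>" using real_arch_simple by blast
      show "\<forall>\<^sub>F n in sequentially. \<phi> n z = \<psi> z"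
        unfolding eventually_sequentially
      proof (intro exI allI impI)
        fix n assume "N \<le> n"
        then have "real N \<le> real n" by simp
        then have "z \<in> cbox (- real n, - real n) (real n, real n)"
          using N by (cases z) (auto simp: cbox_Pair_eq)
        then show "\<phi> n z = \<psi> z" by (simp add: \<phi>_def)
      qed
    qed
    then show "AE z in lborel. (\<lambda>n. \<phi> n z) \<longlonglongrightarrow> \<psi> z" by simp
  qed (use \<phi>m in auto)
  have fdiff: "l2 lborel (\<lambda>y. f m y - f n y) \<le> sqrt (gconst \<gamma>) * l2 lborel (\<lambda>z. \<phi> m z - \<phi> n z)" for m n
  proof -
    obtain B where B: "box_bounded (real (max m n)) B (\<lambda>z. \<phi> m z - \<phi> n z)"
    proof -
      have sub: "cbox (- real j, - real j) (real j, real j) \<subseteq> cbox (- real (max m n), - real (max m n)) (real (max m n), real (max m n))"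
        if "j \<le> max m n" for j
        using that by (auto simp: cbox_Pair_eq simp del: of_nat_max)
      have "\<exists>B. box_bounded (real (max m n)) B (\<lambda>z. \<phi> m z - \<phi> n z)"
        using sub[of m] sub[of n] \<phi>m
        by (intro bb) (auto simp: \<phi>_def indicator_def simp del: of_nat_max)
      then show ?thesis using that by blast
    qed
    obtain Bm Bn where Bmn: "box_bounded (real m) Bm (\<phi> m)" "box_bounded (real n) Bn (\<phi> n)"
      using bb1 by blast
    have "f m y - f n y = gabor_adj \<gamma> (\<lambda>z. \<phi> m z - \<phi> n z) y" for y
      unfolding f_def gabor_adj_def
      using gabor_adj_integrable[OF \<gamma> Bmn(1), of y] gabor_adj_integrable[OF \<gamma> Bmn(2), of y]
      by (simp add: right_diff_distrib)
    then show ?thesis using gabor_adj_contraction[OF \<gamma> B] by simp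
  qed
  have "\<exists>g. sqint lborel g \<and> (\<lambda>n. l2 lborel (\<lambda>x. f n x - g x)) \<longlonglongrightarrow> 0"
  proof (rule l2_complete[OF fs])
    fix e :: real assume e: "e > 0"
    define s where "s = sqrt (gconst \<gamma>)"
    have s: "s > 0" using gconst_pos[OF \<gamma>] by (simp add: s_def)
    obtain N where N: "\<And>n. n \<ge> N \<Longrightarrow> l2 lborel (\<lambda>z. \<phi> n z - \<psi> z) < e / (2 * s)"
      using LIMSEQ_D[OF \<phi>lim, of "e / (2 * s)"] e s by auto
    show "\<exists>N. \<forall>m\<ge>N. \<forall>n\<ge>N. l2 lborel (\<lambda>x. f m x - f n x) < e"
    proof (intro exI allI impI)
      fix m n assume mn: "N \<le> m" "N \<le> n"
      have "l2 lborel (\<lambda>z. \<phi> m z - \<phi> n z) < e / (2 * s) + e / (2 * s)"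
        using l2_triangle_diff[OF \<phi>s[of m] sq \<phi>s[of n]] N[OF mn(1)] N[OF mn(2)]
          l2_minus_commute[of lborel \<psi> "\<phi> n"] by linarith
      then have "s * l2 lborel (\<lambda>z. \<phi> m z - \<phi> n z) < s * (e / (2 * s) + e / (2 * s))"
        using s by (intro mult_strict_left_mono)
      also have "s * (e / (2 * s) + e / (2 * s)) = e" using s by (simp add: field_simps)
      finally show "l2 lborel (\<lambda>x. f m x - f n x) < e" using fdiff[of m n] by (simp add: s_def)
    qed
  qed
  then obtain g where g: "sqint lborel g" and lim: "(\<lambda>n. l2 lborel (\<lambda>x. f n x - g x)) \<longlonglongrightarrow> 0"
    by blast
  have gg: "gabor \<gamma> g z = of_real (gconst \<gamma>) * \<psi> z" for z
  proof -
    let ?k = "\<lambda>y. cnj (gabor_kernel \<gamma> z y)"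
    have ks: "sqint lborel ?k" by (intro sqint_cnj gabor_kernel_l2 \<gamma>)
    have gks: "sqint lborel (gabor \<gamma> ?k)" by (rule gabor_isometry(1)[OF \<gamma> ks])
    \<comment> \<open>The value of a transform at \<open>z\<close> is an inner product with the
      conjugated kernel at \<open>z\<close>, which moves the adjoint off \<open>\<phi> n\<close> and
      exposes the reproducing kernel.\<close>
    have val: "gabor \<gamma> (f n) z = (LINT w|lborel. cnj (gabor \<gamma> ?k w) * \<phi> n w)" for n
    proof -
      obtain B where B: "box_bounded (real n) B (\<phi> n)" using bb1 by blast
      have "gabor \<gamma> (f n) z = (LINT y|lborel. cnj (?k y) * f n y)" by (simp add: gabor_def)
      then show ?thesis unfolding f_def gabor_adj_inner[OF \<gamma> B ks] .
    qed
    have "(\<lambda>n. (LINT w|lborel. cnj (gabor \<gamma> ?k w) * \<phi> n w) - (LINT w|lborel. cnj (gabor \<gamma> ?k w) * \<psi> w)) \<longlonglongrightarrow> 0"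
    proof (rule Lim_null_comparison)
      show "(\<lambda>n. l2 lborel (gabor \<gamma> ?k) * l2 lborel (\<lambda>z. \<phi> n z - \<psi> z)) \<longlonglongrightarrow> 0"
        by (intro tendsto_mult_right_zero \<phi>lim)
      have "(LINT w|lborel. cnj (gabor \<gamma> ?k w) * \<phi> n w) - (LINT w|lborel. cnj (gabor \<gamma> ?k w) * \<psi> w)
         = (LINT w|lborel. cnj (gabor \<gamma> ?k w) * (\<phi> n w - \<psi> w))" for n
        using sqint_cnj_mult_integrable[OF gks \<phi>s[of n]] sqint_cnj_mult_integrable[OF gks sq]
        by (simp add: right_diff_distrib)
      then show "\<forall>\<^sub>F n in sequentially. norm ((LINT w|lborel. cnj (gabor \<gamma> ?k w) * \<phi> n w) - (LINT w|lborel. cnj (gabor \<gamma> ?k w) * \<psi> w))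
          \<le> l2 lborel (gabor \<gamma> ?k) * l2 lborel (\<lambda>z. \<phi> n z - \<psi> z)"
        using norm_inner_le_l2[OF gks sqint_diff[OF \<phi>s sq]] by simp
    qed
    then have "(\<lambda>n. gabor \<gamma> (f n) z) \<longlonglongrightarrow> (LINT w|lborel. cnj (gabor \<gamma> ?k w) * \<psi> w)"
      unfolding val by (simp add: LIM_zero_iff)
    moreover have "(\<lambda>n. gabor \<gamma> (f n) z) \<longlonglongrightarrow> gabor \<gamma> g z" by (rule gabor_tendsto[OF \<gamma> fs g lim])
    ultimately show ?thesis using LIMSEQ_unique reproducing[OF \<gamma> pol sq, of z] by metis
  qed
  show ?thesis
  proof (rule that)
    show "sqint lborel (\<lambda>x. of_real (1 / gconst \<gamma>) * g x)" by (rule sqint_cmult[OF g])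
    show "gabor \<gamma> (\<lambda>x. of_real (1 / gconst \<gamma>) * g x) = \<psi>"
      unfolding fun_eq_iff gabor_cmult gg using gconst_pos[OF \<gamma>] by simp
  qed
qed

section \<open>The transform on the polarized Hilbert space\<close>

lemma Ck_Suc_imp: "Ck (Suc n) f \<Longrightarrow> Ck n f"
proof (induction n arbitrary: f)
  case 0
  then obtain fx fp where "\<forall>z. (f has_derivative (\<lambda>h. fst h *\<^sub>R fx z + snd h *\<^sub>R fp z)) (at z)"
    by auto
  then show ?case
    by (auto intro!: continuous_at_imp_continuous_on has_derivative_continuous)
next
  case (Suc n)
  from Suc.prems obtain fx fp where
    f: "\<forall>z. (f has_derivative (\<lambda>h. fst h *\<^sub>R fx z + snd h *\<^sub>R fp z)) (at z)"
    and "Ck (Suc n) fx" "Ck (Suc n) fp"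
    unfolding Ck.simps(2)[of "Suc n" f] by blast
  then have "Ck n fx" "Ck n fp" using Suc.IH by blast+
  with f show ?case unfolding Ck.simps(2)[of n f] by blast
qed

lemma CkI_Suc:
  assumes "\<And>z. (f has_derivative (\<lambda>h. fst h *\<^sub>R fx z + snd h *\<^sub>R fp z)) (at z)" "Ck n fx" "Ck n fp"
  shows "Ck (Suc n) f"
  unfolding Ck.simps(2)[of n f] using assms by blast

lemma Ck_SucE:
  assumes "Ck (Suc n) f"
  obtains fx fp where "\<And>z. (f has_derivative (\<lambda>h. fst h *\<^sub>R fx z + snd h *\<^sub>R fp z)) (at z)" "Ck n fx" "Ck n fp"
  using assms unfolding Ck.simps(2)[of n f] by blast

lemma Ck_const: "Ck n (\<lambda>z. c)"
proof (induction n arbitrary: c)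
  case (Suc n)
  show ?case by (rule CkI_Suc[of _ "\<lambda>z. 0" "\<lambda>z. 0"]) (use Suc in auto)
qed simp

lemma Ck_add: "Ck n f \<Longrightarrow> Ck n g \<Longrightarrow> Ck n (\<lambda>z. f z + g z)"
proof (induction n arbitrary: f g)
  case (Suc n)
  obtain fx fp where f: "\<And>z. (f has_derivative (\<lambda>h. fst h *\<^sub>R fx z + snd h *\<^sub>R fp z)) (at z)" "Ck n fx" "Ck n fp"
    using Ck_SucE[OF Suc.prems(1)] by blast
  obtain gx gp where g: "\<And>z. (g has_derivative (\<lambda>h. fst h *\<^sub>R gx z + snd h *\<^sub>R gp z)) (at z)" "Ck n gx" "Ck n gp"
    using Ck_SucE[OF Suc.prems(2)] by blast
  show ?case
  proof (rule CkI_Suc)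
    show "((\<lambda>z. f z + g z) has_derivative (\<lambda>h. fst h *\<^sub>R (fx z + gx z) + snd h *\<^sub>R (fp z + gp z))) (at z)" for z
      using has_derivative_add[OF f(1)[of z] g(1)[of z]] by (simp add: algebra_simps)
  qed (intro Suc.IH f g)+
qed (auto intro: continuous_intros)

lemma Ck_mult: "Ck n f \<Longrightarrow> Ck n g \<Longrightarrow> Ck n (\<lambda>z. f z * g z)"
proof (induction n arbitrary: f g)
  case (Suc n)
  obtain fx fp where f: "\<And>z. (f has_derivative (\<lambda>h. fst h *\<^sub>R fx z + snd h *\<^sub>R fp z)) (at z)" "Ck n fx" "Ck n fp"
    using Ck_SucE[OF Suc.prems(1)] by blast
  obtain gx gp where g: "\<And>z. (g has_derivative (\<lambda>h. fst h *\<^sub>R gx z + snd h *\<^sub>R gp z)) (at z)" "Ck n gx" "Ck n gp"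
    using Ck_SucE[OF Suc.prems(2)] by blast
  have n: "Ck n f" "Ck n g" using Suc.prems by (blast intro: Ck_Suc_imp)+
  show ?case
  proof (rule CkI_Suc)
    show "((\<lambda>z. f z * g z) has_derivative (\<lambda>h. fst h *\<^sub>R (f z * gx z + fx z * g z) + snd h *\<^sub>R (f z * gp z + fp z * g z))) (at z)" for z
      using has_derivative_mult[OF f(1)[of z] g(1)[of z]] by (simp add: algebra_simps)
  qed (intro Ck_add Suc.IH f g n)+
qed (auto intro: continuous_intros)

text \<open>Differentiation returns exp (q) times a derivative of q, so the induction on the order
  closes for a fixed \<open>q\<close> that is known to be smooth at every order.\<close>

lemma Ck_exp:
  assumes "\<And>n. Ck n q"
  shows "Ck n (\<lambda>z. exp (q z))"
proof (induction n)
  case 0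
  then show ?case using assms[of 0] by (auto intro: continuous_intros)
next
  case (Suc n)
  obtain qx qp where q: "\<And>z. (q has_derivative (\<lambda>h. fst h *\<^sub>R qx z + snd h *\<^sub>R qp z)) (at z)" "Ck n qx" "Ck n qp"
    using Ck_SucE[OF assms[of "Suc n"]] by blast
  show ?case
  proof (rule CkI_Suc)
    show "((\<lambda>z. exp (q z)) has_derivative (\<lambda>h. fst h *\<^sub>R (exp (q z) * qx z) + snd h *\<^sub>R (exp (q z) * qp z))) (at z)" for z
      using has_derivative_compose[OF q(1)[of z] has_field_derivative_imp_has_derivative[OF DERIV_exp]]
      by (simp add: algebra_simps)
  qed (intro Ck_mult Suc.IH q)+
qed

lemma Ck_fst: "Ck n (\<lambda>z. of_real (fst z))"
proof (cases n)
  case 0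
  then show ?thesis by (auto intro!: continuous_intros)
next
  case (Suc m)
  show ?thesis unfolding Suc
    by (rule CkI_Suc[of _ "\<lambda>z. 1" "\<lambda>z. 0"])
       (auto intro!: Ck_const derivative_eq_intros simp: scaleR_conv_of_real)
qed

lemma Ck_snd: "Ck n (\<lambda>z. of_real (snd z))"
proof (cases n)
  case 0
  then show ?thesis by (auto intro!: continuous_intros)
next
  case (Suc m)
  show ?thesis unfolding Suc
    by (rule CkI_Suc[of _ "\<lambda>z. 0" "\<lambda>z. 1"])
       (auto intro!: Ck_const derivative_eq_intros simp: scaleR_conv_of_real)
qed

lemma smooth2_const: "smooth2 (\<lambda>z. c)"
  and smooth2_fst: "smooth2 (\<lambda>z. of_real (fst z))"
  and smooth2_snd: "smooth2 (\<lambda>z. of_real (snd z))"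
  by (auto simp: smooth2_def Ck_const Ck_fst Ck_snd)

lemma smooth2_add: "smooth2 f \<Longrightarrow> smooth2 g \<Longrightarrow> smooth2 (\<lambda>z. f z + g z)"
  and smooth2_mult: "smooth2 f \<Longrightarrow> smooth2 g \<Longrightarrow> smooth2 (\<lambda>z. f z * g z)"
  and smooth2_exp: "smooth2 f \<Longrightarrow> smooth2 (\<lambda>z. exp (f z))"
  by (auto simp: smooth2_def Ck_add Ck_mult Ck_exp)

lemma smooth2_diff: "smooth2 f \<Longrightarrow> smooth2 g \<Longrightarrow> smooth2 (\<lambda>z. f z - g z)"
  using smooth2_add[of f "\<lambda>z. (-1) * g z"] smooth2_mult[OF smooth2_const, of g "-1"] by simp

lemma smooth2_sum: "(\<And>i. i \<in> I \<Longrightarrow> smooth2 (f i)) \<Longrightarrow> smooth2 (\<lambda>z. \<Sum>i\<in>I. f i z)"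
  by (induction I rule: infinite_finite_induct) (simp_all add: smooth2_const smooth2_add)

text \<open>The exponent written with sums and products of the complex coordinate functions only,
  the shape on which the rules for \<open>smooth2\<close> and for derivatives operate.\<close>

lemma gabor_psiY_alt:
  assumes \<gamma>: "\<gamma> > 0"
  shows "gabor \<gamma> (psiY P Q) z = of_real (1 / sqrt pi * sqrt (2 * pi / (1 + \<gamma>))) *
    exp (- \<i> * of_real P * (of_real (fst z) - of_real Q)
      - of_real (1 / (1 + \<gamma>) / 2) * ((of_real (snd z) - of_real P) * (of_real (snd z) - of_real P))
      - of_real (\<gamma> / (1 + \<gamma>) / 2) * ((of_real (fst z) - of_real Q) * (of_real (fst z) - of_real Q))
      - \<i> * of_real (1 / (1 + \<gamma>)) * ((of_real (fst z) - of_real Q) * (of_real (snd z) - of_real P)))"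
proof -
  obtain x p where z: "z = (x, p)" by (cases z)
  have "- \<i> * of_real (P * u) + (of_real (- m * v\<^sup>2 - n * u\<^sup>2) - 2 * \<i> * of_real (m * (u * v))) / 2
     = - \<i> * of_real P * of_real u - of_real (m / 2) * (of_real v * of_real v)
       - of_real (n / 2) * (of_real u * of_real u) - \<i> * of_real m * (of_real u * of_real v)"
    for m n u v :: real
    by (simp add: field_simps power2_eq_square)
  then show ?thesis
    unfolding z gabor_psiY[OF \<gamma>] fst_conv snd_conv of_real_diff[symmetric] by (simp only:)
qed

lemma smooth2_gabor_psiY:
  assumes "\<gamma> > 0"
  shows "smooth2 (gabor \<gamma> (psiY P Q))"
  unfolding gabor_psiY_alt[OF assms, abs_def]
  by (intro smooth2_mult smooth2_const smooth2_exp smooth2_diff smooth2_fst smooth2_snd)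

lemma gabor_polarized_psiY:
  assumes \<gamma>: "\<gamma> > 0"
  shows "gabor_polarized \<gamma> (gabor \<gamma> (psiY P Q))"
  unfolding gabor_polarized_def
proof
  fix z :: "real \<times> real"
  define \<mu> \<nu> where "\<mu> = 1 / (1 + \<gamma>)" and "\<nu> = \<gamma> / (1 + \<gamma>)"
  have \<nu>: "\<mu> + \<nu> = 1" "\<gamma> * \<mu> = \<nu>" using \<gamma> by (auto simp: \<mu>_def \<nu>_def field_simps)
  define k where "k = complex_of_real (1 / sqrt pi * sqrt (2 * pi / (1 + \<gamma>)))"
  define q where "q z = - \<i> * of_real P * (of_real (fst z) - of_real Q)
      - of_real (\<mu> / 2) * ((of_real (snd z) - of_real P) * (of_real (snd z) - of_real P))
      - of_real (\<nu> / 2) * ((of_real (fst z) - of_real Q) * (of_real (fst z) - of_real Q))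
      - \<i> * of_real \<mu> * ((of_real (fst z) - of_real Q) * (of_real (snd z) - of_real P))" for z :: "real \<times> real"
  have g: "gabor \<gamma> (psiY P Q) = (\<lambda>z. k * exp (q z))"
    unfolding gabor_psiY_alt[OF \<gamma>, abs_def] k_def q_def \<mu>_def \<nu>_def ..
  define u v where "u = complex_of_real (fst z) - of_real Q" and "v = complex_of_real (snd z) - of_real P"
  have dq: "(q has_derivative (\<lambda>h. of_real (fst h) * (- \<i> * of_real P - of_real \<nu> * u - \<i> * of_real \<mu> * v)
       + of_real (snd h) * (- of_real \<mu> * v - \<i> * of_real \<mu> * u))) (at z)"
    unfolding q_def u_def v_def
    by (rule derivative_eq_intros refl)+ (simp add: fun_eq_iff field_simps)
  let ?D = "\<lambda>h. k * (exp (q z) * (of_real (fst h) * (- \<i> * of_real P - of_real \<nu> * u - \<i> * of_real \<mu> * v)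
       + of_real (snd h) * (- of_real \<mu> * v - \<i> * of_real \<mu> * u)))"
  have "((\<lambda>z. k * exp (q z)) has_derivative ?D) (at z)"
    by (intro has_derivative_mult_right has_derivative_compose[OF dq has_field_derivative_imp_has_derivative[OF DERIV_exp]])
  moreover have "\<i> * ?D (1, 0) - of_real \<gamma> * ?D (0, 1) - of_real (snd z) * (k * exp (q z)) = 0"
  proof -
    \<comment> \<open>The bracket vanishes because mu + gamma mu = 1 and gamma mu = nu, together
      with P + v = p.\<close>
    have "\<i> * ?D (1, 0) - of_real \<gamma> * ?D (0, 1) - of_real (snd z) * (k * exp (q z))
      = k * exp (q z) * (of_real P + of_real (\<mu> + \<gamma> * \<mu>) * v - of_real (snd z) + \<i> * u * of_real (\<gamma> * \<mu> - \<nu>))"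
      by (simp add: algebra_simps)
    also have "\<dots> = 0" unfolding \<nu> by (simp add: v_def)
    finally show ?thesis .
  qed
  ultimately show "\<exists>D. (gabor \<gamma> (psiY P Q) has_derivative D) (at z) \<and>
     \<i> * D (1, 0) - of_real \<gamma> * D (0, 1) - of_real (snd z) * gabor \<gamma> (psiY P Q) z = 0"
    unfolding g by blast
qed

lemma gabor_polarized_zero: "gabor_polarized \<gamma> (\<lambda>z. 0)"
  unfolding gabor_polarized_def by (intro allI exI[of _ "\<lambda>h. 0"]) simp

lemma gabor_polarized_add:
  assumes "gabor_polarized \<gamma> f" "gabor_polarized \<gamma> g"
  shows "gabor_polarized \<gamma> (\<lambda>z. f z + g z)"
  unfolding gabor_polarized_def
proof
  fix z
  obtain D where D: "(f has_derivative D) (at z)" "\<i> * D (1, 0) - of_real \<gamma> * D (0, 1) - of_real (snd z) * f z = 0"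
    using assms(1) unfolding gabor_polarized_def by blast
  obtain E where E: "(g has_derivative E) (at z)" "\<i> * E (1, 0) - of_real \<gamma> * E (0, 1) - of_real (snd z) * g z = 0"
    using assms(2) unfolding gabor_polarized_def by blast
  have "\<i> * (D (1, 0) + E (1, 0)) - of_real \<gamma> * (D (0, 1) + E (0, 1)) - of_real (snd z) * (f z + g z)
    = (\<i> * D (1, 0) - of_real \<gamma> * D (0, 1) - of_real (snd z) * f z) + (\<i> * E (1, 0) - of_real \<gamma> * E (0, 1) - of_real (snd z) * g z)"
    by (simp add: algebra_simps)
  with has_derivative_add[OF D(1) E(1)] show "\<exists>D. ((\<lambda>z. f z + g z) has_derivative D) (at z) \<and>
     \<i> * D (1, 0) - of_real \<gamma> * D (0, 1) - of_real (snd z) * (f z + g z) = 0"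
    unfolding D(2) E(2) by (intro exI[of _ "\<lambda>h. D h + E h"]) simp
qed

lemma gabor_polarized_cmult:
  assumes "gabor_polarized \<gamma> f"
  shows "gabor_polarized \<gamma> (\<lambda>z. c * f z)"
  unfolding gabor_polarized_def
proof
  fix z
  obtain D where D: "(f has_derivative D) (at z)" "\<i> * D (1, 0) - of_real \<gamma> * D (0, 1) - of_real (snd z) * f z = 0"
    using assms(1) unfolding gabor_polarized_def by blast
  have "\<i> * (c * D (1, 0)) - of_real \<gamma> * (c * D (0, 1)) - of_real (snd z) * (c * f z)
    = c * (\<i> * D (1, 0) - of_real \<gamma> * D (0, 1) - of_real (snd z) * f z)"
    by (simp add: algebra_simps)
  with has_derivative_mult_right[OF D(1), of c] show "\<exists>D. ((\<lambda>z. c * f z) has_derivative D) (at z) \<and>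
     \<i> * D (1, 0) - of_real \<gamma> * D (0, 1) - of_real (snd z) * (c * f z) = 0"
    unfolding D(2) by (intro exI[of _ "\<lambda>h. c * D h"]) simp
qed

lemma gabor_polarized_sum:
  "(\<And>i. i \<in> I \<Longrightarrow> gabor_polarized \<gamma> (f i)) \<Longrightarrow> gabor_polarized \<gamma> (\<lambda>z. \<Sum>i\<in>I. f i z)"
  by (induction I rule: infinite_finite_induct) (simp_all add: gabor_polarized_zero gabor_polarized_add)

lemma gabor_lin_comb:
  assumes "\<gamma> > 0"
  shows "gabor \<gamma> (lin_comb n c P Q) = (\<lambda>z. \<Sum>k<n. c k * gabor \<gamma> (psiY (P k) (Q k)) z)"
  unfolding lin_comb_def
  by (simp add: fun_eq_iff gabor_sum[OF assms] sqint_cmult sqint_psiY gabor_cmult)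

lemma L2R_iff_sqint: "f \<in> L2R \<longleftrightarrow> sqint lborel f"
  using sqint_iff_nn_integral[of f lborel] by (auto simp: L2R_def sqint_def)

lemma in_V_V0: "in_V f \<Longrightarrow> in_V (V0 P0 f)"
proof -
  assume "in_V f"
  then obtain n c P Q where f: "f = lin_comb n c P Q" unfolding in_V_def by blast
  \<comment> \<open>Splitting x as Q + (x - Q) turns the multiplier into a momentum shift of the
    state and a constant phase, which is moved into the coefficient.\<close>
  have VP: "exp (- \<i> * of_real (P0 * x)) * psiY P Q x = exp (- \<i> * of_real (P0 * Q)) * psiY (P + P0) Q x" for P Q x
  proof -
    have "exp (- \<i> * of_real (P0 * x)) * exp (- \<i> * of_real P * of_real (x - Q) - of_real ((x - Q)\<^sup>2 / 2))
       = exp (- \<i> * of_real (P0 * Q)) * exp (- \<i> * of_real (P + P0) * of_real (x - Q) - of_real ((x - Q)\<^sup>2 / 2))"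
      unfolding mult_exp_exp by (rule arg_cong[where f = exp]) (simp add: algebra_simps)
    then show ?thesis unfolding psiY_def by (metis mult.left_commute)
  qed
  have "V0 P0 f x = lin_comb n (\<lambda>k. c k * exp (- \<i> * of_real (P0 * Q k))) (\<lambda>k. P k + P0) Q x" for x
  proof -
    have "V0 P0 f x = (\<Sum>k<n. c k * (exp (- \<i> * of_real (P0 * x)) * psiY (P k) (Q k) x))"
      by (simp add: V0_def f lin_comb_def sum_distrib_left mult.left_commute)
    then show ?thesis by (simp only: VP lin_comb_def mult.assoc)
  qed
  then have "V0 P0 f = lin_comb n (\<lambda>k. c k * exp (- \<i> * of_real (P0 * Q k))) (\<lambda>k. P k + P0) Q" by blast
  then show ?thesis unfolding in_V_def by blast
qed

lemma in_V_W0: "in_V f \<Longrightarrow> in_V (W0 Q0 f)"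
proof -
  assume "in_V f"
  then obtain n c P Q where f: "f = lin_comb n c P Q" unfolding in_V_def by blast
  have "W0 Q0 f = lin_comb n c P (\<lambda>k. Q k + Q0)"
    unfolding W0_def f lin_comb_def psiY_def by (simp add: diff_diff_eq add.commute)
  then show ?thesis unfolding in_V_def by blast
qed

section \<open>The unitary extension for the parameters of the flow\<close>

context
  fixes \<alpha> t \<theta> :: real
  assumes \<alpha>: "\<alpha> > 0" and t: "0 < t" "t < pi / (2 * \<alpha>)"
    and \<theta>: "0 < \<theta>" "\<theta> < pi / 2" "tan \<theta> = \<alpha>"
begin

lemma sin_cos_flow_pos: "sin (\<alpha> * t) > 0" "cos (\<alpha> * t) > 0"
proof -
  have "0 < \<alpha> * t" "\<alpha> * t < pi / 2" using \<alpha> t by (auto simp: field_simps)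
  then show "sin (\<alpha> * t) > 0" "cos (\<alpha> * t) > 0" by (auto intro!: sin_gt_zero cos_gt_zero)
qed

definition width :: real where "width = \<alpha> * cos (\<alpha> * t) / sin (\<alpha> * t)"

text \<open>Chosen to match the amplitude of a transformed coherent state: \<open>amp\<close> times
  sqrt (2 pi / (1 + width)) is the square root of sin theta / sin (theta + alpha t).\<close>

definition amp :: real where "amp = sqrt (\<alpha> / (2 * pi * sin (\<alpha> * t)))"

definition dens :: real where "dens = sqrt (sin (\<alpha> * t) * cos (\<alpha> * t) / \<alpha>)"

definition U :: "(real \<Rightarrow> complex) \<Rightarrow> real \<times> real \<Rightarrow> complex" where
  "U f z = of_real amp * gabor width f z"

lemma width_pos: "width > 0" and amp_pos: "amp > 0" and dens_pos: "dens > 0"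
  using \<alpha> sin_cos_flow_pos by (simp_all add: width_def amp_def dens_def)

text \<open>All three factors on the left are already fixed, by the volume form, by the amplitude of
  the coherent states and by the window. That they multiply to the constant of the Schroedinger
  inner product is what makes the transform unitary: sqrt width in \<open>dens\<close> cancels
  against \<open>gconst\<close>.\<close>

lemma normalization: "dens * (amp\<^sup>2 * gconst width) = sqrt pi"
proof -
  let ?s = "sin (\<alpha> * t)" and ?c = "cos (\<alpha> * t)"
  have "?s * ?c / \<alpha> = (?s / \<alpha>)\<^sup>2 * width"
    using \<alpha> sin_cos_flow_pos by (simp add: width_def power2_eq_square field_simps)
  then have d: "dens = ?s / \<alpha> * sqrt width"
    using \<alpha> sin_cos_flow_pos by (simp add: dens_def real_sqrt_mult)
  have a: "amp\<^sup>2 = \<alpha> / (2 * pi * ?s)"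
    using \<alpha> sin_cos_flow_pos by (simp add: amp_def)
  show ?thesis
    unfolding d a gconst_def real_sqrt_divide using \<alpha> sin_cos_flow_pos width_pos by simp
qed

text \<open>The quotient of the two area forms is the positive real sin (alpha t) cos (alpha t) /
  alpha, so the principal complex root is the ordinary one.\<close>

lemma vol_density_eq: "vol_density \<alpha> t = of_real dens"
proof -
  have "(of_real c * cnj (\<i> * of_real (s / \<alpha>)) - \<i> * of_real (s / \<alpha>) * cnj (of_real c)) / (- 2 * \<i>) = complex_of_real (s * c / \<alpha>)" for s c
    by (simp add: field_simps)
  then show ?thesis
    unfolding vol_density_def Let_def dens_def using \<alpha> sin_cos_flow_pos
    by (simp only:) (simp add: csqrt_of_real_nonneg del: of_real_divide of_real_mult)
qed

lemma polarized_iff: "polarized \<alpha> t \<psi> \<longleftrightarrow> gabor_polarized width \<psi>"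
proof -
  let ?s = "sin (\<alpha> * t)" and ?c = "cos (\<alpha> * t)"
  have k: "complex_of_real (?s / \<alpha>) \<noteq> 0" using \<alpha> sin_cos_flow_pos by simp
  have c: "?c = (?s / \<alpha>) * width" using \<alpha> sin_cos_flow_pos by (simp add: width_def)
  have "Xw_x \<alpha> t * A + Xw_p \<alpha> t * B + \<i> * of_real p * Xw_x \<alpha> t * w
     = of_real (?s / \<alpha>) * (\<i> * A - of_real width * B - of_real p * w)" for A B w and p :: real
    unfolding Xw_x_def Xw_p_def c of_real_mult by (simp add: algebra_simps)
  then show ?thesis
    unfolding polarized_def gabor_polarized_def using k by (simp only: mult_eq_0_iff) simp
qed

text \<open>Because tan theta = alpha, sin (theta + alpha t) equals cos theta (sin (alpha t) + alpha
  cos (alpha t)). Hence the weights 1 / (1 + width) and width / (1 + width) of the integral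
  transform are the coefficients of the closed formula.\<close>

lemma KSH_gauss_eq: "KSH_gauss \<alpha> t P Q = U (psiY P Q)"
proof
  fix z :: "real \<times> real"
  obtain x p where z: "z = (x, p)" by (cases z)
  let ?s = "sin (\<alpha> * t)" and ?c = "cos (\<alpha> * t)" and ?S = "sin (\<theta> + \<alpha> * t)"
  have th: "sin \<theta> = \<alpha> * cos \<theta>" "cos \<theta> > 0" "sin \<theta> > 0" by (rule tan_angle[OF \<alpha> t \<theta>])+
  have S: "?S = cos \<theta> * (?s + \<alpha> * ?c)" by (simp add: sin_add th algebra_simps)
  have pos: "?s + \<alpha> * ?c > 0" using sin_cos_flow_pos \<alpha> by (simp add: add_pos_pos)
  have S0: "?S > 0" unfolding S using th pos by simp
  have w: "1 + width = (?s + \<alpha> * ?c) / ?s" using sin_cos_flow_pos by (simp add: width_def field_simps)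
  have \<mu>: "1 / (1 + width) = cos \<theta> * ?s / ?S"
    unfolding w S using th pos by simp
  have \<nu>: "width / (1 + width) = sin \<theta> * ?c / ?S"
    unfolding w S using th pos sin_cos_flow_pos by (simp add: width_def)
  have "amp * (1 / sqrt pi * sqrt (2 * pi / (1 + width))) = 1 / sqrt pi * (amp * sqrt (2 * pi / (1 + width)))"
    by simp
  also have "amp * sqrt (2 * pi / (1 + width)) = sqrt \<bar>sin \<theta> / ?S\<bar>"
  proof -
    have "amp * sqrt (2 * pi / (1 + width)) = sqrt (\<alpha> / (2 * pi * ?s) * (2 * pi * (1 / (1 + width))))"
      by (simp add: amp_def real_sqrt_mult[symmetric])
    also have "\<alpha> / (2 * pi * ?s) * (2 * pi * (1 / (1 + width))) = \<bar>sin \<theta> / ?S\<bar>"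
      unfolding \<mu> using th S0 sin_cos_flow_pos by (simp add: field_simps)
    finally show ?thesis .
  qed
  finally have amp: "complex_of_real amp * of_real (1 / sqrt pi * sqrt (2 * pi / (1 + width))) = of_real (1 / sqrt pi * sqrt \<bar>sin \<theta> / ?S\<bar>)"
    by (simp only: of_real_mult[symmetric])
  have e: "(of_real (- (1 / (1 + width)) * (p - P)\<^sup>2 - width / (1 + width) * (x - Q)\<^sup>2)
         - 2 * \<i> * of_real (1 / (1 + width) * ((x - Q) * (p - P)))) / 2
     = (of_real (- cos \<theta> * ?s * (p - P)^2 - sin \<theta> * ?c * (x - Q)^2)
          - 2 * \<i> * of_real (cos \<theta> * ?s * (x - Q) * (p - P))) / of_real (2 * sin (\<alpha> * t + \<theta>))"
    unfolding \<mu> \<nu> add.commute[of "\<alpha> * t" \<theta>] using S0 by (simp add: divide_simps)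
  show "KSH_gauss \<alpha> t P Q z = U (psiY P Q) z"
    unfolding z KSH_gauss_formula[OF \<alpha> t \<theta>] U_def gabor_psiY[OF width_pos] e exp_add
    unfolding mult.assoc[symmetric, where a = "complex_of_real amp"] amp by (simp only: mult.assoc)
qed

text \<open>\<open>KSH\<close> chooses some representation of \<open>f\<close> as a combination of
  coherent states. Each \<open>KSH_gauss\<close> is the value of the linear map \<open>U\<close> on
  its state, so every representation leads to the same function.\<close>

lemma KSH_eq_U:
  assumes "in_V f"
  shows "KSH \<alpha> t f = U f"
proof -
  have "\<exists>g n c P Q. f = lin_comb n c P Q \<and> g = (\<lambda>z. \<Sum>k<n. c k * KSH_gauss \<alpha> t (P k) (Q k) z)"
    using assms unfolding in_V_def by blast
  from someI_ex[OF this] obtain n c P Q where f: "f = lin_comb n c P Q"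
    and K: "KSH \<alpha> t f = (\<lambda>z. \<Sum>k<n. c k * KSH_gauss \<alpha> t (P k) (Q k) z)"
    unfolding KSH_def by blast
  show ?thesis
    unfolding K unfolding f U_def[abs_def] gabor_lin_comb[OF width_pos] KSH_gauss_eq
    by (simp add: sum_distrib_left mult_ac)
qed

lemma U_isometry:
  assumes "sqint lborel f"
  shows "sqint lborel (U f)" "l2 lborel (U f) = amp * sqrt (gconst width) * l2 lborel f"
  using gabor_isometry[OF width_pos assms] amp_pos
  by (simp_all add: U_def[abs_def] sqint_cmult l2_cmult)

lemma U_add_cmult:
  assumes "sqint lborel f" "sqint lborel g"
  shows "U (\<lambda>x. f x + c * g x) z = U f z + c * U g z"
  using gabor_add[OF width_pos assms(1) sqint_cmult[OF assms(2)], of c z]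
  by (simp add: U_def gabor_cmult algebra_simps)

lemma U_diff:
  assumes "sqint lborel f" "sqint lborel g"
  shows "U (\<lambda>x. f x - g x) z = U f z - U g z"
  using U_add_cmult[OF assms, of "-1" z] by simp

lemma normsq_P_nn_integral:
  assumes [measurable]: "f \<in> borel_measurable lborel"
  shows "normsq_P \<alpha> t f = ennreal dens * (\<integral>\<^sup>+ z. ennreal ((cmod (f z))\<^sup>2) \<partial>lborel)"
proof -
  have "normsq_P \<alpha> t f = (\<integral>\<^sup>+ z. ennreal dens * ennreal ((cmod (f z))\<^sup>2) \<partial>lborel)"
    unfolding normsq_P_def vol_density_eq using dens_pos
    by (intro nn_integral_cong) (simp add: ennreal_mult[symmetric] mult.commute)
  also have "\<dots> = ennreal dens * (\<integral>\<^sup>+ z. ennreal ((cmod (f z))\<^sup>2) \<partial>lborel)"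
    by (subst nn_integral_cmult) auto
  finally show ?thesis .
qed

lemma normsq_P_eq: "sqint lborel f \<Longrightarrow> normsq_P \<alpha> t f = ennreal (dens * (l2 lborel f)\<^sup>2)"
  using normsq_P_nn_integral[OF sqint_measurable] dens_pos
  by (simp only: nn_integral_l2) (simp add: ennreal_mult)

lemma sqintI_normsq_P:
  assumes f: "f \<in> borel_measurable lborel" and fin: "normsq_P \<alpha> t f < \<infinity>"
  shows "sqint lborel f"
  using fin dens_pos unfolding normsq_P_nn_integral[OF f]
  by (intro sqintI_nn_integral[OF f]) (auto simp: ennreal_mult_less_top)

lemma U_in_S_pol:
  assumes "in_V f"
  shows "U f \<in> S_pol \<alpha> t"
proof -
  obtain n c P Q where f: "f = lin_comb n c P Q" using assms unfolding in_V_def by blast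
  have U: "U f = (\<lambda>z. of_real amp * (\<Sum>k<n. c k * gabor width (psiY (P k) (Q k)) z))"
    unfolding U_def[abs_def] f gabor_lin_comb[OF width_pos] ..
  have "smooth2 (U f)"
    unfolding U by (intro smooth2_mult smooth2_const smooth2_sum smooth2_gabor_psiY width_pos)
  moreover have "polarized \<alpha> t (U f)"
    unfolding U polarized_iff by (intro gabor_polarized_cmult gabor_polarized_sum gabor_polarized_psiY width_pos)
  moreover have "normsq_P \<alpha> t (U f) < \<infinity>"
    using normsq_P_eq[OF U_isometry(1)[OF in_V_sqint[OF assms]]] by simp
  ultimately show ?thesis by (simp add: S_pol_def)
qed

text \<open>The approximants of \<open>f\<close> from the span have smooth polarized images, and the
  isometry carries their convergence over to the weighted norm.\<close>

lemma U_in_H_P: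
  assumes f: "sqint lborel f"
  shows "U f \<in> H_P \<alpha> t"
proof -
  obtain g where g: "\<And>n. in_V (g n)" and lim: "(\<lambda>n. l2 lborel (\<lambda>x. g n x - f x)) \<longlonglongrightarrow> 0"
    by (rule V_dense_seq[OF f]) (rule that)
  have gs: "sqint lborel (g n)" for n by (rule in_V_sqint[OF g])
  let ?k = "dens * (amp * sqrt (gconst width))\<^sup>2"
  have "normsq_P \<alpha> t (\<lambda>z. U (g n) z - U f z) = ennreal (?k * (l2 lborel (\<lambda>x. g n x - f x))\<^sup>2)" for n
    using normsq_P_eq[OF U_isometry(1)[OF sqint_diff[OF gs[of n] f]]] U_isometry(2)[OF sqint_diff[OF gs[of n] f]]
    unfolding U_diff[OF gs[of n] f, abs_def] by (simp add: power_mult_distrib mult.assoc)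
  moreover have "(\<lambda>n. ennreal (?k * (l2 lborel (\<lambda>x. g n x - f x))\<^sup>2)) \<longlonglongrightarrow> ennreal (?k * 0\<^sup>2)"
    by (intro tendsto_ennrealI tendsto_intros lim)
  ultimately have "(\<lambda>n. normsq_P \<alpha> t (\<lambda>z. U (g n) z - U f z)) \<longlonglongrightarrow> 0" by simp
  moreover have "U f \<in> borel_measurable lborel" using U_isometry(1)[OF f] by (simp add: sqint_def)
  ultimately show ?thesis
    unfolding H_P_def using U_in_S_pol[OF g] by (auto intro!: exI[of _ "\<lambda>n. U (g n)"])
qed

text \<open>Polarization turns the norm identity for all \<open>f + c * g\<close> into one for inner
  products with the factor \<open>?K\<close> squared; \<open>normalization\<close> identifies that
  factor times the density as sqrt pi.\<close>

lemma U_inner: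
  assumes f: "sqint lborel f" and g: "sqint lborel g"
  shows "ip_P \<alpha> t (U f) (U g) = ip_Sch f g"
proof -
  let ?K = "amp * sqrt (gconst width)"
  have K: "(l2 lborel (\<lambda>z. U f z + c * U g z))\<^sup>2 = ?K\<^sup>2 * (l2 lborel (\<lambda>x. f x + c * g x))\<^sup>2" for c
    using U_isometry(2)[OF sqint_add[OF f sqint_cmult[OF g, of c]]]
    unfolding U_add_cmult[OF f g, abs_def] by (simp only: power_mult_distrib)
  have K1: "(l2 lborel (\<lambda>z. U f z + U g z))\<^sup>2 = ?K\<^sup>2 * (l2 lborel (\<lambda>x. f x + g x))\<^sup>2"
    using K[of 1] by simp
  have "(LINT z|lborel. cnj (U f z) * U g z) = of_real (?K\<^sup>2) * (LINT x|lborel. cnj (f x) * g x)"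
    unfolding inner_polarization[OF U_isometry(1)[OF f] U_isometry(1)[OF g]] inner_polarization[OF f g] K K1
    by (simp add: right_diff_distrib algebra_simps)
  then have "ip_P \<alpha> t (U f) (U g) = of_real (?K\<^sup>2 * dens) * (LINT x|lborel. cnj (f x) * g x)"
    unfolding ip_P_def vol_density_eq by simp
  also have "?K\<^sup>2 * dens = sqrt pi"
    using normalization gconst_pos[OF width_pos] by (simp add: power_mult_distrib mult.commute)
  finally show ?thesis unfolding ip_Sch_def .
qed

text \<open>The weighted norm takes values in the extended reals, so convergence to 0 makes only a
  tail of the differences square integrable. Shifting the index past that point gives a sequence in
  L2, and then \<open>g\<close> is a difference of two square integrable functions.\<close>

lemma H_P_E:
  assumes "g \<in> H_P \<alpha> t"
  obtains \<psi> where "\<And>n. gabor_polarized width (\<psi> n)" "\<And>n. sqint lborel (\<psi> n)" "sqint lborel g"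
    "(\<lambda>n. l2 lborel (\<lambda>z. \<psi> n z - g z)) \<longlonglongrightarrow> 0"
proof -
  obtain \<psi> where gm: "g \<in> borel_measurable lborel" and S: "\<And>n. \<psi> n \<in> S_pol \<alpha> t"
    and lim: "(\<lambda>n. normsq_P \<alpha> t (\<lambda>z. \<psi> n z - g z)) \<longlonglongrightarrow> 0"
    using assms unfolding H_P_def by blast
  have pol: "gabor_polarized width (\<psi> n)" for n
    using S[of n] by (simp add: S_pol_def polarized_iff)
  have \<psi>m: "\<psi> n \<in> borel_measurable lborel" for n
    using borel_measurable_continuous_onI[OF gabor_polarized_continuous[OF pol[of n]]] by simp
  have \<psi>s: "sqint lborel (\<psi> n)" for n
    using S[of n] by (intro sqintI_normsq_P \<psi>m) (simp add: S_pol_def)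
  have "\<forall>\<^sub>F n in sequentially. normsq_P \<alpha> t (\<lambda>z. \<psi> n z - g z) < 1"
    using lim by (rule order_tendstoD(2)) simp
  then obtain N where N: "\<And>n. n \<ge> N \<Longrightarrow> normsq_P \<alpha> t (\<lambda>z. \<psi> n z - g z) < 1"
    unfolding eventually_sequentially by blast
  have dm: "(\<lambda>z. \<psi> n z - g z) \<in> borel_measurable lborel" for n using \<psi>m gm by measurable
  have ds: "sqint lborel (\<lambda>z. \<psi> (n + N) z - g z)" for n
    using N[of "n + N"] by (intro sqintI_normsq_P dm) (auto intro: less_trans)
  have gs: "sqint lborel g"
    using sqint_diff[OF \<psi>s[of "0 + N"] ds[of 0]] by simp
  have "(\<lambda>n. normsq_P \<alpha> t (\<lambda>z. \<psi> (n + N) z - g z)) \<longlonglongrightarrow> 0"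
    using lim by (rule LIMSEQ_ignore_initial_segment)
  then have "(\<lambda>n. ennreal (dens * (l2 lborel (\<lambda>z. \<psi> (n + N) z - g z))\<^sup>2)) \<longlonglongrightarrow> ennreal 0"
    by (simp add: normsq_P_eq[OF ds])
  then have "(\<lambda>n. dens * (l2 lborel (\<lambda>z. \<psi> (n + N) z - g z))\<^sup>2) \<longlonglongrightarrow> 0"
    using dens_pos by (subst (asm) tendsto_ennreal_iff) auto
  then have "(\<lambda>n. (1 / dens) * (dens * (l2 lborel (\<lambda>z. \<psi> (n + N) z - g z))\<^sup>2)) \<longlonglongrightarrow> (1 / dens) * 0"
    by (intro tendsto_intros)
  then have "(\<lambda>n. (l2 lborel (\<lambda>z. \<psi> (n + N) z - g z))\<^sup>2) \<longlonglongrightarrow> 0"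
    using dens_pos by simp
  from tendsto_real_sqrt[OF this] have "(\<lambda>n. l2 lborel (\<lambda>z. \<psi> (n + N) z - g z)) \<longlonglongrightarrow> 0"
    by simp
  then show ?thesis using that[of "\<lambda>n. \<psi> (n + N)"] pol \<psi>s gs by blast
qed

text \<open>Every polarized approximant has an exact preimage; by the isometry these preimages are
  Cauchy, and their limit is mapped to the limit of the approximants. The completion identifies
  functions almost everywhere, so equality holds in that sense.\<close>

lemma U_surj:
  assumes "g \<in> H_P \<alpha> t"
  shows "\<exists>f. sqint lborel f \<and> (AE z in lborel. U f z = g z)"
proof -
  obtain \<psi> where pol: "\<And>n. gabor_polarized width (\<psi> n)" and \<psi>s: "\<And>n. sqint lborel (\<psi> n)" and gs: "sqint lborel g"
    and lim: "(\<lambda>n. l2 lborel (\<lambda>z. \<psi> n z - g z)) \<longlonglongrightarrow> 0"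
    by (rule H_P_E[OF assms]) (rule that)
  have "\<exists>f. sqint lborel f \<and> gabor width f = \<psi> n" for n
    using gabor_surj_polarized[OF width_pos pol \<psi>s] by metis
  then obtain f where fs: "\<And>n. sqint lborel (f n)" and f\<psi>: "\<And>n. gabor width (f n) = \<psi> n" by metis
  define s where "s = sqrt (gconst width)"
  have s: "s > 0" using gconst_pos[OF width_pos] by (simp add: s_def)
  have iso: "s * l2 lborel (\<lambda>x. h x - k x) = l2 lborel (\<lambda>z. gabor width h z - gabor width k z)"
    if "sqint lborel h" "sqint lborel k" for h k
    using gabor_isometry(2)[OF width_pos sqint_diff[OF that]]
    unfolding gabor_diff[OF width_pos that, abs_def] by (simp add: s_def)
  have "\<exists>h. sqint lborel h \<and> (\<lambda>n. l2 lborel (\<lambda>x. f n x - h x)) \<longlonglongrightarrow> 0"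
  proof (rule l2_complete[OF fs])
    fix e :: real assume e: "e > 0"
    obtain N where N: "\<And>n. n \<ge> N \<Longrightarrow> l2 lborel (\<lambda>z. \<psi> n z - g z) < s * e / 2"
      using LIMSEQ_D[OF lim, of "s * e / 2"] e s by auto
    show "\<exists>N. \<forall>m\<ge>N. \<forall>n\<ge>N. l2 lborel (\<lambda>x. f m x - f n x) < e"
    proof (intro exI allI impI)
      fix m n assume mn: "N \<le> m" "N \<le> n"
      have "s * l2 lborel (\<lambda>x. f m x - f n x) < s * e"
        unfolding iso[OF fs fs] f\<psi>
        using l2_triangle_diff[OF \<psi>s[of m] gs \<psi>s[of n]] N[OF mn(1)] N[OF mn(2)]
          l2_minus_commute[of lborel g "\<psi> n"] by linarith
      then show "l2 lborel (\<lambda>x. f m x - f n x) < e" using s by simp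
    qed
  qed
  then obtain h where h: "sqint lborel h" and hlim: "(\<lambda>n. l2 lborel (\<lambda>x. f n x - h x)) \<longlonglongrightarrow> 0" by blast
  have hs: "sqint lborel (gabor width h)" by (rule gabor_isometry(1)[OF width_pos h])
  have "l2 lborel (\<lambda>z. gabor width h z - g z) \<le> s * l2 lborel (\<lambda>x. f n x - h x) + l2 lborel (\<lambda>z. \<psi> n z - g z)" for n
    unfolding iso[OF fs h] f\<psi>
    using l2_triangle_diff[OF hs \<psi>s[of n] gs] l2_minus_commute[of lborel "\<psi> n" "gabor width h"] by simp
  moreover have "(\<lambda>n. s * l2 lborel (\<lambda>x. f n x - h x) + l2 lborel (\<lambda>z. \<psi> n z - g z)) \<longlonglongrightarrow> s * 0 + 0"
    by (intro tendsto_intros hlim lim)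
  ultimately have "l2 lborel (\<lambda>z. gabor width h z - g z) \<le> s * 0 + 0"
    by (intro LIMSEQ_le_const) auto
  then have "l2 lborel (\<lambda>z. gabor width h z - g z) = 0"
    using l2_nonneg[of lborel "\<lambda>z. gabor width h z - g z"] by linarith
  from l2_eq_0_AE[OF sqint_diff[OF hs gs] this] have ae: "AE z in lborel. gabor width h z = g z" by simp
  have "U (\<lambda>x. of_real (1 / amp) * h x) z = gabor width h z" for z
    unfolding U_def gabor_cmult using amp_pos by simp
  with ae sqint_cmult[OF h, of "of_real (1 / amp)"] show ?thesis
    by (intro exI[of _ "\<lambda>x. of_real (1 / amp) * h x"]) simp
qed

lemma unitary_U: "unitary_ext \<alpha> t U"
  unfolding unitary_ext_def L2R_iff_sqint[abs_def]
proof (intro conjI ballI allI impI)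
  show "U f \<in> H_P \<alpha> t" if "f \<in> L2R" for f using that U_in_H_P by (simp add: L2R_iff_sqint)
  show "AE z in lborel. U (\<lambda>x. f x + c * g x) z = U f z + c * U g z" if "f \<in> L2R" "g \<in> L2R" for f g c
    using that by (simp add: L2R_iff_sqint U_add_cmult)
  show "ip_P \<alpha> t (U f) (U g) = ip_Sch f g" if "f \<in> L2R" "g \<in> L2R" for f g
    using that by (simp add: L2R_iff_sqint U_inner)
  show "\<exists>f\<in>L2R. AE z in lborel. U f z = g z" if "g \<in> H_P \<alpha> t" for g
    using U_surj[OF that] by (auto simp: L2R_iff_sqint Bex_def)
  show "AE z in lborel. U f z = KSH \<alpha> t f z" if "in_V f" for f
    by (simp add: KSH_eq_U[OF that])
qed

lemma U_V0: "U (V0 P0 f) = Vtau P0 (U f)"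
  unfolding U_def[abs_def] gabor_V0 by (simp add: fun_eq_iff Vtau_def)

lemma U_W0: "U (W0 Q0 f) = Wtau Q0 (U f)"
  unfolding U_def[abs_def] gabor_W0 by (simp add: fun_eq_iff Wtau_def)

end

section \<open>Density in the Schroedinger norm and conclusion\<close>

lemma V_dense_normsq:
  assumes "f \<in> L2R" "e > 0"
  shows "\<exists>g. in_V g \<and> normsq_Sch (\<lambda>x. f x - g x) < e"
proof -
  have f: "sqint lborel f" using assms(1) by (simp add: L2R_iff_sqint)
  \<comment> \<open>The bound \<open>e\<close> is an extended real and may be infinite; a positive
    real below it is what the density lemma can work with.\<close>
  obtain r where r: "r > 0" "ennreal r \<le> e"
  proof (cases e)
    case (real r)
    then show ?thesis using assms(2) that[of r] by auto
  next
    case top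
    then show ?thesis using that[of 1] by simp
  qed
  define d where "d = sqrt (r / sqrt pi)"
  have d: "d > 0" using r by (simp add: d_def)
  obtain g where g: "in_V g" "l2 lborel (\<lambda>x. f x - g x) < d" by (rule V_dense[OF f d])
  have "(l2 lborel (\<lambda>x. f x - g x))\<^sup>2 < d\<^sup>2" using g(2) by (intro power_strict_mono) auto
  also have "d\<^sup>2 = r / sqrt pi" using r by (simp add: d_def)
  finally have "sqrt pi * (l2 lborel (\<lambda>x. f x - g x))\<^sup>2 < r" by (simp add: field_simps)
  then have "ennreal (sqrt pi * (l2 lborel (\<lambda>x. f x - g x))\<^sup>2) < ennreal r" using r by (simp add: ennreal_lessI)
  moreover have "normsq_Sch (\<lambda>x. f x - g x) = ennreal (sqrt pi * (l2 lborel (\<lambda>x. f x - g x))\<^sup>2)"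
    unfolding normsq_Sch_def nn_integral_l2[OF sqint_diff[OF f in_V_sqint[OF g(1)]]]
    by (rule ennreal_mult[symmetric]) auto
  ultimately show ?thesis using g(1) r(2) by (auto intro: less_le_trans)
qed

theorem theorem4p1:
  fixes \<alpha> t \<theta> :: real
  assumes "\<alpha> > 0"
    and "0 < t" and "t < pi / (2 * \<alpha>)"
    and "0 < \<theta>" and "\<theta> < pi / 2" and "tan \<theta> = \<alpha>"
  shows
    \<comment> \<open>(a) intertwining\<close>
    "(\<forall>f P0. in_V f \<longrightarrow> KSH \<alpha> t (V0 P0 f) = Vtau P0 (KSH \<alpha> t f)) \<and>
     (\<forall>f Q0. in_V f \<longrightarrow> KSH \<alpha> t (W0 Q0 f) = Wtau Q0 (KSH \<alpha> t f)) \<and>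
     \<comment> \<open>(b) V dense in L^2 and U extends by continuity to a unitary isomorphism\<close>
     (\<forall>f\<in>L2R. \<forall>e>0. \<exists>g. in_V g \<and> normsq_Sch (\<lambda>x. f x - g x) < e) \<and>
     (\<exists>T. unitary_ext \<alpha> t T) \<and>
     \<comment> \<open>(c) explicit formula\<close>
     (\<forall>P Q x p.
        KSH_gauss \<alpha> t P Q (x, p) =
          of_real (1 / sqrt pi * sqrt \<bar>sin \<theta> / sin (\<theta> + \<alpha> * t)\<bar>) *
          exp (- integral {0..t} (\<lambda>s. L_H \<alpha> (p_is \<alpha> s x p) (x_is \<alpha> s x p)
                                      - L_H \<alpha> (p_is \<alpha> s Q P) (x_is \<alpha> s Q P))) *
          exp (- \<i> * p_is \<alpha> t Q P * (w_tau \<alpha> t x p - x_is \<alpha> t Q P)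
               - of_real (\<alpha> * cot (\<theta> + \<alpha> * t)) / 2 * (w_tau \<alpha> t x p - x_is \<alpha> t Q P)^2) \<and>
        KSH_gauss \<alpha> t P Q (x, p) =
          of_real (1 / sqrt pi * sqrt \<bar>sin \<theta> / sin (\<theta> + \<alpha> * t)\<bar>) *
          exp (- \<i> * of_real (P * (x - Q))) *
          exp ((of_real (- cos \<theta> * sin (\<alpha> * t) * (p - P)^2 - sin \<theta> * cos (\<alpha> * t) * (x - Q)^2)
                - 2 * \<i> * of_real (cos \<theta> * sin (\<alpha> * t) * (x - Q) * (p - P)))
               / of_real (2 * sin (\<alpha> * t + \<theta>))))"
proof (intro conjI allI impI ballI)
  show "KSH \<alpha> t (V0 P0 f) = Vtau P0 (KSH \<alpha> t f)" if "in_V f" for f P0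
    unfolding KSH_eq_U[OF assms that] KSH_eq_U[OF assms in_V_V0[OF that]] by (rule U_V0[OF assms])
  show "KSH \<alpha> t (W0 Q0 f) = Wtau Q0 (KSH \<alpha> t f)" if "in_V f" for f Q0
    unfolding KSH_eq_U[OF assms that] KSH_eq_U[OF assms in_V_W0[OF that]] by (rule U_W0[OF assms])
  show "\<exists>g. in_V g \<and> normsq_Sch (\<lambda>x. f x - g x) < e" if "f \<in> L2R" "0 < e" for f e
    by (rule V_dense_normsq[OF that])
  show "\<exists>T. unitary_ext \<alpha> t T"
    using unitary_U[OF assms] by blast
qed (rule KSH_gauss_formula_flow[OF assms] KSH_gauss_formula[OF assms])+

end
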